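(* Let $n\ge2$, $\boldsymbol{\gamma}\in\mathbb{C}^n$ with $\Re(\gamma_j)>0$ for all $j$, and $\mathbf b\in\mathbb C^n$ with $\Re(b_j)>-\Re(\gamma_1)$ for all $j$, $b_n-b_{n-1}\notin(-\infty,0]$, $(b_n-b_{n-1})/\gamma_n\notin(-\infty,0]$. Let $\boldsymbol{\mu}_{n-2}\in(\mathbb{T}\setminus\{1\})^{n-2}$. Then $\zeta_{n,n-2}(\mathbf{s},\boldsymbol{\gamma},\mathbf{b},\boldsymbol{\mu}_{n-2})$ has a meromorphic continuation to $\mathbb{C}^n$ whose possible singularities lie only on the hyperplanes $s_n=1$ and $s_{n-1}+s_n=k$ ($k\in\mathbb{Z}$, $k\le2$). Furthermore, for every $\mathbf N\in\mathbb N_0^n$, as $\boldsymbol\delta=(\delta_1,\dots,\delta_n)\to(0,\dots,0)$ with $\delta_{n-1}+\delta_n\neq0$, $$\zeta_{n,n-2}(-\mathbf{N}+\boldsymbol{\delta},\boldsymbol{\gamma},\mathbf{b},\boldsymbol{\mu}_{n-2})=-\frac{1}{N_n+1}\zeta_{n-1,n-2}(-\mathbf{N}^*_{n-1}(1),\boldsymbol{\gamma}_{n-1},\mathbf{b}_{n-1},\boldsymbol{\mu}_{n-2})\gamma_n^{-1}$$ $$+\sum_{l=0}^{N_n}\binom{N_n}{l}\zeta_{n-1,n-2}(-\mathbf{N}^*_{n-1}(-l),\boldsymbol{\gamma}_{n-1},\mathbf{b}_{n-1},\boldsymbol{\mu}_{n-2})\,\zeta\!\left(-l,\frac{b_n-b_{n-1}}{\gamma_n}\right)\gamma_n^l$$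 $$+\frac{(-1)^{N_{n-1}+1}N_n!\,N_{n-1}!}{(N_{n-1}+N_n+1)!}\cdot\frac{\epsilon(\delta_n)}{\delta_{n-1}+\delta_n}\cdot\zeta_{n-2,n-2}(-\mathbf N_{n-2}+\boldsymbol\delta_{n-2},\boldsymbol{\gamma}_{n-2},\mathbf{b}_{n-2},\boldsymbol{\mu}_{n-2})$$ $$\times\zeta\!\left(-N_{n-1}-N_n-1,\frac{b_n-b_{n-1}}{\gamma_n}\right)\gamma_{n-1}^{-1}\gamma_n^{N_{n-1}+N_n+1}+O\Big(\max_{1\le j\le n}|\delta_j|\Big),$$ where $\epsilon(\delta_n)$ is a function of $\delta_n$ alone satisfying $\epsilon(\delta_n)=\delta_n+O(\delta_n^2)$, and for $n=2$ one sets $\zeta_{0,0}\equiv1$.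
   Context: $\mathbb{T}=\{z\in\mathbb{C}:|z|=1\}$; principal branches for all powers. For $0\le k\le n$ and $\boldsymbol\mu_k\in(\mathbb T\setminus\{1\})^k$, $\zeta_{n,k}(\mathbf{s},\boldsymbol{\gamma},\mathbf{b},\boldsymbol{\mu}_k)=\sum_{m_1\geq1,\ m_2,\dots,m_n\geq0}\prod_{j=1}^k\mu_j^{m_j}\big/\prod_{j=1}^n(\gamma_1m_1+\cdots+\gamma_jm_j+b_j)^{s_j}$ (numerator $1$ if $k=0$), absolutely convergent when $\Re(s_j+\cdots+s_n)>n+1-j$ for all $j$ and meromorphically continued otherwise. For a vector $\mathbf v$, $\mathbf v_k$ denotes its first $k$ coordinates. $\mathbf N^*_{n-1}(l)=(N_1,\dots,N_{n-2},N_{n-1}+N_n+l)$ for $l\in\mathbb Z$. $\zeta(s,a)=\sum_{m\ge0}(m+a)^{-s}$ is the Hurwitz zeta-function (complex $a\notin(-\infty,0]$, continued meromorphically in $s$). *)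

theory Defs
  imports "HOL-Analysis.Analysis"
begin

text \<open>Points of C^n are represented as functions nat \<Rightarrow> complex that vanish outside
  the index range {1..n}; the type nat \<Rightarrow> complex carries the product topology
  (HOL-Analysis Function_Topology), which on this subspace is the usual topology of C^n.\<close>

definition cn :: "nat \<Rightarrow> (nat \<Rightarrow> complex) set" where
  "cn n = {s. \<forall>j. j \<notin> {1..n} \<longrightarrow> s j = 0}"

definition rst :: "nat \<Rightarrow> (nat \<Rightarrow> 'a::zero) \<Rightarrow> nat \<Rightarrow> 'a" where
  "rst k v = (\<lambda>j. if j \<in> {1..k} then v j else 0)"

text \<open>Holomorphy in several complex variables (Osgood): continuous and holomorphic
  in each variable separately.\<close>
definition holo_n :: "nat \<Rightarrow> ((nat \<Rightarrow> complex) \<Rightarrow> complex) \<Rightarrow> (nat \<Rightarrow> complex) set \<Rightarrow> bool" where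
  "holo_n n F U \<longleftrightarrow> continuous_on U F \<and>
     (\<forall>s\<in>U. \<forall>j\<in>{1..n}. (\<lambda>z. F (s(j := z))) field_differentiable (at (s j)))"

definition conv_region :: "nat \<Rightarrow> (nat \<Rightarrow> complex) set" where
  "conv_region n = {s \<in> cn n. \<forall>j\<in>{1..n}. Re (\<Sum>i=j..n. s i) > real (n + 1 - j)}"

definition idx :: "nat \<Rightarrow> (nat \<Rightarrow> nat) set" where
  "idx n = {m. m 1 \<ge> 1 \<and> (\<forall>j. j \<notin> {1..n} \<longrightarrow> m j = 0)}"

definition zeta_term ::
  "nat \<Rightarrow> nat \<Rightarrow> (nat \<Rightarrow> complex) \<Rightarrow> (nat \<Rightarrow> complex) \<Rightarrow> (nat \<Rightarrow> complex)
     \<Rightarrow> (nat \<Rightarrow> complex) \<Rightarrow> (nat \<Rightarrow> nat) \<Rightarrow> complex" where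
  "zeta_term n k \<gamma> b \<mu> s m =
     (\<Prod>j=1..k. \<mu> j ^ m j) /
     (\<Prod>j=1..n. ((\<Sum>i=1..j. \<gamma> i * of_nat (m i)) + b j) powr s j)"

definition zeta_series ::
  "nat \<Rightarrow> nat \<Rightarrow> (nat \<Rightarrow> complex) \<Rightarrow> (nat \<Rightarrow> complex) \<Rightarrow> (nat \<Rightarrow> complex)
     \<Rightarrow> (nat \<Rightarrow> complex) \<Rightarrow> complex" where
  "zeta_series n k \<gamma> b \<mu> s = (\<Sum>\<^sub>\<infinity>m\<in>idx n. zeta_term n k \<gamma> b \<mu> s m)"

text \<open>Value of the (meromorphic) continuation of zeta_{n,k} at a point s where it is
  holomorphic: the value at s of any holomorphic function on a connected open subset of
  C^n containing s which agrees with the series on the (nonempty) part of its domain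
  lying in the region of absolute convergence. Convention zeta_{0,0} = 1.\<close>
definition zeta_cont ::
  "nat \<Rightarrow> nat \<Rightarrow> (nat \<Rightarrow> complex) \<Rightarrow> (nat \<Rightarrow> complex) \<Rightarrow> (nat \<Rightarrow> complex)
     \<Rightarrow> (nat \<Rightarrow> complex) \<Rightarrow> complex" where
  "zeta_cont n k \<gamma> b \<mu> s =
     (if n = 0 then 1 else
      (THE v. \<exists>U F. U \<subseteq> cn n \<and> openin (top_of_set (cn n)) U \<and> connected U \<and> s \<in> U \<and>
          holo_n n F U \<and> U \<inter> conv_region n \<noteq> {} \<and>
          (\<forall>t\<in>U \<inter> conv_region n. F t = zeta_series n k \<gamma> b \<mu> t) \<and> F s = v))"

definition hurwitz_zeta :: "complex \<Rightarrow> complex \<Rightarrow> complex" where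
  "hurwitz_zeta s a =
     (THE v. \<exists>U F. open U \<and> connected U \<and> s \<in> U \<and> F holomorphic_on U \<and>
        U \<inter> {z. Re z > 1} \<noteq> {} \<and>
        (\<forall>z\<in>U. Re z > 1 \<longrightarrow> F z = (\<Sum>m. (of_nat m + a) powr (- z))) \<and> F s = v)"

text \<open>Meromorphy on C^n of a function holomorphic on H: locally a quotient g/h of
  holomorphic functions with h not identically zero.\<close>
definition meromorphic_n :: "nat \<Rightarrow> ((nat \<Rightarrow> complex) \<Rightarrow> complex) \<Rightarrow> (nat \<Rightarrow> complex) set \<Rightarrow> bool" where
  "meromorphic_n n F H \<longleftrightarrow>
     (\<forall>p\<in>cn n. \<exists>V g h. openin (top_of_set (cn n)) V \<and> p \<in> V \<and> connected V \<and>
        holo_n n g V \<and> holo_n n h V \<and> (\<exists>x\<in>V. h x \<noteq> 0) \<and>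
        (\<forall>x\<in>V \<inter> H. F x * h x = g x))"

definition Nstar :: "nat \<Rightarrow> (nat \<Rightarrow> nat) \<Rightarrow> int \<Rightarrow> nat \<Rightarrow> int" where
  "Nstar n N l = (\<lambda>j. if j \<in> {1..n-2} then int (N j)
                      else if j = n - 1 then int (N (n-1)) + int (N n) + l else 0)"

definition nonpos_real :: "complex set" where
  "nonpos_real = {z. Im z = 0 \<and> Re z \<le> 0}"

end

theory Submission
  imports Defs "HOL-Complex_Analysis.Complex_Analysis"
begin

text \<open>Put \<open>X = \<gamma>\<^sub>1 m\<^sub>1 + \<dots> + \<gamma>\<^bsub>n-1\<^esub> m\<^bsub>n-1\<^esub> + b\<^bsub>n-1\<^esub>\<close> and \<open>\<beta> = b\<^sub>n - b\<^bsub>n-1\<^esub>\<close>. The difference equation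
  \<open>P(X) - \<mu>\<^sub>n P(X + \<gamma>\<^sub>n) = (X + \<beta>)\<^bsup>-s\<^esup>\<close> is solved up to \<open>O(X\<^bsup>-s-L\<^esup>)\<close> by a finite combination of powers
  \<open>X\<^bsup>1-s-r\<^esup>\<close>, with coefficients given by the values of a Lerch or Hurwitz zeta function at nonpositive
  integers. Summing over \<open>m\<^sub>n\<close> telescopes, which expresses the zeta function in \<open>n\<close> variables by
  those in \<open>n - 1\<close> variables at \<open>(s\<^sub>1, \<dots>, s\<^bsub>n-1\<^esub> + s\<^sub>n + r - 1)\<close> plus a series that converges absolutely in a region
  growing with \<open>L\<close>; the identity theorem glues these continuations together. A twisted variable
  (\<open>\<mu>\<^sub>n \<noteq> 1\<close>) creates no pole, an untwisted one the simple pole \<open>s\<^sub>n = 1\<close>; two untwisted variables in a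
  row create the poles \<open>s\<^bsub>n-1\<^esub> + s\<^sub>n = 2 - r\<close>. At a nonpositive integer point all terms but one are
  holomorphic, the error series vanishes because the expansion is a finite identity between
  polynomials, and the exceptional term is a binomial coefficient vanishing at \<open>\<delta>\<^sub>n = 0\<close> times the
  zeta function in \<open>n - 1\<close> variables at distance \<open>\<delta>\<^bsub>n-1\<^esub> + \<delta>\<^sub>n\<close> from its pole.\<close>

subsection \<open>Separately holomorphic functions\<close>

text \<open>The full expansion in powers of X need not terminate or converge, so each truncation
  continues the function only on a region growing with \<open>L\<close>. Comparing truncations off
  the poles would require connectedness of complements of hyperplanes; instead numerators are
  compared after cross-multiplication, on sets known to be connected. The same device makes
  \<open>zeta_cont\<close> single-valued: any competing continuation, multiplied by the linear
  factor that clears the pole, agrees with one entire function, so monodromy cannot arise. Twists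
  are allowed to be 1 throughout. One induction therefore yields the entire twisted functions, the
  cleared function with one untwisted variable, and its residue. The coefficients \<open>q l\<close>
  are fixed by a recursion with parameter \<beta>/\<gamma>; the one-dimensional case of the same
  expansion identifies them with the Hurwitz values at \<open>- l\<close>. The factor
  \<open>\<delta> n / (\<delta> (n-1) + \<delta> n)\<close> can be arbitrarily large, which is why
  the residue in the exceptional term is evaluated at the perturbed point and not at its
  limit.\<close>

definition polydisc :: "nat \<Rightarrow> (nat \<Rightarrow> complex) \<Rightarrow> real \<Rightarrow> (nat \<Rightarrow> complex) set" where
  "polydisc n p r = {x \<in> cn n. \<forall>j\<in>{1..n}. cmod (x j - p j) < r}"

lemma cn_upd: "s \<in> cn n \<Longrightarrow> j \<in> {1..n} \<Longrightarrow> s(j := z) \<in> cn n"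
  by (auto simp: cn_def)

lemma cn_eqI:
  assumes "x \<in> cn n" "y \<in> cn n" "\<And>j. j \<in> {1..n} \<Longrightarrow> x j = y j"
  shows "x = y"
proof
  fix j show "x j = y j"
    by (cases "j \<in> {1..n}") (use assms in \<open>auto simp: cn_def\<close>)
qed

lemma rst_cn: "rst n v \<in> cn n"
  by (simp add: rst_def cn_def)

lemma continuous_on_coord [continuous_intros]:
  "continuous_on S (\<lambda>s::nat \<Rightarrow> complex. s j)"
  by (rule continuous_on_subset[OF continuous_on_product_coordinates]) auto

lemma openin_cn_conds:
  fixes f :: "nat \<Rightarrow> (nat \<Rightarrow> complex) \<Rightarrow> 'a::topological_space"
  assumes "finite J" "\<And>j. j \<in> J \<Longrightarrow> continuous_on UNIV (f j)" "\<And>j. j \<in> J \<Longrightarrow> open (W j)"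
  shows "openin (top_of_set (cn n)) {x \<in> cn n. \<forall>j\<in>J. f j x \<in> W j}"
proof -
  have "open (\<Inter>j\<in>J. f j -` W j)"
    using assms by (intro open_INT ballI open_vimage) auto
  moreover have "{x \<in> cn n. \<forall>j\<in>J. f j x \<in> W j} = cn n \<inter> (\<Inter>j\<in>J. f j -` W j)"
    by auto
  ultimately show ?thesis by (auto simp: openin_open)
qed

lemma openin_cn_cond:
  assumes "continuous_on UNIV f" "open W"
  shows "openin (top_of_set (cn n)) {x \<in> cn n. f x \<in> W}"
proof -
  have "open (f -` W)" by (rule open_vimage[OF assms(2,1)])
  moreover have "{x \<in> cn n. f x \<in> W} = cn n \<inter> f -` W" by auto
  ultimately show ?thesis by (auto simp: openin_open)
qed

lemma openin_polydisc: "openin (top_of_set (cn n)) (polydisc n p r)"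
proof -
  have "polydisc n p r = {x \<in> cn n. \<forall>j\<in>{1..n}. x j \<in> ball (p j) r}"
    by (auto simp: polydisc_def dist_norm norm_minus_commute)
  then show ?thesis by (simp only:) (rule openin_cn_conds, auto intro: continuous_intros)
qed

lemma polydisc_center: "p \<in> cn n \<Longrightarrow> r > 0 \<Longrightarrow> p \<in> polydisc n p r"
  by (simp add: polydisc_def)

lemma polydisc_mono: "r \<le> r' \<Longrightarrow> polydisc n p r \<subseteq> polydisc n p r'"
  by (force simp: polydisc_def)

text \<open>Off \<open>{1..n}\<close> every point of \<open>cn n\<close> has the value 0, as
  \<open>p\<close> does, so a basic open set of the product topology restricts it only through the
  coordinates \<open>1..n\<close>. The minimum of their finitely many radii works.\<close>

lemma polydisc_within:
  assumes U: "openin (top_of_set (cn n)) U" and p: "p \<in> U"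
  shows "\<exists>r>0. polydisc n p r \<subseteq> U"
proof -
  obtain T where T: "open T" "U = cn n \<inter> T" using U by (auto simp: openin_open)
  have "openin (product_topology (\<lambda>i. euclidean) UNIV) T"
    using T(1) by (simp add: open_fun_def)
  from product_topology_open_contains_basis[OF this, of p] p T
  obtain X where X: "\<And>i. p i \<in> X i" "\<And>i. open (X i)" "Pi\<^sub>E UNIV X \<subseteq> T"
    by (auto simp: PiE_UNIV_domain)
  have "\<exists>r>0. ball (p i) r \<subseteq> X i" for i
    using X(1,2) open_contains_ball by blast
  then obtain r where r: "\<And>i. r i > 0" "\<And>i. ball (p i) (r i) \<subseteq> X i" by metis
  define R where "R = Min (insert 1 (r ` {1..n}))"
  have R0: "R > 0" unfolding R_def using r(1) by auto
  have Rle: "R \<le> r i" if "i \<in> {1..n}" for i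
    unfolding R_def by (rule Min_le) (use that in auto)
  have "polydisc n p R \<subseteq> U"
  proof
    fix x assume x: "x \<in> polydisc n p R"
    have "x i \<in> X i" for i
    proof (cases "i \<in> {1..n}")
      case True
      then have "x i \<in> ball (p i) (r i)"
        using x Rle[OF True] by (force simp: polydisc_def dist_norm norm_minus_commute)
      then show ?thesis using r(2) by (meson subsetD)
    next
      case False
      then have "x i = p i" using x p T(2) by (simp add: polydisc_def cn_def)
      then show ?thesis using X(1) by simp
    qed
    then have "x \<in> T" using X(3) by (auto simp: PiE_UNIV_domain)
    then show "x \<in> U" using x T by (auto simp: polydisc_def)
  qed
  with R0 show ?thesis by blast
qed

lemma open_slice:
  assumes U: "openin (top_of_set (cn n)) U" and s: "s \<in> cn n" and j: "j \<in> {1..n}"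
  shows "open {z. s(j := z) \<in> U}"
proof -
  obtain T where T: "open T" "U = cn n \<inter> T" using U by (auto simp: openin_open)
  have "continuous_on UNIV (\<lambda>z. s(j := z))"
  proof (rule continuous_on_coordinatewise_then_product)
    show "continuous_on UNIV (\<lambda>z. (s(j := z)) i)" for i by (cases "i = j") simp_all
  qed
  then have "open ((\<lambda>z. s(j := z)) -` T)" by (rule open_vimage[OF T(1)])
  moreover have "(\<lambda>z. s(j := z)) -` T = {z. s(j := z) \<in> U}"
    using T(2) cn_upd[OF s j] by auto
  ultimately show ?thesis by simp
qed

lemma holo_nI:
  assumes "continuous_on U F"
    and "\<And>s j. s \<in> U \<Longrightarrow> j \<in> {1..n} \<Longrightarrow> (\<lambda>z. F (s(j := z))) field_differentiable (at (s j))"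
  shows "holo_n n F U"
  using assms by (simp add: holo_n_def)

lemma holo_nD:
  assumes "holo_n n F U"
  shows "continuous_on U F"
    and "\<And>s j. s \<in> U \<Longrightarrow> j \<in> {1..n} \<Longrightarrow> (\<lambda>z. F (s(j := z))) field_differentiable (at (s j))"
  using assms by (auto simp: holo_n_def)

lemma holo_n_subset: "holo_n n F U \<Longrightarrow> V \<subseteq> U \<Longrightarrow> holo_n n F V"
  unfolding holo_n_def using continuous_on_subset by blast

lemma holo_n_slice:
  assumes F: "holo_n n F U" and U: "U \<subseteq> cn n" and j: "j \<in> {1..n}"
  shows "(\<lambda>z. F (s(j := z))) holomorphic_on {z. s(j := z) \<in> U}"
proof (rule holomorphic_onI)
  fix z assume "z \<in> {z. s(j := z) \<in> U}"
  then have "(\<lambda>w. F ((s(j := z))(j := w))) field_differentiable (at ((s(j := z)) j))"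
    using holo_nD(2)[OF F _ j] by blast
  then have "(\<lambda>w. F (s(j := w))) field_differentiable (at z)" by simp
  then show "(\<lambda>w. F (s(j := w))) field_differentiable (at z within {z. s(j := z) \<in> U})"
    by (rule field_differentiable_at_within)
qed

lemma holo_n_const: "holo_n n (\<lambda>s. c) U"
  by (rule holo_nI) auto

lemma holo_n_add: "holo_n n F U \<Longrightarrow> holo_n n G U \<Longrightarrow> holo_n n (\<lambda>s. F s + G s) U"
  by (rule holo_nI, rule continuous_on_add)
     (auto intro: holo_nD(1) field_differentiable_add[OF holo_nD(2) holo_nD(2)])

lemma holo_n_mult: "holo_n n F U \<Longrightarrow> holo_n n G U \<Longrightarrow> holo_n n (\<lambda>s. F s * G s) U"
  by (rule holo_nI, rule continuous_on_mult)
     (auto intro: holo_nD(1) field_differentiable_mult[OF holo_nD(2) holo_nD(2)])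

lemma holo_n_minus: "holo_n n F U \<Longrightarrow> holo_n n (\<lambda>s. - F s) U"
  using holo_n_mult[OF holo_n_const[of n "-1" U], of F] by simp

lemma holo_n_diff: "holo_n n F U \<Longrightarrow> holo_n n G U \<Longrightarrow> holo_n n (\<lambda>s. F s - G s) U"
  using holo_n_add[OF _ holo_n_minus, of n F U G] by simp

lemma holo_n_sum:
  "(\<And>i. i \<in> I \<Longrightarrow> holo_n n (F i) U) \<Longrightarrow> holo_n n (\<lambda>s. \<Sum>i\<in>I. F i s) U"
  by (induction I rule: infinite_finite_induct) (auto intro: holo_n_const holo_n_add)

lemma holo_n_prod:
  "(\<And>i. i \<in> I \<Longrightarrow> holo_n n (F i) U) \<Longrightarrow> holo_n n (\<lambda>s. \<Prod>i\<in>I. F i s) U"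
  by (induction I rule: infinite_finite_induct) (auto intro: holo_n_const holo_n_mult)

lemma holo_n_comp:
  assumes g: "g holomorphic_on W" "open W" and F: "holo_n n F U"
    and W: "\<And>s. s \<in> U \<Longrightarrow> F s \<in> W"
  shows "holo_n n (\<lambda>s. g (F s)) U"
proof (rule holo_nI)
  show "continuous_on U (\<lambda>s. g (F s))"
    by (rule continuous_on_compose2[OF holomorphic_on_imp_continuous_on[OF g(1)] holo_nD(1)[OF F]])
       (use W in auto)
next
  fix s j assume s: "s \<in> U" and j: "j \<in> {1..n}"
  have *: "(\<lambda>z. F (s(j := z))) field_differentiable (at (s j))" by (rule holo_nD(2)[OF F s j])
  have "g field_differentiable at (F (s(j := s j)))"
    using holomorphic_on_imp_differentiable_at[OF g] W[OF s] by simp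
  from field_differentiable_compose[OF * this]
  show "(\<lambda>z. g (F (s(j := z)))) field_differentiable (at (s j))" by (simp only: o_def)
qed

lemma holo_n_divide:
  assumes "holo_n n F U" "holo_n n G U" "\<And>s. s \<in> U \<Longrightarrow> G s \<noteq> 0"
  shows "holo_n n (\<lambda>s. F s / G s) U"
proof -
  have "holo_n n (\<lambda>s. inverse (G s)) U"
    by (rule holo_n_comp[where W = "- {0}", OF _ _ assms(2)])
       (use assms(3) in \<open>auto intro!: holomorphic_intros\<close>)
  from holo_n_mult[OF assms(1) this] show ?thesis by (simp add: field_simps)
qed

lemma holo_n_coord: "holo_n n (\<lambda>s. s i) U"
proof (rule holo_nI)
  fix s j show "(\<lambda>z. (s(j := z)) i) field_differentiable (at (s j))"
    by (cases "i = j") auto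
qed (auto intro: continuous_intros)

lemma holo_n_coord_comp: "g holomorphic_on UNIV \<Longrightarrow> holo_n n (\<lambda>s. g (s i)) U"
  by (rule holo_n_comp[OF _ _ holo_n_coord, of g UNIV]) auto

lemma holo_n_local:
  assumes U: "openin (top_of_set (cn n)) U"
    and loc: "\<And>p. p \<in> U \<Longrightarrow> \<exists>V G. openin (top_of_set (cn n)) V \<and> p \<in> V \<and> holo_n n G V \<and>
                 (\<forall>s\<in>V \<inter> U. F s = G s)"
  shows "holo_n n F U"
proof (rule holo_nI)
  show "continuous_on U F"
    unfolding continuous_on_def
  proof
    fix p assume p: "p \<in> U"
    then obtain V G where V: "openin (top_of_set (cn n)) V" "p \<in> V" "holo_n n G V"
      "\<forall>s\<in>V \<inter> U. F s = G s" using loc by blast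
    obtain T where T: "open T" "V = cn n \<inter> T" using V(1) by (auto simp: openin_open)
    have Ucn: "U \<subseteq> cn n" using U openin_imp_subset by blast
    have "(G \<longlongrightarrow> G p) (at p within V)"
      using holo_nD(1)[OF V(3)] V(2) by (simp add: continuous_on_def)
    then have "(G \<longlongrightarrow> G p) (at p within (V \<inter> U))"
      by (rule tendsto_within_subset) auto
    moreover have "F p = G p" using V(2,4) p by auto
    moreover have "\<forall>\<^sub>F s in at p within (V \<inter> U). F s = G s"
      using V(4) unfolding eventually_at_topological by (intro exI[of _ UNIV]) auto
    ultimately have "(F \<longlongrightarrow> F p) (at p within (V \<inter> U))"
      by (simp add: tendsto_cong)
    moreover have "at p within (V \<inter> U) = at p within U"
      by (rule at_within_nhd[of _ T]) (use T V(2) Ucn in auto)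
    ultimately show "(F \<longlongrightarrow> F p) (at p within U)" by simp
  qed
next
  fix s j assume s: "s \<in> U" and j: "j \<in> {1..n}"
  then obtain V G where V: "openin (top_of_set (cn n)) V" "s \<in> V" "holo_n n G V"
    "\<forall>s\<in>V \<inter> U. F s = G s" using loc by blast
  have scn: "s \<in> cn n" using U openin_imp_subset s by blast
  have VU: "openin (top_of_set (cn n)) (V \<inter> U)" by (rule openin_Int[OF V(1) U])
  have "open {z. s(j := z) \<in> V \<inter> U}" by (rule open_slice[OF VU scn j])
  moreover have "s j \<in> {z. s(j := z) \<in> V \<inter> U}" using V(2) s by simp
  ultimately have ev: "\<forall>\<^sub>F z in nhds (s j). s(j := z) \<in> V \<inter> U"
    by (auto simp: eventually_nhds)
  have ev': "\<forall>\<^sub>F z in nhds (s j). G (s(j := z)) = F (s(j := z))"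
    by (rule eventually_mono[OF ev]) (use V(4) in auto)
  have "(\<lambda>z. G (s(j := z))) field_differentiable (at (s j))"
    by (rule holo_nD(2)[OF V(3) V(2) j])
  then obtain D where D: "((\<lambda>z. G (s(j := z))) has_field_derivative D) (at (s j))"
    by (auto simp: field_differentiable_def)
  have "((\<lambda>z. F (s(j := z))) has_field_derivative D) (at (s j))"
    using D DERIV_cong_ev[OF refl ev' refl] by simp
  then show "(\<lambda>z. F (s(j := z))) field_differentiable (at (s j))"
    by (auto simp: field_differentiable_def)
qed

text \<open>Local domination gives uniform convergence near each point by the M-test. Uniform limits
  keep joint continuity and, on a disc in a single coordinate, holomorphy; these are the two clauses
  of \<open>holo_n\<close>.\<close>

lemma holo_n_infsum:
  assumes V: "openin (top_of_set (cn n)) V"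
    and f: "\<And>m. m \<in> I \<Longrightarrow> holo_n n (f m) V"
    and dom: "\<And>p. p \<in> V \<Longrightarrow> \<exists>W M. openin (top_of_set (cn n)) W \<and> p \<in> W \<and> M summable_on I \<and>
                (\<forall>m\<in>I. \<forall>s\<in>W. norm (f m s) \<le> M m)"
  shows "holo_n n (\<lambda>s. \<Sum>\<^sub>\<infinity>m\<in>I. f m s) V"
proof (rule holo_n_local[OF V])
  fix p assume p: "p \<in> V"
  then obtain W M where W: "openin (top_of_set (cn n)) W" "p \<in> W" "M summable_on I"
    "\<forall>m\<in>I. \<forall>s\<in>W. norm (f m s) \<le> M m" using dom by blast
  define U where "U = W \<inter> V"
  have U: "openin (top_of_set (cn n)) U" unfolding U_def by (rule openin_Int[OF W(1) V])
  have Ucn: "U \<subseteq> cn n" using U openin_imp_subset by blast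
  have hol: "holo_n n (\<lambda>s. \<Sum>m\<in>X. f m s) U" if "X \<subseteq> I" for X
    by (rule holo_n_sum, rule holo_n_subset[of n _ V]) (use that f in \<open>auto simp: U_def\<close>)
  have ev: "eventually (\<lambda>X. X \<subseteq> I) (finite_subsets_at_top I)"
    by (rule eventually_finite_subsets_at_top_weakI)
  have ul: "uniform_limit U (\<lambda>X s. \<Sum>m\<in>X. f m s) (\<lambda>s. \<Sum>\<^sub>\<infinity>m\<in>I. f m s) (finite_subsets_at_top I)"
    by (rule Weierstrass_m_test_general[OF _ W(3)]) (use W(4) in \<open>auto simp: U_def\<close>)
  have "holo_n n (\<lambda>s. \<Sum>\<^sub>\<infinity>m\<in>I. f m s) U"
  proof (rule holo_nI)
    show "continuous_on U (\<lambda>s. \<Sum>\<^sub>\<infinity>m\<in>I. f m s)"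
      by (rule uniform_limit_theorem[OF _ ul])
         (rule eventually_mono[OF ev], rule holo_nD(1)[OF hol], auto)
  next
    fix s j assume s: "s \<in> U" and j: "j \<in> {1..n}"
    define O' where "O' = {z. s(j := z) \<in> U}"
    have "open O'" unfolding O'_def by (rule open_slice[OF U _ j]) (use s Ucn in auto)
    moreover have "s j \<in> O'" using s by (simp add: O'_def)
    ultimately obtain r where r: "r > 0" "cball (s j) r \<subseteq> O'"
      using open_contains_cball by blast
    have hs: "(\<lambda>z. \<Sum>m\<in>X. f m (s(j := z))) holomorphic_on O'" if "X \<subseteq> I" for X
      unfolding O'_def by (rule holo_n_slice[OF hol[OF that] Ucn j])
    have "uniform_limit (cball (s j) r) (\<lambda>X z. \<Sum>m\<in>X. f m (s(j := z)))
        (\<lambda>z. \<Sum>\<^sub>\<infinity>m\<in>I. f m (s(j := z))) (finite_subsets_at_top I)"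
      by (rule uniform_limit_compose'[OF ul]) (use r in \<open>auto simp: O'_def\<close>)
    note ul' = this
    have ev': "\<forall>\<^sub>F X in finite_subsets_at_top I.
          continuous_on (cball (s j) r) (\<lambda>z. \<Sum>m\<in>X. f m (s(j := z))) \<and>
          (\<lambda>z. \<Sum>m\<in>X. f m (s(j := z))) holomorphic_on ball (s j) r"
    proof (rule eventually_mono[OF ev], rule conjI)
      fix X assume X: "X \<subseteq> I"
      show "continuous_on (cball (s j) r) (\<lambda>z. \<Sum>m\<in>X. f m (s(j := z)))"
        by (rule holomorphic_on_imp_continuous_on, rule holomorphic_on_subset[OF hs[OF X] r(2)])
      show "(\<lambda>z. \<Sum>m\<in>X. f m (s(j := z))) holomorphic_on ball (s j) r"
        by (rule holomorphic_on_subset[OF hs[OF X] order_trans[OF ball_subset_cball r(2)]])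
    qed
    have "(\<lambda>z. \<Sum>\<^sub>\<infinity>m\<in>I. f m (s(j := z))) holomorphic_on ball (s j) r"
      using holomorphic_uniform_limit[OF ev' ul' finite_subsets_at_top_neq_bot] by blast
    then show "(\<lambda>z. \<Sum>\<^sub>\<infinity>m\<in>I. f m (s(j := z))) field_differentiable (at (s j))"
      by (rule holomorphic_on_imp_differentiable_at[OF _ open_ball]) (use r(1) in simp)
  qed
  then show "\<exists>U G. openin (top_of_set (cn n)) U \<and> p \<in> U \<and> holo_n n G U \<and>
      (\<forall>s\<in>U \<inter> V. (\<Sum>\<^sub>\<infinity>m\<in>I. f m s) = G s)"
    by (intro exI[of _ U] exI[of _ "\<lambda>s. \<Sum>\<^sub>\<infinity>m\<in>I. f m s"] conjI ballI refl U) (use W(2) p U_def in blast)+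
qed

subsection \<open>The identity theorem and continuation by gluing\<close>

text \<open>The coordinates are released one at a time: after \<open>k\<close> steps
  \<open>H\<close> vanishes wherever the coordinates beyond \<open>k\<close> are still within \<rho>
  of those of \<open>a\<close>. Each step is the one-variable identity theorem on the disc of one
  coordinate.\<close>

lemma polydisc_identity:
  assumes H: "holo_n n H (polydisc n p r)" and a: "a \<in> polydisc n p r" and \<rho>: "\<rho> > 0"
    and z: "\<And>y. y \<in> polydisc n a \<rho> \<Longrightarrow> y \<in> polydisc n p r \<Longrightarrow> H y = 0"
    and y: "y \<in> polydisc n p r"
  shows "H y = 0"
proof -
  have claim: "H y = 0" if "k \<le> n" "y \<in> polydisc n p r"
    "\<And>j. j \<in> {1..n} \<Longrightarrow> j > k \<Longrightarrow> cmod (y j - a j) < \<rho>" for k y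
    using that
  proof (induction k arbitrary: y)
    case 0
    then have "y \<in> polydisc n a \<rho>" by (auto simp: polydisc_def)
    then show ?case using z 0 by blast
  next
    case (Suc k)
    define j where "j = Suc k"
    have j: "j \<in> {1..n}" using Suc.prems(1) by (simp add: j_def)
    have upd: "y(j := w) \<in> polydisc n p r \<longleftrightarrow> w \<in> ball (p j) r" for w
      using Suc.prems(2) j by (auto simp: polydisc_def cn_def dist_norm norm_minus_commute)
    have hol: "(\<lambda>w. H (y(j := w))) holomorphic_on ball (p j) r"
    proof -
      have "{w. y(j := w) \<in> polydisc n p r} = ball (p j) r" using upd by blast
      then show ?thesis using holo_n_slice[OF H _ j, of y] by (auto simp: polydisc_def)
    qed
    have "H (y(j := y j)) = 0"
    proof (rule analytic_continuation_open[of "ball (a j) \<rho> \<inter> ball (p j) r" "ball (p j) r"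
            "\<lambda>w. H (y(j := w))" "\<lambda>_. 0" "y j"])
      have "a j \<in> ball (a j) \<rho> \<inter> ball (p j) r"
        using a j \<rho> by (auto simp: polydisc_def dist_norm norm_minus_commute)
      then show "ball (a j) \<rho> \<inter> ball (p j) r \<noteq> {}" by blast
      show "y j \<in> ball (p j) r" using upd[of "y j"] Suc.prems(2) by simp
    next
      fix w assume w: "w \<in> ball (a j) \<rho> \<inter> ball (p j) r"
      show "H (y(j := w)) = 0"
      proof (rule Suc.IH)
        show "y(j := w) \<in> polydisc n p r" using upd w by simp
        show "cmod ((y(j := w)) i - a i) < \<rho>" if "i \<in> {1..n}" "k < i" for i
          using Suc.prems(3)[of i] that w
          by (cases "i = j") (auto simp: j_def dist_norm norm_minus_commute)
      qed (use Suc.prems in simp)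
    qed (use hol in auto)
    then show ?case by simp
  qed
  show ?thesis by (rule claim[of n, OF _ y]) auto
qed

lemma holo_n_identity:
  assumes U: "openin (top_of_set (cn n)) U" "connected U" and FG: "holo_n n F U" "holo_n n G U"
    and W: "openin (top_of_set (cn n)) W" "W \<noteq> {}" "W \<subseteq> U"
    and eq: "\<And>s. s \<in> W \<Longrightarrow> F s = G s" and x: "x \<in> U"
  shows "F x = G x"
proof -
  have Ucn: "U \<subseteq> cn n" using U(1) openin_imp_subset by blast
  define A where "A = {x \<in> U. \<exists>r>0. polydisc n x r \<subseteq> U \<and> (\<forall>y\<in>polydisc n x r. F y = G y)}"
  have full: "y \<in> polydisc n p r \<Longrightarrow> F y = G y"
    if p: "polydisc n p r \<subseteq> U" and a: "a \<in> polydisc n p r" "a \<in> A" for p r a y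
  proof -
    assume y: "y \<in> polydisc n p r"
    obtain \<rho> where \<rho>: "\<rho> > 0" "\<forall>y\<in>polydisc n a \<rho>. F y = G y" using a(2) by (auto simp: A_def)
    have "holo_n n (\<lambda>s. F s - G s) (polydisc n p r)"
      using holo_n_subset[OF holo_n_diff[OF FG] p] .
    from polydisc_identity[OF this a(1) \<rho>(1) _ y] \<rho>(2) show "F y = G y" by simp
  qed
  \<comment> \<open>Hence a polydisc inside \<open>U\<close> either lies in \<open>A\<close> or
    misses it, which makes both \<open>A\<close> and \<open>U - A\<close> open.\<close>
  have sub: "polydisc n p r \<subseteq> A"
    if "polydisc n p r \<subseteq> U" "a \<in> polydisc n p r" "a \<in> A" for p r a
  proof
    fix y assume y: "y \<in> polydisc n p r"
    obtain \<rho> where \<rho>: "\<rho> > 0" "polydisc n y \<rho> \<subseteq> polydisc n p r"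
      using polydisc_within[OF openin_polydisc y] by blast
    show "y \<in> A" unfolding A_def using \<rho> that(1) y full[OF that] by blast
  qed
  have opA: "openin (top_of_set U) A"
  proof (subst openin_subopen, intro ballI)
    fix x assume x: "x \<in> A"
    then obtain r where r: "r > 0" "polydisc n x r \<subseteq> U" by (auto simp: A_def)
    have c: "x \<in> polydisc n x r" using x r(1) Ucn by (auto simp: A_def intro: polydisc_center)
    have "openin (top_of_set U) (polydisc n x r)"
      using openin_subset_trans[OF openin_polydisc r(2) Ucn] .
    then show "\<exists>T. openin (top_of_set U) T \<and> x \<in> T \<and> T \<subseteq> A"
      using sub[OF r(2) c x] c by blast
  qed
  have opB: "openin (top_of_set U) (U - A)"
  proof (subst openin_subopen, intro ballI)
    fix x assume x: "x \<in> U - A"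
    then obtain r where r: "r > 0" "polydisc n x r \<subseteq> U" using polydisc_within[OF U(1)] by blast
    have c: "x \<in> polydisc n x r" using x r(1) Ucn by (auto intro: polydisc_center)
    have "polydisc n x r \<inter> A = {}" using sub[OF r(2)] c x by blast
    moreover have "openin (top_of_set U) (polydisc n x r)"
      using openin_subset_trans[OF openin_polydisc r(2) Ucn] .
    ultimately show "\<exists>T. openin (top_of_set U) T \<and> x \<in> T \<and> T \<subseteq> U - A"
      using c r(2) by blast
  qed
  obtain w where w: "w \<in> W" using W(2) by blast
  obtain r where r: "r > 0" "polydisc n w r \<subseteq> W" using polydisc_within[OF W(1) w] by blast
  have "w \<in> A" unfolding A_def using w r W(3) eq by blast
  moreover have "closedin (top_of_set U) A"
    using opB opA openin_imp_subset by (auto simp: closedin_def)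
  ultimately have "A = U" using U(2) opA connected_clopen by blast
  with x have "x \<in> A" by simp
  then obtain r where "r > 0" "\<forall>y\<in>polydisc n x r. F y = G y" unfolding A_def by blast
  then show ?thesis using polydisc_center[of x n r] x Ucn by auto
qed

lemma connected_segmentI:
  fixes U :: "(nat \<Rightarrow> complex) set"
  assumes "\<And>x y t. x \<in> U \<Longrightarrow> y \<in> U \<Longrightarrow> 0 \<le> t \<Longrightarrow> t \<le> 1 \<Longrightarrow>
             (\<lambda>j. of_real (1 - t) * x j + of_real t * y j) \<in> U"
  shows "connected U"
proof (rule path_connected_imp_connected, unfold path_connected_def, intro ballI)
  fix x y assume xy: "x \<in> U" "y \<in> U"
  define g where "g = (\<lambda>t::real. \<lambda>j. of_real (1 - t) * x j + of_real t * y j)"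
  have "path g" unfolding path_def g_def
    by (intro continuous_on_coordinatewise_then_product continuous_intros)
  moreover have "path_image g \<subseteq> U" unfolding path_image_def g_def using assms[OF xy] by auto
  moreover have "pathstart g = x" "pathfinish g = y"
    by (auto simp: pathstart_def pathfinish_def g_def)
  ultimately show "\<exists>g. path g \<and> path_image g \<subseteq> U \<and> pathstart g = x \<and> pathfinish g = y" by blast
qed

text \<open>The \<open>g L\<close> and \<open>h L\<close> are numerators and denominators of one
  function. They are compared by cross-multiplication on the whole connected set \<open>D L\<close>,
  poles included, so that nothing has to be known about connectedness of
  \<open>D L \<inter> E\<close>; division takes place only afterwards, on \<open>E\<close>.\<close>

lemma holo_n_glue:
  assumes C: "openin (top_of_set (cn n)) C" "C \<noteq> {}"
    and D: "\<And>L. openin (top_of_set (cn n)) (D L)" "\<And>L. connected (D L)" "\<And>L. C \<subseteq> D L"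
      "\<And>L M. L \<le> M \<Longrightarrow> D L \<subseteq> D M" "\<And>s. s \<in> cn n \<Longrightarrow> \<exists>L::nat. s \<in> D L"
    and g: "\<And>L. holo_n n (g L) (D L)" and h: "\<And>L. holo_n n (h L) (cn n)"
    and E: "openin (top_of_set (cn n)) E" "C \<subseteq> E" "\<And>L s. s \<in> E \<Longrightarrow> h L s \<noteq> 0"
    and eq: "\<And>L s. s \<in> C \<Longrightarrow> f s * h L s = g L s"
  obtains F where "holo_n n F E" "\<And>s. s \<in> C \<Longrightarrow> F s = f s"
    "\<And>L s. s \<in> D L \<Longrightarrow> s \<in> E \<Longrightarrow> F s * h L s = g L s"
proof -
  have Dcn: "D L \<subseteq> cn n" for L using D(1) openin_imp_subset by blast
  have cross: "g L s * h M s = g M s * h L s" if "L \<le> M" "s \<in> D L" for L M s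
  proof (rule holo_n_identity[OF D(1)[of L] D(2)[of L] _ _ C D(3),
        where F = "\<lambda>s. g L s * h M s" and G = "\<lambda>s. g M s * h L s"])
    show "holo_n n (\<lambda>s. g L s * h M s) (D L)"
      by (rule holo_n_mult[OF g holo_n_subset[OF h Dcn]])
    show "holo_n n (\<lambda>s. g M s * h L s) (D L)"
      by (rule holo_n_mult[OF holo_n_subset[OF g D(4)[OF that(1)]] holo_n_subset[OF h Dcn]])
    show "g L t * h M t = g M t * h L t" if "t \<in> C" for t
      using eq[OF that, of L] eq[OF that, of M] by (metis mult.assoc mult.commute)
  qed (rule that)
  \<comment> \<open>Any other admissible index is at least the least one, so \<open>cross\<close>,
    applied on the domain of the least index, shows that all of them give the same value.\<close>
  define F where "F = (\<lambda>s. let L = (LEAST L. s \<in> D L) in g L s / h L s)"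
  have F: "F s * h L s = g L s" if s: "s \<in> D L" "s \<in> E" for L s
  proof -
    define K where "K = (LEAST L. s \<in> D L)"
    have K: "s \<in> D K" "K \<le> L" unfolding K_def using s(1) by (auto intro: LeastI Least_le)
    have "F s = g K s / h K s" by (simp add: F_def K_def Let_def)
    moreover have "g K s * h L s = g L s * h K s" by (rule cross[OF K(2,1)])
    moreover have hK: "h K s \<noteq> 0" by (rule E(3)[OF s(2)])
    ultimately have "h K s * (F s * h L s) = h K s * g L s"
      by (simp add: mult.commute)
    then show ?thesis using hK by simp
  qed
  show ?thesis
  proof (rule that[of F])
    show "holo_n n F E"
    proof (rule holo_n_local[OF E(1)])
      fix p assume p: "p \<in> E"
      then obtain L where L: "p \<in> D L" using D(5) E(1) openin_imp_subset by blast
      have "holo_n n (\<lambda>s. g L s / h L s) (D L \<inter> E)"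
      proof (rule holo_n_divide)
        show "holo_n n (g L) (D L \<inter> E)" by (rule holo_n_subset[OF g]) auto
        show "holo_n n (h L) (D L \<inter> E)" by (rule holo_n_subset[OF h]) (use Dcn in auto)
      qed (use E(3) in auto)
      moreover have "F s = g L s / h L s" if "s \<in> D L" "s \<in> E" for s
        using F[OF that] E(3)[OF that(2), of L] by (simp add: field_simps)
      ultimately show "\<exists>V G. openin (top_of_set (cn n)) V \<and> p \<in> V \<and> holo_n n G V \<and>
          (\<forall>s\<in>V \<inter> E. F s = G s)"
        using openin_Int[OF D(1) E(1), of L] L p
        by (intro exI[of _ "D L \<inter> E"] exI[of _ "\<lambda>s. g L s / h L s"]) auto
    qed
    show "F s = f s" if "s \<in> C" for s
    proof -
      have "F s * h 0 s = f s * h 0 s" using F[of s 0] eq[OF that, of 0] that D(3) E(2) by auto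
      moreover have "h 0 s \<noteq> 0" using E(2,3) that by blast
      ultimately show ?thesis by simp
    qed
  qed (use F in auto)
qed

section \<open>Local Lipschitz bounds\<close>

lemma holomorphic_lipschitz:
  assumes h: "h holomorphic_on ball c R" and M: "\<And>z. z \<in> ball c R \<Longrightarrow> cmod (h z) \<le> M"
    and R: "R > 0" and xy: "x \<in> ball c (R/2)" "y \<in> ball c (R/2)"
  shows "cmod (h x - h y) \<le> 4 * M / R * cmod (x - y)"
proof (rule field_differentiable_bound[OF convex_ball _ _ xy])
  fix z assume z: "z \<in> ball c (R/2)"
  \<comment> \<open>The radius fits because \<open>R/2 + R/4 < R\<close>; Cauchy's inequality on
    this circle produces the constant \<open>4 * M / R\<close>.\<close>
  have sub: "cball z (R/4) \<subseteq> ball c R"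
  proof
    fix w assume "w \<in> cball z (R/4)"
    then show "w \<in> ball c R" using z R dist_triangle[of c w z] by auto
  qed
  have "h field_differentiable at z"
    using holomorphic_on_imp_differentiable_at[OF h] z R by auto
  then show "(h has_field_derivative deriv h z) (at z within ball c (R/2))"
    by (meson DERIV_subset field_differentiable_derivI has_field_derivative_at_within)
  have "norm ((deriv ^^ 1) h z) \<le> fact 1 * M / (R/4) ^ 1"
  proof (rule Cauchy_inequality)
    show "h holomorphic_on ball z (R/4)"
      using holomorphic_on_subset[OF h order_trans[OF ball_subset_cball sub]] .
    show "continuous_on (cball z (R/4)) h"
      using holomorphic_on_imp_continuous_on[OF holomorphic_on_subset[OF h sub]] .
    show "cmod (h w) \<le> M" if "cmod (z - w) = R/4" for w
      using M sub that by (auto simp: subset_iff dist_norm)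
  qed (use R in auto)
  then show "cmod (deriv h z) \<le> 4 * M / R" by (simp add: field_simps)
qed

text \<open>The source of the O-terms. Continuity bounds \<open>F\<close> near \<open>p\<close>,
  Cauchy's inequality turns the bound into a Lipschitz constant in each coordinate, and
  \<open>x\<close> is carried to \<open>y\<close> by exchanging coordinates one after
  another.\<close>

lemma holo_n_lipschitz:
  assumes U: "openin (top_of_set (cn n)) U" and F: "holo_n n F U" and p: "p \<in> U"
  obtains r C where "r > 0" "C \<ge> 0" "polydisc n p r \<subseteq> U"
    "\<And>x y. x \<in> polydisc n p r \<Longrightarrow> y \<in> polydisc n p r \<Longrightarrow>
       cmod (F x - F y) \<le> C * (\<Sum>j=1..n. cmod (x j - y j))"
proof -
  have "openin (top_of_set U) (U \<inter> F -` ball (F p) 1)"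
    by (rule continuous_openin_preimage_gen[OF holo_nD(1)[OF F] open_ball])
  then have "openin (top_of_set (cn n)) (U \<inter> F -` ball (F p) 1)"
    by (rule openin_trans[OF _ U])
  then obtain R where R: "R > 0" "polydisc n p R \<subseteq> U \<inter> F -` ball (F p) 1"
    using polydisc_within[of n "U \<inter> F -` ball (F p) 1" p] p by fastforce
  define M where "M = cmod (F p) + 1"
  have bd: "cmod (F x) \<le> M" if "x \<in> polydisc n p R" for x
  proof -
    have "cmod (F p - F x) < 1" using that R(2) by (auto simp: dist_norm)
    then show ?thesis unfolding M_def using norm_triangle_ineq4[of "F p" "F p - F x"] by simp
  qed
  have hol: "holo_n n F (polydisc n p R)" using holo_n_subset[OF F] R(2) by blast
  define C where "C = 4 * M / R"
  have C0: "C \<ge> 0" unfolding C_def M_def using R(1) by simp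
  have step: "cmod (F (x(j := u)) - F (x(j := v))) \<le> C * cmod (u - v)"
    if x: "x \<in> polydisc n p R" and j: "j \<in> {1..n}" and uv: "u \<in> ball (p j) (R/2)" "v \<in> ball (p j) (R/2)"
    for x j u v
  proof -
    have upd: "x(j := w) \<in> polydisc n p R \<longleftrightarrow> w \<in> ball (p j) R" for w
      using x j by (auto simp: polydisc_def cn_def dist_norm norm_minus_commute)
    have "(\<lambda>w. F (x(j := w))) holomorphic_on ball (p j) R"
    proof -
      have "{w. x(j := w) \<in> polydisc n p R} = ball (p j) R" using upd by blast
      then show ?thesis using holo_n_slice[OF hol _ j, of x] by (auto simp: polydisc_def)
    qed
    then show ?thesis unfolding C_def
      by (rule holomorphic_lipschitz) (use bd upd R(1) uv in auto)
  qed
  have lip: "cmod (F x - F y) \<le> C * (\<Sum>j=1..n. cmod (x j - y j))"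
    if x: "x \<in> polydisc n p (R/2)" and y: "y \<in> polydisc n p (R/2)" for x y
  proof -
    define z where "z = (\<lambda>k j. if j \<le> k then y j else x j)"
    have xR: "x j \<in> ball (p j) (R/2)" "y j \<in> ball (p j) (R/2)" if "j \<in> {1..n}" for j
      using that x y by (auto simp: polydisc_def dist_norm norm_minus_commute)
    have zp: "z k \<in> polydisc n p R" for k
      using x y R(1) by (force simp: z_def polydisc_def cn_def)
    have "cmod (F x - F (z k)) \<le> C * (\<Sum>j=1..k. cmod (x j - y j))" if "k \<le> n" for k
      using that
    proof (induction k)
      case 0
      have "z 0 = x" using x y by (intro ext) (auto simp: z_def polydisc_def cn_def)
      then show ?case by simp
    next
      case (Suc k)
      have 1: "(z k)(Suc k := x (Suc k)) = z k" by (auto simp: z_def)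
      have 2: "(z k)(Suc k := y (Suc k)) = z (Suc k)" by (auto simp: z_def)
      have "cmod (F (z k) - F (z (Suc k))) \<le> C * cmod (x (Suc k) - y (Suc k))"
        using step[OF zp[of k], of "Suc k" "x (Suc k)" "y (Suc k)"] xR[of "Suc k"] Suc.prems 1 2 by simp
      moreover have "cmod (F x - F (z (Suc k))) \<le> cmod (F x - F (z k)) + cmod (F (z k) - F (z (Suc k)))"
        using norm_triangle_ineq[of "F x - F (z k)" "F (z k) - F (z (Suc k))"] by simp
      ultimately show ?case using Suc by (simp add: distrib_left)
    qed
    from this[of n] moreover have "z n = y"
      using x y by (intro cn_eqI[of _ n]) (auto simp: z_def polydisc_def cn_def)
    ultimately show ?thesis by simp
  qed
  show ?thesis
  proof (rule that[of "R/2" C])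
    show "polydisc n p (R/2) \<subseteq> U" using R polydisc_mono[of "R/2" R n p] by auto
  qed (use R C0 lip in auto)
qed

subsection \<open>Regions of convergence and uniqueness of the continued values\<close>

text \<open>Every tail sum contains the last coordinate, so for \<open>n \<ge> 1\<close> this is the
  convergence region with \<open>s n\<close> replaced by \<open>s n + L\<close>: the natural domain
  of a series whose last factor gains \<open>L\<close> orders of decay.\<close>

definition shifted_region :: "nat \<Rightarrow> nat \<Rightarrow> (nat \<Rightarrow> complex) set" where
  "shifted_region n L = {s \<in> cn n. \<forall>j\<in>{1..n}. Re (\<Sum>i=j..n. s i) + real L > real (n + 1 - j)}"

lemma shifted_region_0: "shifted_region n 0 = conv_region n"
  by (simp add: shifted_region_def conv_region_def)

lemma openin_shifted_region: "openin (top_of_set (cn n)) (shifted_region n L)"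
proof -
  have "openin (top_of_set (cn n))
      {s \<in> cn n. \<forall>j\<in>{1..n}. Re (\<Sum>i=j..n. s i) \<in> {real (n + 1 - j) - real L <..}}"
    by (rule openin_cn_conds) (auto intro!: continuous_intros)
  moreover have "{s \<in> cn n. \<forall>j\<in>{1..n}. Re (\<Sum>i=j..n. s i) \<in> {real (n + 1 - j) - real L <..}} =
      shifted_region n L"
    unfolding shifted_region_def by (auto simp: algebra_simps)
  ultimately show ?thesis by simp
qed

lemma openin_conv_region: "openin (top_of_set (cn n)) (conv_region n)"
  using openin_shifted_region[of n 0] by (simp add: shifted_region_0)

lemma shifted_region_mono: "L \<le> M \<Longrightarrow> shifted_region n L \<subseteq> shifted_region n M"
  unfolding shifted_region_def by force

lemma conv_region_subset: "conv_region n \<subseteq> shifted_region n L"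
  using shifted_region_mono[of 0 L n] by (simp add: shifted_region_0)

lemma shifted_region_cn: "shifted_region n L \<subseteq> cn n"
  by (auto simp: shifted_region_def)

lemma connected_shifted_region: "connected (shifted_region n L)"
proof (rule connected_segmentI)
  fix x y :: "nat \<Rightarrow> complex" and t :: real
  assume x: "x \<in> shifted_region n L" and y: "y \<in> shifted_region n L" and t: "0 \<le> t" "t \<le> 1"
  let ?z = "\<lambda>j. complex_of_real (1 - t) * x j + complex_of_real t * y j"
  have "real (n + 1 - j) < Re (\<Sum>i=j..n. ?z i) + real L" if j: "j \<in> {1..n}" for j
  proof -
    define a where "a = Re (\<Sum>i=j..n. x i) + real L"
    define b where "b = Re (\<Sum>i=j..n. y i) + real L"
    have ab: "real (n + 1 - j) < a" "real (n + 1 - j) < b"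
      using x y j by (auto simp: shifted_region_def a_def b_def)
    have "Re (\<Sum>i=j..n. ?z i) = (1 - t) * Re (\<Sum>i=j..n. x i) + t * Re (\<Sum>i=j..n. y i)"
      by (simp add: sum.distrib sum_distrib_left)
    then have "Re (\<Sum>i=j..n. ?z i) + real L = (1 - t) * a + t * b"
      by (simp add: a_def b_def algebra_simps)
    also have "\<dots> > real (n + 1 - j)"
      using convex_bound_lt[of "- a" "- real (n + 1 - j)" "- b" "1 - t" t] ab t by simp
    finally show ?thesis .
  qed
  then show "?z \<in> shifted_region n L"
    using x y by (auto simp: shifted_region_def cn_def)
qed

lemma shifted_region_exhausts:
  assumes "s \<in> cn n"
  shows "\<exists>L. s \<in> shifted_region n L"
proof -
  define f where "f = (\<lambda>j. real (n + 1 - j) - Re (\<Sum>i=j..n. s i))"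
  obtain L :: nat where L: "(\<Sum>j=1..n. \<bar>f j\<bar>) < real L" using reals_Archimedean2 by blast
  have "f j < real L" if "j \<in> {1..n}" for j
    using member_le_sum[of j "{1..n}" "\<lambda>j. \<bar>f j\<bar>"] that L by simp
  then have "s \<in> shifted_region n L"
    using assms by (auto simp: shifted_region_def f_def algebra_simps)
  then show ?thesis by blast
qed

text \<open>The last coordinate is left free because the domain used later for values at nonpositive
  integers contains only part of \<open>Re z > 1\<close>.\<close>

lemma conv_region_last:
  assumes "n \<ge> 1" "Re z > 1"
  shows "(\<lambda>j. if j \<in> {1..n} then (if j = n then z else 2) else 0) \<in> conv_region n"
    (is "?s \<in> _")
proof -
  have "real (n + 1 - j) < Re (\<Sum>i=j..n. ?s i)" if j: "j \<in> {1..n}" for j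
  proof -
    obtain m where n: "n = Suc m" using assms(1) by (cases n) auto
    have "(\<Sum>i=j..n. ?s i) = (\<Sum>i=j..<n. ?s i) + ?s n"
      using j n by (simp add: atLeastLessThanSuc_atLeastAtMost[symmetric] del: atLeastLessThanSuc_atLeastAtMost)
    also have "(\<Sum>i=j..<n. ?s i) = (\<Sum>i=j..<n. 2)"
      by (rule sum.cong) (use j in auto)
    finally have "Re (\<Sum>i=j..n. ?s i) = 2 * real (n - j) + Re z" using assms(1) by simp
    then show ?thesis using j assms(2) by (auto simp: of_nat_diff)
  qed
  then show ?thesis by (auto simp: conv_region_def cn_def)
qed

lemma conv_region_nonempty: "n \<ge> 1 \<Longrightarrow> conv_region n \<noteq> {}"
  using conv_region_last[of n 2] by force

text \<open>Uniqueness behind the \<open>THE\<close>: on the connected domain of any competitor, its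
  product with \<open>h\<close> equals \<open>G\<close> by the identity theorem, even if
  \<open>h\<close> has zeros there. Only the exhibited domain \<open>U\<close> must avoid the zeros
  of \<open>h\<close>.\<close>

lemma zeta_cont_eq:
  assumes n: "n \<ge> 1" and G: "holo_n n G (cn n)" and h: "holo_n n h (cn n)"
    and eq: "\<And>t. t \<in> conv_region n \<Longrightarrow> G t = h t * zeta_series n k \<gamma> b \<mu> t"
    and U: "openin (top_of_set (cn n)) U" "connected U" "s \<in> U" "U \<inter> conv_region n \<noteq> {}"
    and hU: "\<And>t. t \<in> U \<Longrightarrow> h t \<noteq> 0"
  shows "zeta_cont n k \<gamma> b \<mu> s = G s / h s"
proof -
  have Ucn: "U \<subseteq> cn n" using U(1) openin_imp_subset by blast
  have "(THE v. \<exists>U F. U \<subseteq> cn n \<and> openin (top_of_set (cn n)) U \<and> connected U \<and> s \<in> U \<and>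
          holo_n n F U \<and> U \<inter> conv_region n \<noteq> {} \<and>
          (\<forall>t\<in>U \<inter> conv_region n. F t = zeta_series n k \<gamma> b \<mu> t) \<and> F s = v) = G s / h s"
  proof (rule the_equality)
    have "holo_n n (\<lambda>t. G t / h t) U"
      by (rule holo_n_divide[OF holo_n_subset[OF G Ucn] holo_n_subset[OF h Ucn] hU])
    moreover have "\<forall>t\<in>U \<inter> conv_region n. G t / h t = zeta_series n k \<gamma> b \<mu> t"
      using eq hU by auto
    ultimately show "\<exists>U F. U \<subseteq> cn n \<and> openin (top_of_set (cn n)) U \<and> connected U \<and> s \<in> U \<and>
          holo_n n F U \<and> U \<inter> conv_region n \<noteq> {} \<and>
          (\<forall>t\<in>U \<inter> conv_region n. F t = zeta_series n k \<gamma> b \<mu> t) \<and> F s = G s / h s"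
      using U Ucn by (intro exI[of _ U] exI[of _ "\<lambda>t. G t / h t"]) auto
  next
    fix v assume "\<exists>U F. U \<subseteq> cn n \<and> openin (top_of_set (cn n)) U \<and> connected U \<and> s \<in> U \<and>
          holo_n n F U \<and> U \<inter> conv_region n \<noteq> {} \<and>
          (\<forall>t\<in>U \<inter> conv_region n. F t = zeta_series n k \<gamma> b \<mu> t) \<and> F s = v"
    then obtain V F where V: "V \<subseteq> cn n" "openin (top_of_set (cn n)) V" "connected V" "s \<in> V"
      "holo_n n F V" "V \<inter> conv_region n \<noteq> {}"
      "\<forall>t\<in>V \<inter> conv_region n. F t = zeta_series n k \<gamma> b \<mu> t" "F s = v" by blast
    have "h s * F s = G s"
    proof (rule holo_n_identity[OF V(2,3) _ _ openin_Int[OF V(2) openin_conv_region] V(6),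
          where F = "\<lambda>s. h s * F s" and G = G])
      show "holo_n n (\<lambda>s. h s * F s) V" by (rule holo_n_mult[OF holo_n_subset[OF h V(1)] V(5)])
      show "holo_n n G V" by (rule holo_n_subset[OF G V(1)])
    qed (use V eq in auto)
    then show "v = G s / h s" using hU[OF U(3)] V(8) by (auto simp: field_simps)
  qed
  then show ?thesis using n by (simp add: zeta_cont_def)
qed

subsection \<open>Expansions of complex powers at infinity\<close>

text \<open>The modulus is the exponential of the real part of \<open>e * Ln x\<close>. Replacing
  \<open>cmod x\<close> by the comparable \<open>t\<close> changes the logarithm by at most
  \<open>ln K\<close>, and the argument contributes at most \<open>pi\<close>.\<close>

lemma powr_norm_bound:
  fixes x e :: complex
  assumes K: "K \<ge> 1" and t: "t > 0" and x: "x \<noteq> 0" "cmod x \<le> K * t" "t \<le> K * cmod x"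
  shows "cmod (x powr e) \<le> exp ((ln K + pi) * cmod e) * t powr Re e"
proof -
  have K0: "K > 0" using K by simp
  have "ln (cmod x) \<le> ln (K * t)" "ln t \<le> ln (K * cmod x)"
    using x t K0 by (auto intro!: ln_mono)
  then have d: "\<bar>ln (cmod x) - ln t\<bar> \<le> ln K"
    using t x K0 by (simp add: ln_mult abs_le_iff)
  have "Re (e * Ln x) = Re e * ln (cmod x) - Im e * Im (Ln x)" using x by simp
  also have "\<dots> = Re e * ln t + Re e * (ln (cmod x) - ln t) - Im e * Im (Ln x)"
    by (simp add: algebra_simps)
  also have "\<dots> \<le> Re e * ln t + cmod e * ln K + cmod e * pi"
  proof -
    have "\<bar>Re e * (ln (cmod x) - ln t)\<bar> \<le> cmod e * ln K"
      unfolding abs_mult by (intro mult_mono d abs_Re_le_cmod) auto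
    moreover have "\<bar>Im e * Im (Ln x)\<bar> \<le> cmod e * pi"
      unfolding abs_mult by (intro mult_mono abs_Im_le_cmod)
        (use mpi_less_Im_Ln[OF x(1)] Im_Ln_le_pi[OF x(1)] in auto)
    ultimately show ?thesis by linarith
  qed
  finally have "exp (Re (e * Ln x)) \<le> exp (Re e * ln t + (ln K + pi) * cmod e)"
    by (simp add: algebra_simps)
  then show ?thesis using x t by (simp add: powr_def exp_add mult.commute)
qed

definition powr_rem :: "complex \<Rightarrow> nat \<Rightarrow> complex \<Rightarrow> complex \<Rightarrow> complex" where
  "powr_rem e K h X = (X + h) powr e - (\<Sum>i<K. (e gchoose i) * h ^ i * X powr (e - of_nat i))"

lemma halfplane_segment:
  assumes "Re X \<ge> \<delta>" "Re (X + h) \<ge> \<delta>" "x \<in> closed_segment X (X + h)"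
  shows "Re x \<ge> \<delta>" "cmod (x - X) \<le> cmod h"
proof -
  obtain u where u: "0 \<le> u" "u \<le> 1" "x = (1 - u) *\<^sub>R X + u *\<^sub>R (X + h)"
    using assms(3) by (auto simp: in_segment)
  have "(1 - u) * \<delta> + u * \<delta> \<le> (1 - u) * Re X + u * Re (X + h)"
    using assms u by (intro add_mono mult_left_mono) auto
  then show "Re x \<ge> \<delta>" using u by (simp add: algebra_simps)
  have "x - X = u *\<^sub>R h" using u by (simp add: algebra_simps scaleR_conv_of_real)
  then show "cmod (x - X) \<le> cmod h" using u by (simp add: mult_left_le_one_le)
qed

text \<open>Taylor's formula along the segment from \<open>X\<close> to \<open>X + h\<close>. The
  segment stays in \<open>Re \<ge> \<delta>\<close>, off the branch cut, where its moduli are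
  comparable with ratio \<open>1 + cmod h / \<delta>\<close>, so \<open>h\<close> need not be small.
  The factor \<open>e gchoose K\<close> is kept visible because its zeros give exact
  expansions.\<close>

lemma powr_rem_bound:
  assumes \<delta>: "\<delta> > 0" and X: "Re X \<ge> \<delta>" "Re (X + h) \<ge> \<delta>" and K: "K \<ge> 1"
  shows "cmod (powr_rem e K h X) \<le> cmod (e gchoose K) * (real K * cmod h ^ K *
           exp ((ln (1 + cmod h / \<delta>) + pi) * cmod (e - of_nat K))) * cmod X powr (Re e - real K)"
proof -
  define Q where "Q = 1 + cmod h / \<delta>"
  have Q: "Q \<ge> 1" unfolding Q_def using \<delta> by simp
  \<comment> \<open>\<open>f i\<close> is the i-th derivative of \<open>x powr e\<close>.\<close>
  define f where "f = (\<lambda>i x. fact i * (e gchoose i) * x powr (e - of_nat i))"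
  obtain k where k: "K = Suc k" using K by (cases K) auto
  have comp: "cmod x \<le> Q * cmod X \<and> cmod X \<le> Q * cmod x \<and> x \<noteq> 0 \<and> cmod X > 0"
    if "x \<in> closed_segment X (X + h)" for x
  proof -
    note xh = halfplane_segment[OF X that]
    have lo: "\<delta> \<le> cmod x" "\<delta> \<le> cmod X"
      using xh X complex_Re_le_cmod[of x] complex_Re_le_cmod[of X] by auto
    have "cmod h \<le> cmod h / \<delta> * y" if "\<delta> \<le> y" for y
      using mult_left_mono[OF that, of "cmod h / \<delta>"] \<delta> by simp
    with lo have "cmod h \<le> cmod h / \<delta> * cmod x" "cmod h \<le> cmod h / \<delta> * cmod X" by blast+
    moreover have "cmod x \<le> cmod X + cmod h" "cmod X \<le> cmod x + cmod h"
      using xh(2) norm_triangle_ineq2[of x X] norm_triangle_ineq3[of x X] by linarith+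
    ultimately show ?thesis using lo \<delta> unfolding Q_def by (auto simp: algebra_simps)
  qed
  define B where "B = fact K * cmod (e gchoose K) *
      (exp ((ln Q + pi) * cmod (e - of_nat K)) * cmod X powr (Re e - real K))"
  have "cmod (f 0 (X + h) - (\<Sum>i\<le>k. f i X * (X + h - X) ^ i / fact i)) \<le>
      B * cmod (X + h - X) ^ Suc k / fact k"
  proof (rule complex_Taylor[OF convex_closed_segment[of X "X + h"]])
    fix i x assume x: "x \<in> closed_segment X (X + h)" and "i \<le> k"
    have "x \<notin> \<real>\<^sub>\<le>\<^sub>0" using halfplane_segment(1)[OF X x] \<delta> by (auto simp: complex_nonpos_Reals_iff)
    then have "((\<lambda>z. z powr (e - of_nat i)) has_field_derivative
        ((e - of_nat i) * x powr (e - of_nat i - 1))) (at x)"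
      by (rule has_field_derivative_powr)
    then have "(f i has_field_derivative fact i * (e gchoose i) *
        ((e - of_nat i) * x powr (e - of_nat i - 1))) (at x)"
      unfolding f_def by (rule DERIV_cmult)
    moreover have "fact i * (e gchoose i) * ((e - of_nat i) * x powr (e - of_nat i - 1)) = f (Suc i) x"
    proof -
      have "of_nat (Suc i) * (e gchoose Suc i) = (e - of_nat i) * (e gchoose i)"
        using gbinomial_absorption[of i e] gbinomial_absorb_comp[of e i] by simp
      then have "fact i * (of_nat (Suc i) * (e gchoose Suc i)) = fact i * ((e - of_nat i) * (e gchoose i))"
        by (simp only:)
      then have *: "fact (Suc i) * (e gchoose Suc i) = fact i * (e gchoose i) * (e - of_nat i)"
        by (simp only: fact_Suc mult.assoc mult.commute mult.left_commute)
      have **: "e - of_nat i - 1 = e - of_nat (Suc i)" by simp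
      show ?thesis unfolding f_def ** * by (simp only: mult.assoc)
    qed
    ultimately show "(f i has_field_derivative f (Suc i) x) (at x within closed_segment X (X + h))"
      by (simp add: has_field_derivative_at_within)
  next
    fix x assume x: "x \<in> closed_segment X (X + h)"
    have "cmod (x powr (e - of_nat K)) \<le>
        exp ((ln Q + pi) * cmod (e - of_nat K)) * cmod X powr Re (e - of_nat K)"
      by (rule powr_norm_bound) (use comp[OF x] Q in auto)
    then have "cmod (x powr (e - of_nat K)) \<le>
        exp ((ln Q + pi) * cmod (e - of_nat K)) * cmod X powr (Re e - real K)"
      by simp
    then have "fact K * cmod (e gchoose K) * cmod (x powr (e - of_nat K)) \<le> B"
      unfolding B_def by (rule mult_left_mono) simp
    then show "cmod (f (Suc k) x) \<le> B"
      unfolding f_def k by (simp only: norm_mult norm_fact)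
  qed auto
  moreover have "f 0 (X + h) - (\<Sum>i\<le>k. f i X * (X + h - X) ^ i / fact i) = powr_rem e K h X"
    unfolding powr_rem_def f_def k lessThan_Suc_atMost by (simp add: algebra_simps)
  ultimately have "cmod (powr_rem e K h X) \<le> B * cmod h ^ K / fact k" by (simp add: k)
  also have "\<dots> = cmod (e gchoose K) * (real K * cmod h ^ K *
      exp ((ln Q + pi) * cmod (e - of_nat K))) * cmod X powr (Re e - real K)"
    unfolding B_def k by (simp add: field_simps)
  finally show ?thesis unfolding Q_def .
qed

text \<open>The bound carries the factor \<open>k gchoose K\<close>, which is 0 here: a terminating
  binomial expansion has no remainder.\<close>

lemma powr_rem_of_nat:
  assumes "Re X > 0" "Re (X + h) > 0" "k < K"
  shows "powr_rem (of_nat k) K h X = 0"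
proof -
  have "(of_nat k gchoose K :: complex) = of_nat (k choose K)" by (simp add: binomial_gbinomial)
  then have "(of_nat k gchoose K :: complex) = 0" using assms(3) by (simp add: binomial_eq_0)
  then show ?thesis
    using powr_rem_bound[of "min (Re X) (Re (X + h))" X h K "of_nat k"] assms by auto
qed

lemma holomorphic_gbinomial:
  fixes f :: "complex \<Rightarrow> complex"
  shows "f holomorphic_on A \<Longrightarrow> (\<lambda>s. f s gchoose k) holomorphic_on A"
  unfolding gbinomial_prod_rev by (intro holomorphic_intros) auto

lemma entire_bounded:
  assumes "f holomorphic_on UNIV"
  shows "\<exists>C\<ge>0. \<forall>s. cmod s \<le> R \<longrightarrow> cmod (f s) \<le> C"
proof -
  have "continuous_on (cball 0 R) f"
    using assms holomorphic_on_imp_continuous_on holomorphic_on_subset by blast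
  then have "bounded (f ` cball 0 R)"
    using compact_continuous_image compact_imp_bounded compact_cball by blast
  then obtain C where C: "\<forall>s\<in>cball 0 R. cmod (f s) \<le> C" by (auto simp: bounded_iff)
  have "cmod (f s) \<le> max C 0" if "cmod s \<le> R" for s
    using C that by (simp add: le_max_iff_disj)
  then show ?thesis by (intro exI[of _ "max C 0"]) auto
qed

lemma powr_rem_bound_uniform:
  assumes \<delta>: "\<delta> > 0" and K: "K \<ge> 1"
  shows "\<exists>C\<ge>0. \<forall>e X. cmod e \<le> R \<longrightarrow> Re X \<ge> \<delta> \<longrightarrow> Re (X + h) \<ge> \<delta> \<longrightarrow>
           cmod (powr_rem e K h X) \<le> C * cmod X powr (Re e - real K)"
proof -
  obtain C1 where C1: "C1 \<ge> 0" "\<And>e. cmod e \<le> R \<Longrightarrow> cmod (e gchoose K) \<le> C1"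
    using entire_bounded[OF holomorphic_gbinomial[OF holomorphic_on_ident]] by blast
  define q where "q = ln (1 + cmod h / \<delta>) + pi"
  have q: "q \<ge> 0" unfolding q_def using \<delta> by simp
  define C2 where "C2 = real K * cmod h ^ K * exp (q * (R + real K))"
  show ?thesis
  proof (intro exI[of _ "C1 * C2"] conjI allI impI)
    show "0 \<le> C1 * C2" using C1 by (simp add: C2_def)
    fix e X assume e: "cmod e \<le> R" and X: "Re X \<ge> \<delta>" "Re (X + h) \<ge> \<delta>"
    have "cmod (e - of_nat K) \<le> R + real K"
      using norm_triangle_ineq4[of e "of_nat K"] e by simp
    then have "real K * cmod h ^ K * exp (q * cmod (e - of_nat K)) \<le> C2"
      unfolding C2_def using q by (intro mult_left_mono) (auto intro!: mult_left_mono)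
    then have "cmod (e gchoose K) * (real K * cmod h ^ K * exp (q * cmod (e - of_nat K)))
        * cmod X powr (Re e - real K) \<le> C1 * C2 * cmod X powr (Re e - real K)"
      using C1 e q by (intro mult_mono mult_nonneg_nonneg) (auto simp: C2_def)
    with powr_rem_bound[OF \<delta> X K, of e]
    show "cmod (powr_rem e K h X) \<le> C1 * C2 * cmod X powr (Re e - real K)"
      unfolding q_def by linarith
  qed
qed

subsection \<open>Coefficients of the expansion\<close>

definition pole_factor :: "complex \<Rightarrow> complex \<Rightarrow> complex" where
  "pole_factor \<nu> s = (if \<nu> = 1 then s - 1 else 1)"

text \<open>The exponential generating function of \<open>q\<close> is \<open>e\<^bsup>at\<^esup> / (1 - \<nu> e\<^bsup>t\<^esup>)\<close>, with the polar part
  \<open>-1/t\<close> removed if \<open>\<nu> = 1\<close>; in that case \<open>q l = - B\<^bsub>l+1\<^esub>(a) / (l + 1)\<close>.\<close>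
definition lerch_coeffs :: "complex \<Rightarrow> complex \<Rightarrow> (nat \<Rightarrow> complex) \<Rightarrow> bool" where
  "lerch_coeffs \<nu> a q \<longleftrightarrow> (\<forall>R. q R - \<nu> * (\<Sum>l\<le>R. of_nat (R choose l) * q l)
      + (if \<nu> = 1 then 1 / of_nat (Suc R) else 0) = a ^ R)"

text \<open>For \<nu> \<noteq> 1 the equation at \<open>R\<close> determines \<open>q R\<close>,
  whose coefficient is \<open>1 - \<nu>\<close>. For \<nu> = 1 the two copies of \<open>q R\<close>
  cancel; the equation at \<open>R = Suc n\<close> then determines \<open>q n\<close>, with
  coefficient \<open>- Suc n\<close>, and the one at \<open>R = 0\<close> holds trivially.\<close>

lemma lerch_coeffs_exist: "\<exists>q. lerch_coeffs \<nu> a q"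
proof -
  have rec: "\<exists>q. \<forall>n. q n = F n q" if "\<And>n f g. (\<And>m. m < n \<Longrightarrow> f m = g m) \<Longrightarrow> F n f = F n g"
    for F :: "nat \<Rightarrow> (nat \<Rightarrow> complex) \<Rightarrow> complex"
    using dependent_wf_choice[OF wf_less_than, of "\<lambda>f x r. r = F x f"] that
    by (metis less_than_iff)
  show ?thesis
  proof (cases "\<nu> = 1")
    case True
    obtain q where q: "\<And>n. q n = (1 / of_nat (n + 2) - a ^ Suc n
        - (\<Sum>l<n. of_nat (Suc n choose l) * q l)) / of_nat (Suc n)"
      using rec[of "\<lambda>n q. (1 / of_nat (n + 2) - a ^ Suc n
        - (\<Sum>l<n. of_nat (Suc n choose l) * q l)) / of_nat (Suc n)"] by force
    have "q R - (\<Sum>l\<le>R. of_nat (R choose l) * q l) + 1 / of_nat (Suc R) = a ^ R" for R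
    proof (cases R)
      case (Suc n)
      have "(\<Sum>l\<le>R. of_nat (R choose l) * q l) =
          (\<Sum>l<n. of_nat (Suc n choose l) * q l) + of_nat (Suc n) * q n + q R"
        unfolding Suc by (simp add: lessThan_Suc_atMost[symmetric])
      moreover have "of_nat (Suc n) * q n = 1 / of_nat (n + 2) - a ^ Suc n
          - (\<Sum>l<n. of_nat (Suc n choose l) * q l)"
        by (subst q) (simp del: of_nat_Suc of_nat_add power_Suc)
      ultimately show ?thesis using Suc by simp
    qed simp
    then show ?thesis unfolding lerch_coeffs_def using True by auto
  next
    case False
    obtain q where q: "\<And>n. q n = (a ^ n + \<nu> * (\<Sum>l<n. of_nat (n choose l) * q l)) / (1 - \<nu>)"
      using rec[of "\<lambda>n q. (a ^ n + \<nu> * (\<Sum>l<n. of_nat (n choose l) * q l)) / (1 - \<nu>)"] by force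
    have "q R - \<nu> * (\<Sum>l\<le>R. of_nat (R choose l) * q l) = a ^ R" for R
    proof -
      have "(\<Sum>l\<le>R. of_nat (R choose l) * q l) = (\<Sum>l<R. of_nat (R choose l) * q l) + q R"
        by (simp add: lessThan_Suc_atMost[symmetric])
      moreover have "(1 - \<nu>) * q R = a ^ R + \<nu> * (\<Sum>l<R. of_nat (R choose l) * q l)"
        by (subst q) (use False in simp)
      ultimately show ?thesis by (simp add: algebra_simps)
    qed
    then show ?thesis unfolding lerch_coeffs_def using False by auto
  qed
qed

text \<open>With \<open>f(X) = X\<^bsup>-s\<^esup>\<close> and \<open>D = d/dX\<close> these are the coefficients of
  \<open>(s - 1) e\<^bsup>\<beta>D\<^esup> / (1 - \<nu> e\<^bsup>\<gamma>D\<^esup>) f\<close>, the factor \<open>s - 1\<close>, present only for \<open>\<nu> = 1\<close>, making them entire in \<open>s\<close>.\<close>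
definition expansion_coeff ::
  "complex \<Rightarrow> complex \<Rightarrow> (nat \<Rightarrow> complex) \<Rightarrow> nat \<Rightarrow> complex \<Rightarrow> complex" where
  "expansion_coeff \<nu> \<gamma> q r s =
     (case r of 0 \<Rightarrow> if \<nu> = 1 then inverse \<gamma> else 0
      | Suc l \<Rightarrow> pole_factor \<nu> s * ((- s) gchoose l) * (\<gamma> ^ l * q l))"

lemma expansion_coeff_0: "expansion_coeff \<nu> \<gamma> q 0 s = (if \<nu> = 1 then inverse \<gamma> else 0)"
  and expansion_coeff_Suc: "expansion_coeff \<nu> \<gamma> q (Suc l) s =
    pole_factor \<nu> s * ((- s) gchoose l) * (\<gamma> ^ l * q l)"
  by (simp_all add: expansion_coeff_def)

lemma holomorphic_expansion_coeff: "expansion_coeff \<nu> \<gamma> q r holomorphic_on A"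
proof (cases r)
  case 0
  then have "expansion_coeff \<nu> \<gamma> q r = (\<lambda>s. if \<nu> = 1 then inverse \<gamma> else 0)"
    by (auto simp: expansion_coeff_0)
  then show ?thesis by simp
next
  case (Suc l)
  have "(\<lambda>s. pole_factor \<nu> s * ((- s) gchoose l) * (\<gamma> ^ l * q l)) holomorphic_on A"
    unfolding pole_factor_def
    by (cases "\<nu> = 1") (auto intro!: holomorphic_intros holomorphic_gbinomial)
  then show ?thesis unfolding Suc expansion_coeff_def by simp
qed

text \<open>Comparison of the coefficients of \<open>X powr (- s - R)\<close> in the difference
  equation. Trinomial revision turns the product of binomials into \<open>(- s) gchoose R\<close>
  times \<open>R choose l\<close>, which leaves the recursion of \<open>lerch_coeffs\<close>; the
  polar term \<open>r = 0\<close> supplies \<open>1 / Suc R\<close> by absorption.\<close>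

lemma expansion_coeff_rel:
  assumes \<gamma>: "\<gamma> \<noteq> 0" and q: "lerch_coeffs \<nu> (\<beta> / \<gamma>) q"
  shows "expansion_coeff \<nu> \<gamma> q (Suc R) s
      - \<nu> * (\<Sum>r\<le>Suc R. expansion_coeff \<nu> \<gamma> q r s * ((1 - s - of_nat r) gchoose (Suc R - r)) * \<gamma> ^ (Suc R - r))
      = pole_factor \<nu> s * ((- s) gchoose R) * \<beta> ^ R"
proof -
  define p where "p = pole_factor \<nu> s"
  define g where "g = ((- s) gchoose R)"
  have t: "expansion_coeff \<nu> \<gamma> q (Suc l) s * ((1 - s - of_nat (Suc l)) gchoose (Suc R - Suc l))
      * \<gamma> ^ (Suc R - Suc l) = p * g * \<gamma> ^ R * (of_nat (R choose l) * q l)" if "l \<le> R" for l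
  proof -
    have "((- s) gchoose l) * ((- s - of_nat l) gchoose (R - l)) = g * of_nat (R choose l)"
      unfolding g_def using gbinomial_trinomial_revision[OF that, of "- s"]
      by (simp add: binomial_gbinomial)
    moreover have "\<gamma> ^ l * \<gamma> ^ (R - l) = \<gamma> ^ R" using that by (simp add: power_add[symmetric])
    ultimately have "p * (((- s) gchoose l) * ((- s - of_nat l) gchoose (R - l))) * (\<gamma> ^ l * \<gamma> ^ (R - l)) * q l
        = p * (g * of_nat (R choose l)) * \<gamma> ^ R * q l" by simp
    then show ?thesis by (simp add: expansion_coeff_Suc p_def algebra_simps)
  qed
  have 0: "\<nu> * (expansion_coeff \<nu> \<gamma> q 0 s * ((1 - s) gchoose Suc R) * \<gamma> ^ Suc R)
      = - (p * g * \<gamma> ^ R * (if \<nu> = 1 then 1 / of_nat (Suc R) else 0))"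
  proof (cases "\<nu> = 1")
    case True
    have "of_nat (Suc R) * ((1 - s) gchoose Suc R) = (1 - s) * g"
      unfolding g_def using gbinomial_absorption[of R "1 - s"] by simp
    then have "((1 - s) gchoose Suc R) = (1 - s) * g / of_nat (Suc R)"
      by (simp add: field_simps del: of_nat_Suc)
    then have "\<nu> * (expansion_coeff \<nu> \<gamma> q 0 s * ((1 - s) gchoose Suc R) * \<gamma> ^ Suc R)
        = inverse \<gamma> * ((1 - s) * g / of_nat (Suc R)) * (\<gamma> * \<gamma> ^ R)"
      using True by (simp add: expansion_coeff_0 del: of_nat_Suc)
    also have "\<dots> = (inverse \<gamma> * \<gamma>) * ((1 - s) * g * \<gamma> ^ R / of_nat (Suc R))" by simp
    also have "\<dots> = - (p * g * \<gamma> ^ R * (if \<nu> = 1 then 1 / of_nat (Suc R) else 0))"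
      using True \<gamma> by (simp add: p_def pole_factor_def left_diff_distrib diff_divide_distrib del: of_nat_Suc)
    finally show ?thesis .
  qed (simp add: expansion_coeff_0)
  have "(\<Sum>r\<le>Suc R. expansion_coeff \<nu> \<gamma> q r s * ((1 - s - of_nat r) gchoose (Suc R - r)) * \<gamma> ^ (Suc R - r))
      = expansion_coeff \<nu> \<gamma> q 0 s * ((1 - s) gchoose Suc R) * \<gamma> ^ Suc R
        + (\<Sum>l\<le>R. p * g * \<gamma> ^ R * (of_nat (R choose l) * q l))"
    unfolding sum.atMost_Suc_shift using t by simp
  then have "expansion_coeff \<nu> \<gamma> q (Suc R) s
      - \<nu> * (\<Sum>r\<le>Suc R. expansion_coeff \<nu> \<gamma> q r s * ((1 - s - of_nat r) gchoose (Suc R - r)) * \<gamma> ^ (Suc R - r))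
      = p * g * \<gamma> ^ R * (q R - \<nu> * (\<Sum>l\<le>R. of_nat (R choose l) * q l)
        + (if \<nu> = 1 then 1 / of_nat (Suc R) else 0))"
    using 0 by (simp add: expansion_coeff_Suc p_def g_def sum_distrib_left algebra_simps)
  also have "\<dots> = p * g * \<gamma> ^ R * (\<beta> / \<gamma>) ^ R" using q by (simp add: lerch_coeffs_def)
  also have "\<dots> = p * g * \<beta> ^ R" using \<gamma> by (simp add: power_divide)
  finally show ?thesis by (simp add: p_def g_def)
qed

definition expansion ::
  "complex \<Rightarrow> complex \<Rightarrow> (nat \<Rightarrow> complex) \<Rightarrow> nat \<Rightarrow> complex \<Rightarrow> complex \<Rightarrow> complex" where
  "expansion \<nu> \<gamma> q L s X = (\<Sum>r\<le>L. expansion_coeff \<nu> \<gamma> q r s * X powr (1 - s - of_nat r))"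

definition expansion_error ::
  "complex \<Rightarrow> complex \<Rightarrow> complex \<Rightarrow> (nat \<Rightarrow> complex) \<Rightarrow> nat \<Rightarrow> complex \<Rightarrow> complex \<Rightarrow> complex" where
  "expansion_error \<nu> \<gamma> \<beta> q L s X = pole_factor \<nu> s * (X + \<beta>) powr (- s)
     - expansion \<nu> \<gamma> q L s X + \<nu> * expansion \<nu> \<gamma> q L s (X + \<gamma>)"

text \<open>The r-th power is expanded to \<open>Suc L - r\<close> terms, so that every remainder
  has the common exponent \<open>- s - L\<close>. The expanded terms, collected by
  \<open>k = r + i\<close>, cancel by \<open>expansion_coeff_rel\<close>.\<close>

lemma expansion_error_eq:
  assumes \<gamma>: "\<gamma> \<noteq> 0" and q: "lerch_coeffs \<nu> (\<beta> / \<gamma>) q"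
  shows "expansion_error \<nu> \<gamma> \<beta> q L s X = pole_factor \<nu> s * powr_rem (- s) L \<beta> X
     + \<nu> * (\<Sum>r\<le>L. expansion_coeff \<nu> \<gamma> q r s * powr_rem (1 - s - of_nat r) (Suc L - r) \<gamma> X)"
proof -
  define d where "d = (\<lambda>r. expansion_coeff \<nu> \<gamma> q r s)"
  define x where "x = (\<lambda>k. X powr (1 - s - of_nat k))"
  define g where "g = (\<lambda>r i. d r * ((1 - s - of_nat r) gchoose i) * \<gamma> ^ i)"
  have "(\<Sum>r\<le>L. d r * (\<Sum>i<Suc L - r. ((1 - s - of_nat r) gchoose i) * \<gamma> ^ i
        * X powr (1 - s - of_nat r - of_nat i))) = (\<Sum>r\<le>L. \<Sum>i\<le>L - r. g r i * x (r + i))"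
  proof (rule sum.cong[OF refl])
    fix r assume "r \<in> {..L}"
    then have "Suc L - r = Suc (L - r)" by auto
    then show "d r * (\<Sum>i<Suc L - r. ((1 - s - of_nat r) gchoose i) * \<gamma> ^ i
        * X powr (1 - s - of_nat r - of_nat i)) = (\<Sum>i\<le>L - r. g r i * x (r + i))"
      by (simp add: lessThan_Suc_atMost sum_distrib_left g_def x_def algebra_simps)
  qed
  also have "\<dots> = (\<Sum>(r,i)\<in>{(r,i). r + i \<le> L}. g r i * x (r + i))"
  proof -
    have "{(r,i). r + i \<le> L} = (SIGMA r:{..L}. {..L - r})" by auto
    then show ?thesis by (simp add: sum.Sigma)
  qed
  also have "\<dots> = (\<Sum>k\<le>L. \<Sum>r\<le>k. g r (k - r) * x (r + (k - r)))"
    by (rule sum.triangle_reindex_eq)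
  also have "\<dots> = (\<Sum>k\<le>L. (\<Sum>r\<le>k. g r (k - r)) * x k)"
    by (simp add: sum_distrib_right)
  finally have 1: "(\<Sum>r\<le>L. d r * (\<Sum>i<Suc L - r. ((1 - s - of_nat r) gchoose i) * \<gamma> ^ i
        * X powr (1 - s - of_nat r - of_nat i))) = (\<Sum>k\<le>L. (\<Sum>r\<le>k. g r (k - r)) * x k)" .
  have "(\<Sum>k\<le>L. (d k - \<nu> * (\<Sum>r\<le>k. g r (k - r))) * x k)
      = (\<Sum>k<Suc L. (d k - \<nu> * (\<Sum>r\<le>k. g r (k - r))) * x k)"
    by (simp only: lessThan_Suc_atMost)
  also have "\<dots> = (d 0 - \<nu> * d 0) * x 0 +
      (\<Sum>i<L. (d (Suc i) - \<nu> * (\<Sum>r\<le>Suc i. g r (Suc i - r))) * x (Suc i))"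
    unfolding sum.lessThan_Suc_shift by (simp add: g_def)
  \<comment> \<open>The leading coefficient is zero unless \<nu> = 1, and in that case the two
    copies cancel.\<close>
  also have "(d 0 - \<nu> * d 0) = 0" by (simp add: d_def expansion_coeff_0)
  also have "(\<Sum>i<L. (d (Suc i) - \<nu> * (\<Sum>r\<le>Suc i. g r (Suc i - r))) * x (Suc i))
      = (\<Sum>i<L. pole_factor \<nu> s * ((- s) gchoose i) * \<beta> ^ i * X powr (- s - of_nat i))"
    unfolding g_def d_def x_def expansion_coeff_rel[OF \<gamma> q] by simp
  finally have 2: "(\<Sum>k\<le>L. d k * x k) - \<nu> * (\<Sum>k\<le>L. (\<Sum>r\<le>k. g r (k - r)) * x k)
      = pole_factor \<nu> s * (\<Sum>i<L. ((- s) gchoose i) * \<beta> ^ i * X powr (- s - of_nat i))"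
    by (simp add: sum_distrib_left left_diff_distrib sum_subtractf mult.assoc
          flip: sum_distrib_right sum_distrib_left)
  have 3: "(\<Sum>r\<le>L. d r * powr_rem (1 - s - of_nat r) (Suc L - r) \<gamma> X)
      = (\<Sum>r\<le>L. d r * (X + \<gamma>) powr (1 - s - of_nat r)) - (\<Sum>k\<le>L. (\<Sum>r\<le>k. g r (k - r)) * x k)"
    unfolding 1[symmetric] powr_rem_def by (simp add: right_diff_distrib sum_subtractf)
  define A where "A = (\<Sum>k\<le>L. d k * x k)"
  define B where "B = (\<Sum>k\<le>L. (\<Sum>r\<le>k. g r (k - r)) * x k)"
  define E where "E = (\<Sum>r\<le>L. d r * (X + \<gamma>) powr (1 - s - of_nat r))"
  define T where "T = (\<Sum>i<L. ((- s) gchoose i) * \<beta> ^ i * X powr (- s - of_nat i))"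
  have "expansion_error \<nu> \<gamma> \<beta> q L s X = pole_factor \<nu> s * (X + \<beta>) powr (- s) - A + \<nu> * E"
    by (simp add: expansion_error_def expansion_def A_def E_def d_def x_def)
  also have "\<dots> = pole_factor \<nu> s * ((X + \<beta>) powr (- s) - T) + \<nu> * (E - B)"
    using 2 unfolding A_def[symmetric] B_def[symmetric] T_def[symmetric] by (simp add: algebra_simps)
  also have "(X + \<beta>) powr (- s) - T = powr_rem (- s) L \<beta> X"
    by (simp add: T_def powr_rem_def)
  also have "E - B = (\<Sum>r\<le>L. expansion_coeff \<nu> \<gamma> q r s * powr_rem (1 - s - of_nat r) (Suc L - r) \<gamma> X)"
    using 3 by (simp add: E_def B_def d_def)
  finally show ?thesis .
qed

lemma expansion_error_bound:
  assumes \<gamma>: "Re \<gamma> > 0" and q: "lerch_coeffs \<nu> (\<beta> / \<gamma>) q" and \<delta>: "\<delta> > 0" and L: "L \<ge> 1"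
  shows "\<exists>C\<ge>0. \<forall>s X. cmod s \<le> R \<longrightarrow> Re X \<ge> \<delta> \<longrightarrow> Re (X + \<beta>) \<ge> \<delta> \<longrightarrow>
     cmod (expansion_error \<nu> \<gamma> \<beta> q L s X) \<le> C * cmod X powr (- Re s - real L)"
proof -
  have \<gamma>0: "\<gamma> \<noteq> 0" using \<gamma> by auto
  have hp: "pole_factor \<nu> holomorphic_on UNIV"
    unfolding pole_factor_def by (cases "\<nu> = 1") (auto intro!: holomorphic_intros)
  obtain P where P: "P \<ge> 0" "\<And>s. cmod s \<le> R \<Longrightarrow> cmod (pole_factor \<nu> s) \<le> P"
    using entire_bounded[OF hp] by blast
  obtain C0 where C0: "C0 \<ge> 0" "\<And>e X. cmod e \<le> R \<Longrightarrow> Re X \<ge> \<delta> \<Longrightarrow> Re (X + \<beta>) \<ge> \<delta> \<Longrightarrow>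
      cmod (powr_rem e L \<beta> X) \<le> C0 * cmod X powr (Re e - real L)"
    using powr_rem_bound_uniform[OF \<delta> L, of R \<beta>] by blast
  \<comment> \<open>The \<open>max 1\<close> keeps the expansion order positive, so that constants
    can be chosen for all \<open>r\<close> at once; for \<open>r \<le> L\<close> it
    disappears.\<close>
  have "\<exists>C\<ge>0. \<forall>e X. cmod e \<le> 1 + R + real r \<longrightarrow> Re X \<ge> \<delta> \<longrightarrow> Re (X + \<gamma>) \<ge> \<delta> \<longrightarrow>
      cmod (powr_rem e (max 1 (Suc L - r)) \<gamma> X) \<le> C * cmod X powr (Re e - real (max 1 (Suc L - r)))" for r
    by (rule powr_rem_bound_uniform[OF \<delta>]) simp
  then obtain C1 where C1: "\<And>r. C1 r \<ge> 0" "\<And>r e X. cmod e \<le> 1 + R + real r \<Longrightarrow> Re X \<ge> \<delta> \<Longrightarrow>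
      Re (X + \<gamma>) \<ge> \<delta> \<Longrightarrow>
      cmod (powr_rem e (max 1 (Suc L - r)) \<gamma> X) \<le> C1 r * cmod X powr (Re e - real (max 1 (Suc L - r)))"
    by metis
  have "\<exists>C\<ge>0. \<forall>s. cmod s \<le> R \<longrightarrow> cmod (expansion_coeff \<nu> \<gamma> q r s) \<le> C" for r
    by (rule entire_bounded[OF holomorphic_expansion_coeff])
  then obtain D where D: "\<And>r. D r \<ge> 0" "\<And>r s. cmod s \<le> R \<Longrightarrow> cmod (expansion_coeff \<nu> \<gamma> q r s) \<le> D r"
    by metis
  define C where "C = P * C0 + cmod \<nu> * (\<Sum>r\<le>L. D r * C1 r)"
  show ?thesis
  proof (intro exI[of _ C] conjI allI impI)
    show "C \<ge> 0" unfolding C_def using P C0 D C1 by (intro add_nonneg_nonneg mult_nonneg_nonneg sum_nonneg) auto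
    fix s X assume s: "cmod s \<le> R" and X: "Re X \<ge> \<delta>" "Re (X + \<beta>) \<ge> \<delta>"
    define t where "t = cmod X powr (- Re s - real L)"
    have "cmod (pole_factor \<nu> s * powr_rem (- s) L \<beta> X) \<le> P * (C0 * t)"
      unfolding norm_mult t_def using P(2)[OF s] C0(2)[of "- s" X] s X P(1)
      by (intro mult_mono) auto
    moreover have "cmod (expansion_coeff \<nu> \<gamma> q r s * powr_rem (1 - s - of_nat r) (Suc L - r) \<gamma> X)
        \<le> D r * (C1 r * t)" if "r \<le> L" for r
    proof -
      have m: "max 1 (Suc L - r) = Suc L - r" using that by auto
      have "cmod (1 - s - of_nat r) \<le> 1 + R + real r"
        using norm_triangle_ineq4[of "1 - s" "of_nat r"] norm_triangle_ineq4[of 1 s] s by simp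
      moreover have "Re (1 - s - of_nat r) - real (Suc L - r) = - Re s - real L"
        using that by (simp add: of_nat_diff)
      ultimately have "cmod (powr_rem (1 - s - of_nat r) (Suc L - r) \<gamma> X) \<le> C1 r * t"
        using C1(2)[of "1 - s - of_nat r" r X] X \<gamma> unfolding m t_def by simp
      then show ?thesis unfolding norm_mult using D(1)[of r] D(2)[OF s, of r] by (intro mult_mono) auto
    qed
    then have "cmod (\<Sum>r\<le>L. expansion_coeff \<nu> \<gamma> q r s * powr_rem (1 - s - of_nat r) (Suc L - r) \<gamma> X)
        \<le> (\<Sum>r\<le>L. D r * (C1 r * t))"
      by (intro sum_norm_le) auto
    then have "cmod (\<nu> * (\<Sum>r\<le>L. expansion_coeff \<nu> \<gamma> q r s * powr_rem (1 - s - of_nat r) (Suc L - r) \<gamma> X))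
        \<le> cmod \<nu> * (\<Sum>r\<le>L. D r * (C1 r * t))"
      unfolding norm_mult by (intro mult_left_mono) auto
    ultimately have "cmod (expansion_error \<nu> \<gamma> \<beta> q L s X)
        \<le> P * (C0 * t) + cmod \<nu> * (\<Sum>r\<le>L. D r * (C1 r * t))"
      unfolding expansion_error_eq[OF \<gamma>0 q] by (intro order_trans[OF norm_triangle_ineq] add_mono)
    also have "\<dots> = C * t" by (simp add: C_def algebra_simps sum_distrib_left)
    finally show "cmod (expansion_error \<nu> \<gamma> \<beta> q L s X) \<le> C * cmod X powr (- Re s - real L)"
      by (simp add: t_def)
  qed
qed

text \<open>For \<open>r \<le> Suc N\<close> the exponent \<open>Suc N - r\<close> is a natural
  number below the expansion order, so that expansion is exact. For larger \<open>r\<close> the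
  coefficient contains \<open>N choose l\<close> with \<open>l > N\<close>.\<close>

lemma expansion_error_neg_nat:
  assumes \<gamma>: "Re \<gamma> > 0" and q: "lerch_coeffs \<nu> (\<beta> / \<gamma>) q" and X: "Re X > 0" "Re (X + \<beta>) > 0"
    and N: "N < L"
  shows "expansion_error \<nu> \<gamma> \<beta> q L (- of_nat N) X = 0"
proof -
  have \<gamma>0: "\<gamma> \<noteq> 0" using \<gamma> by auto
  have "expansion_coeff \<nu> \<gamma> q r (- of_nat N) * powr_rem (1 - - of_nat N - of_nat r) (Suc L - r) \<gamma> X = 0"
    if "r \<le> L" for r
  proof (cases "r \<le> Suc N")
    case True
    then have "1 - - of_nat N - of_nat r = (of_nat (Suc N - r) :: complex)" by (simp add: of_nat_diff)
    then show ?thesis using powr_rem_of_nat[of X \<gamma> "Suc N - r" "Suc L - r"] X \<gamma> N True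
      by (simp del: of_nat_Suc)
  next
    case False
    then obtain l where l: "r = Suc l" "l > N" by (cases r) auto
    have "(- (- of_nat N) gchoose l :: complex) = of_nat (N choose l)" by (simp add: binomial_gbinomial)
    then show ?thesis using l by (simp add: expansion_coeff_Suc binomial_eq_0)
  qed
  moreover have "powr_rem (- (- of_nat N)) L \<beta> X = 0"
    using powr_rem_of_nat[OF X N] by simp
  moreover from calculation have "(\<Sum>r\<le>L. expansion_coeff \<nu> \<gamma> q r (- of_nat N) *
      powr_rem (1 - - of_nat N - of_nat r) (Suc L - r) \<gamma> X) = 0"
    by (intro sum.neutral) (metis atMost_iff)
  ultimately show ?thesis unfolding expansion_error_eq[OF \<gamma>0 q] by (simp only: mult_zero_right add_0)
qed

text \<open>At \<open>s = 1\<close> the pole factor vanishes, so only \<open>r = 0\<close> remains,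
  and its power is the constant \<open>X powr 0\<close>. This is what makes the residue at
  \<open>s = 1\<close> computable.\<close>

lemma expansion_error_1:
  assumes \<gamma>: "Re \<gamma> > 0" and X: "Re X > 0"
    and q: "lerch_coeffs 1 (\<beta> / \<gamma>) q"
  shows "expansion_error 1 \<gamma> \<beta> q L 1 X = 0"
proof -
  have "expansion_coeff 1 \<gamma> q r 1 * powr_rem (1 - 1 - of_nat r) (Suc L - r) \<gamma> X = 0" for r
  proof (cases r)
    case 0
    then show ?thesis using powr_rem_of_nat[of X \<gamma> 0 "Suc L"] X \<gamma> by simp
  qed (simp add: expansion_coeff_Suc pole_factor_def)
  then have "(\<Sum>r\<le>L. expansion_coeff 1 \<gamma> q r 1 * powr_rem (1 - 1 - of_nat r) (Suc L - r) \<gamma> X) = 0"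
    by (intro sum.neutral) blast
  moreover have \<gamma>0: "\<gamma> \<noteq> 0" using \<gamma> by auto
  ultimately show ?thesis unfolding expansion_error_eq[OF \<gamma>0 q] by (simp add: pole_factor_def)
qed

lemma holomorphic_powr_exponent: "X \<noteq> 0 \<Longrightarrow> f holomorphic_on A \<Longrightarrow> (\<lambda>s. X powr f s) holomorphic_on A"
  for X :: complex
  by (simp add: powr_def) (intro holomorphic_intros)

lemma holomorphic_expansion_error:
  assumes "X \<noteq> 0" "X + \<beta> \<noteq> 0" "X + \<gamma> \<noteq> 0"
  shows "(\<lambda>s. expansion_error \<nu> \<gamma> \<beta> q L s X) holomorphic_on A"
proof -
  have "pole_factor \<nu> holomorphic_on A"
    unfolding pole_factor_def by (cases "\<nu> = 1") (auto intro!: holomorphic_intros)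
  then show ?thesis unfolding expansion_error_def expansion_def
    by (intro holomorphic_intros holomorphic_expansion_coeff holomorphic_powr_exponent assms)
qed

text \<open>The difference equation at \<open>X + \<gamma> * of_nat k\<close>, weighted by
  \<open>\<nu> ^ k\<close>, telescopes. \<open>Re s > 1\<close> makes the leading power, with
  exponent \<open>1 - s\<close>, tend to 0 along the progression.\<close>

lemma powr_sum_telescope:
  assumes \<gamma>: "Re \<gamma> > 0" and \<nu>: "cmod \<nu> \<le> 1" and s: "Re s > 1" and X: "Re X > 0"
    and S: "(\<lambda>k. \<nu> ^ k * (X + \<gamma> * of_nat k + \<beta>) powr (- s)) sums S"
    and H: "(\<lambda>k. \<nu> ^ k * expansion_error \<nu> \<gamma> \<beta> q L s (X + \<gamma> * of_nat k)) sums H"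
  shows "pole_factor \<nu> s * S = expansion \<nu> \<gamma> q L s X + H"
proof -
  define f where "f = (\<lambda>k. \<nu> ^ k * expansion \<nu> \<gamma> q L s (X + \<gamma> * of_nat k))"
  have big: "filterlim (\<lambda>k. cmod (X + \<gamma> * of_nat k)) at_top sequentially"
  proof (rule filterlim_at_top_mono)
    show "filterlim (\<lambda>k. Re \<gamma> * real k) at_top sequentially"
      by (rule filterlim_tendsto_pos_mult_at_top[OF tendsto_const \<gamma> filterlim_real_sequentially])
    show "\<forall>\<^sub>F k in sequentially. Re \<gamma> * real k \<le> cmod (X + \<gamma> * of_nat k)"
    proof (rule always_eventually, rule allI)
      fix k
      have "Re \<gamma> * real k \<le> Re (X + \<gamma> * of_nat k)" using X by simp
      also have "\<dots> \<le> cmod (X + \<gamma> * of_nat k)" by (rule complex_Re_le_cmod)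
      finally show "Re \<gamma> * real k \<le> cmod (X + \<gamma> * of_nat k)" .
    qed
  qed
  have nz: "X + \<gamma> * of_nat k \<noteq> 0" for k
  proof -
    have "Re (X + \<gamma> * of_nat k) > 0" using X \<gamma> by (simp add: add_pos_nonneg)
    then show ?thesis by (metis less_irrefl zero_complex.sel(1))
  qed
  have pw: "(\<lambda>k. (X + \<gamma> * of_nat k) powr (1 - s - of_nat r)) \<longlonglongrightarrow> 0" for r
  proof (rule Lim_null_comparison)
    let ?e = "1 - s - of_nat r"
    have "(\<lambda>k. cmod (X + \<gamma> * of_nat k) powr Re ?e) \<longlonglongrightarrow> 0"
      by (rule tendsto_neg_powr[OF _ big]) (use s in simp)
    from tendsto_mult_right_zero[OF this]
    show "(\<lambda>k. exp ((ln 1 + pi) * cmod ?e) * cmod (X + \<gamma> * of_nat k) powr Re ?e) \<longlonglongrightarrow> 0" .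
    show "\<forall>\<^sub>F k in sequentially. cmod ((X + \<gamma> * of_nat k) powr ?e)
        \<le> exp ((ln 1 + pi) * cmod ?e) * cmod (X + \<gamma> * of_nat k) powr Re ?e"
      by (rule always_eventually, rule allI, rule powr_norm_bound) (use nz in auto)
  qed
  have ex0: "(\<lambda>k. expansion \<nu> \<gamma> q L s (X + \<gamma> * of_nat k)) \<longlonglongrightarrow> 0"
    unfolding expansion_def by (rule tendsto_null_sum, rule tendsto_mult_right_zero, rule pw)
  have f0: "f \<longlonglongrightarrow> 0"
  proof (rule Lim_null_comparison[OF _ tendsto_norm_zero[OF ex0]], rule always_eventually, rule allI)
    fix k
    have "cmod \<nu> ^ k \<le> 1" using \<nu> by (simp add: power_le_one)
    then show "cmod (f k) \<le> cmod (expansion \<nu> \<gamma> q L s (X + \<gamma> * of_nat k))"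
      unfolding f_def norm_mult norm_power by (simp add: mult_left_le_one_le)
  qed
  have "(\<lambda>k. f k - f (Suc k)) sums (f 0 - 0)" by (rule telescope_sums'[OF f0])
  moreover have "f k - f (Suc k) = pole_factor \<nu> s * (\<nu> ^ k * (X + \<gamma> * of_nat k + \<beta>) powr (- s))
      - \<nu> ^ k * expansion_error \<nu> \<gamma> \<beta> q L s (X + \<gamma> * of_nat k)" for k
    unfolding f_def expansion_error_def by (simp add: algebra_simps)
  ultimately have "(\<lambda>k. pole_factor \<nu> s * (\<nu> ^ k * (X + \<gamma> * of_nat k + \<beta>) powr (- s))
      - \<nu> ^ k * expansion_error \<nu> \<gamma> \<beta> q L s (X + \<gamma> * of_nat k)) sums expansion \<nu> \<gamma> q L s X"
    by (simp add: f_def)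
  moreover have "(\<lambda>k. pole_factor \<nu> s * (\<nu> ^ k * (X + \<gamma> * of_nat k + \<beta>) powr (- s))
      - \<nu> ^ k * expansion_error \<nu> \<gamma> \<beta> q L s (X + \<gamma> * of_nat k)) sums (pole_factor \<nu> s * S - H)"
    by (intro sums_diff sums_mult S H)
  ultimately have "expansion \<nu> \<gamma> q L s X = pole_factor \<nu> s * S - H" using sums_unique2 by blast
  then show ?thesis by simp
qed

subsection \<open>Absolute convergence\<close>

definition psize :: "(nat \<Rightarrow> nat) \<Rightarrow> nat \<Rightarrow> real" where
  "psize m j = (\<Sum>i=1..j. real (m i))"

lemma psize_ge: "i \<in> {1..j} \<Longrightarrow> real (m i) \<le> psize m j"
  unfolding psize_def by (rule member_le_sum) auto

lemma psize_ge_1: "m 1 \<ge> 1 \<Longrightarrow> j \<ge> 1 \<Longrightarrow> psize m j \<ge> 1"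
  using psize_ge[of 1 j m] by auto

lemma psize_Suc: "psize m (Suc j) = psize m j + real (m (Suc j))"
  by (simp add: psize_def)

text \<open>Individual exponents may be negative; only their tails are controlled. As the
  \<open>T j\<close> do not decrease, the excess of the last exponent over \<tau> may be moved to
  the preceding factor, which leaves the tail conditions for one factor fewer.\<close>

lemma prod_powr_tail_le:
  fixes T \<sigma> :: "nat \<Rightarrow> real"
  assumes "\<tau> \<ge> 0" "\<And>j. j \<in> {1..n} \<Longrightarrow> T j \<ge> 1" "\<And>j. j \<in> {1..n} \<Longrightarrow> T j \<le> T (Suc j)"
    and "\<And>j. j \<in> {1..n} \<Longrightarrow> (\<Sum>i=j..n. \<sigma> i) \<ge> real (n + 1 - j) * \<tau>"
  shows "(\<Prod>j=1..n. T j powr (- \<sigma> j)) \<le> (\<Prod>j=1..n. T j powr (- \<tau>))"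
  using assms
proof (induction n arbitrary: \<sigma>)
  case (Suc n)
  have last: "\<sigma> (Suc n) \<ge> \<tau>" using Suc.prems(4)[of "Suc n"] by simp
  have T1: "T (Suc n) \<ge> 1" using Suc.prems(2)[of "Suc n"] by simp
  show ?case
  proof (cases n)
    case 0
    then show ?thesis using last T1 by (simp add: powr_mono)
  next
    case (Suc k)
    define \<sigma>' where "\<sigma>' = \<sigma>(n := \<sigma> n + \<sigma> (Suc n) - \<tau>)"
    have n: "n \<in> {1..n}" using Suc by simp
    have Tn: "T n \<ge> 1" "T n \<le> T (Suc n)" using Suc.prems(2,3)[of n] Suc by auto
    have tail: "(\<Sum>i=j..n. \<sigma>' i) \<ge> real (n + 1 - j) * \<tau>" if j: "j \<in> {1..n}" for j
    proof -
      have "(\<Sum>i=j..n. \<sigma>' i) = (\<Sum>i\<in>{j..n} - {n}. \<sigma>' i) + \<sigma>' n"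
        using j by (subst sum.remove[of _ n]) auto
      also have "(\<Sum>i\<in>{j..n} - {n}. \<sigma>' i) = (\<Sum>i\<in>{j..n} - {n}. \<sigma> i)"
        by (rule sum.cong) (auto simp: \<sigma>'_def)
      also have "\<dots> = (\<Sum>i=j..n. \<sigma> i) - \<sigma> n" using j by (subst (2) sum.remove[of _ n]) auto
      finally have "(\<Sum>i=j..n. \<sigma>' i) = (\<Sum>i=j..Suc n. \<sigma> i) - \<tau>" using j by (simp add: \<sigma>'_def)
      moreover have "(\<Sum>i=j..Suc n. \<sigma> i) \<ge> real (Suc n + 1 - j) * \<tau>"
        using Suc.prems(4)[of j] j by auto
      ultimately show ?thesis using j by (simp add: of_nat_diff algebra_simps)
    qed
    have "T (Suc n) powr (- \<sigma> (Suc n)) = T (Suc n) powr (- \<tau>) * T (Suc n) powr (- (\<sigma> (Suc n) - \<tau>))"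
      by (simp add: powr_add[symmetric])
    also have "\<dots> \<le> T (Suc n) powr (- \<tau>) * T n powr (- (\<sigma> (Suc n) - \<tau>))"
      using Tn last by (intro mult_left_mono powr_mono2') auto
    finally have le: "T (Suc n) powr (- \<sigma> (Suc n)) \<le>
        T (Suc n) powr (- \<tau>) * T n powr (- (\<sigma> (Suc n) - \<tau>))" .
    have "(\<Prod>j=1..n. T j powr (- \<sigma> j)) * T n powr (- (\<sigma> (Suc n) - \<tau>)) = (\<Prod>j=1..n. T j powr (- \<sigma>' j))"
    proof -
      have "(\<Prod>j=1..n. T j powr (- \<sigma> j)) = T n powr (- \<sigma> n) * (\<Prod>j\<in>{1..n} - {n}. T j powr (- \<sigma> j))"
        using n by (subst prod.remove[of _ n]) auto
      also have "(\<Prod>j\<in>{1..n} - {n}. T j powr (- \<sigma> j)) = (\<Prod>j\<in>{1..n} - {n}. T j powr (- \<sigma>' j))"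
        by (rule prod.cong) (auto simp: \<sigma>'_def)
      finally have "(\<Prod>j=1..n. T j powr (- \<sigma> j)) * T n powr (- (\<sigma> (Suc n) - \<tau>)) =
          (T n powr (- \<sigma> n) * T n powr (- (\<sigma> (Suc n) - \<tau>))) * (\<Prod>j\<in>{1..n} - {n}. T j powr (- \<sigma>' j))"
        by simp
      also have "T n powr (- \<sigma> n) * T n powr (- (\<sigma> (Suc n) - \<tau>)) = T n powr (- \<sigma>' n)"
        by (simp add: powr_add[symmetric] \<sigma>'_def algebra_simps)
      also have "\<dots> * (\<Prod>j\<in>{1..n} - {n}. T j powr (- \<sigma>' j)) = (\<Prod>j=1..n. T j powr (- \<sigma>' j))"
        using n by (subst (2) prod.remove[of _ n]) auto
      finally show ?thesis .
    qed
    also have "(\<Prod>j=1..n. T j powr (- \<sigma>' j)) \<le> (\<Prod>j=1..n. T j powr (- \<tau>))"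
      by (rule Suc.IH) (use Suc.prems tail in auto)
    finally have *: "(\<Prod>j=1..n. T j powr (- \<sigma> j)) * T n powr (- (\<sigma> (Suc n) - \<tau>)) \<le>
        (\<Prod>j=1..n. T j powr (- \<tau>))" .
    have "(\<Prod>j=1..Suc n. T j powr (- \<sigma> j)) = (\<Prod>j=1..n. T j powr (- \<sigma> j)) * T (Suc n) powr (- \<sigma> (Suc n))"
      by simp
    also have "\<dots> \<le> (\<Prod>j=1..n. T j powr (- \<sigma> j)) *
        (T (Suc n) powr (- \<tau>) * T n powr (- (\<sigma> (Suc n) - \<tau>)))"
      by (intro mult_left_mono le prod_nonneg) auto
    also have "\<dots> = ((\<Prod>j=1..n. T j powr (- \<sigma> j)) * T n powr (- (\<sigma> (Suc n) - \<tau>))) * T (Suc n) powr (- \<tau>)"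
      by simp
    also have "\<dots> \<le> (\<Prod>j=1..n. T j powr (- \<tau>)) * T (Suc n) powr (- \<tau>)"
      by (intro mult_right_mono *) auto
    finally show ?thesis by simp
  qed
qed simp

lemma has_sum_sum:
  fixes f :: "'i \<Rightarrow> 'a \<Rightarrow> 'b::topological_comm_monoid_add"
  assumes "\<And>i. i \<in> I \<Longrightarrow> (f i has_sum S i) A"
  shows "((\<lambda>x. \<Sum>i\<in>I. f i x) has_sum (\<Sum>i\<in>I. S i)) A"
  using assms by (induction I rule: infinite_finite_induct) (auto intro: has_sum_add)

lemma summable_on_times_nonneg:
  fixes f :: "'a \<Rightarrow> real" and g :: "'b \<Rightarrow> real"
  assumes f: "f summable_on A" "\<And>x. f x \<ge> 0" and g: "g summable_on B" "\<And>x. g x \<ge> 0"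
  shows "(\<lambda>(x, y). f x * g y) summable_on A \<times> B"
proof (rule summable_on_SigmaI)
  show "((\<lambda>y. case (x, y) of (x, y) \<Rightarrow> f x * g y) has_sum f x * infsum g B) B" for x
    using has_sum_cmult_right[OF has_sum_infsum[OF g(1)], of "f x"] by simp
  show "(\<lambda>x. f x * infsum g B) summable_on A" by (rule summable_on_cmult_left[OF f(1)])
qed (use f(2) g(2) in auto)

lemma summable_on_multi_index:
  fixes g :: "nat \<Rightarrow> real" and n :: nat
  assumes g: "g summable_on UNIV" "\<And>k. g k \<ge> 0"
  shows "(\<lambda>m. \<Prod>j=1..n. g (m j)) summable_on {m. \<forall>j. j \<notin> {1..n} \<longrightarrow> m j = 0}"
proof (induction n)
  case 0
  have "{m::nat \<Rightarrow> nat. \<forall>j. j \<notin> {1..0} \<longrightarrow> m j = 0} = {\<lambda>_. 0}" by auto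
  then show ?case by simp
next
  case (Suc n)
  let ?I = "\<lambda>n. {m::nat \<Rightarrow> nat. \<forall>j. j \<notin> {1..n} \<longrightarrow> m j = 0}"
  have bij: "bij_betw (\<lambda>(m, k). m(Suc n := k)) (?I n \<times> UNIV) (?I (Suc n))"
    by (rule bij_betw_byWitness[where f' = "\<lambda>m. (m(Suc n := 0), m (Suc n))"])
       (auto simp: fun_eq_iff)
  have "(\<lambda>(m, k). (\<Prod>j=1..n. g (m j)) * g k) summable_on ?I n \<times> UNIV"
    by (rule summable_on_times_nonneg[OF Suc]) (use g in \<open>auto intro: prod_nonneg\<close>)
  also have "(\<lambda>(m, k). (\<Prod>j=1..n. g (m j)) * g k) =
      (\<lambda>x. (\<lambda>m. \<Prod>j=1..Suc n. g (m j)) ((\<lambda>(m, k). m(Suc n := k)) x))"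
  proof
    fix x :: "(nat \<Rightarrow> nat) \<times> nat"
    obtain m k where x: "x = (m, k)" by force
    have "(\<Prod>j=1..n. g ((m(Suc n := k)) j)) = (\<Prod>j=1..n. g (m j))"
      by (rule prod.cong) auto
    then show "(case x of (m, k) \<Rightarrow> (\<Prod>j=1..n. g (m j)) * g k) =
        (\<lambda>m. \<Prod>j=1..Suc n. g (m j)) (case x of (m, k) \<Rightarrow> m(Suc n := k))"
      by (simp add: x)
  qed
  finally show ?case using summable_on_reindex_bij_betw[OF bij] by blast
qed

text \<open>The tail conditions are finitely many strict inequalities, so a single \<tau> > 1
  satisfies all of them with \<open>real (n + 1 - j) * \<tau>\<close>. Bounding
  \<open>psize m j\<close> below by \<open>max 1 (real (m j))\<close> then separates the
  variables.\<close>

lemma psize_prod_summable: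
  assumes n: "n \<ge> 1" and \<sigma>: "\<And>j. j \<in> {1..n} \<Longrightarrow> (\<Sum>i=j..n. \<sigma> i) > real (n + 1 - j)"
  shows "(\<lambda>m. \<Prod>j=1..n. psize m j powr (- \<sigma> j)) summable_on idx n"
proof -
  define \<tau> where "\<tau> = Min ((\<lambda>j. (\<Sum>i=j..n. \<sigma> i) / real (n + 1 - j)) ` {1..n})"
  have \<tau>1: "\<tau> > 1" unfolding \<tau>_def using n \<sigma> by (subst Min_gr_iff) (auto simp: less_divide_eq)
  have tail: "(\<Sum>i=j..n. \<sigma> i) \<ge> real (n + 1 - j) * \<tau>" if "j \<in> {1..n}" for j
  proof -
    have "\<tau> \<le> (\<Sum>i=j..n. \<sigma> i) / real (n + 1 - j)" unfolding \<tau>_def using that by (intro Min_le) auto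
    then show ?thesis using that by (simp add: le_divide_eq mult.commute)
  qed
  define g where "g = (\<lambda>k::nat. max 1 (real k) powr (- \<tau>))"
  have "summable g"
  proof -
    have "eventually (\<lambda>k. real k powr (- \<tau>) = g k) sequentially"
      using eventually_ge_at_top[of "1::nat"] by eventually_elim (auto simp: g_def max_def)
    then show ?thesis using summable_cong summable_real_powr_iff[of "- \<tau>"] \<tau>1 by force
  qed
  then have "g summable_on UNIV" by (subst summable_on_UNIV_nonneg_real_iff) (auto simp: g_def)
  then have "(\<lambda>m. \<Prod>j=1..n. g (m j)) summable_on {m. \<forall>j. j \<notin> {1..n} \<longrightarrow> m j = 0}"
    by (rule summable_on_multi_index) (auto simp: g_def)
  then have "(\<lambda>m. \<Prod>j=1..n. g (m j)) summable_on idx n"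
    by (rule summable_on_subset_banach) (auto simp: idx_def)
  then show ?thesis
  proof (rule summable_on_comparison_test)
    fix m assume m: "m \<in> idx n"
    then have m1: "m 1 \<ge> 1" by (simp add: idx_def)
    have "(\<Prod>j=1..n. psize m j powr (- \<sigma> j)) \<le> (\<Prod>j=1..n. psize m j powr (- \<tau>))"
      by (rule prod_powr_tail_le) (use \<tau>1 tail psize_ge_1[of m, OF m1] in \<open>auto simp: psize_Suc\<close>)
    also have "\<dots> \<le> (\<Prod>j=1..n. g (m j))"
    proof (rule prod_mono, safe)
      fix j assume j: "j \<in> {1..n}"
      have "max 1 (real (m j)) \<le> psize m j"
        using psize_ge_1[of m j, OF m1] psize_ge[of j j m] j by auto
      then show "psize m j powr (- \<tau>) \<le> g (m j)"
        unfolding g_def using \<tau>1 by (intro powr_mono2') auto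
    qed auto
    finally show "(\<Prod>j=1..n. psize m j powr (- \<sigma> j)) \<le> (\<Prod>j=1..n. g (m j))" .
  qed (auto intro: prod_nonneg)
qed

definition lform :: "(nat \<Rightarrow> complex) \<Rightarrow> complex \<Rightarrow> (nat \<Rightarrow> nat) \<Rightarrow> nat \<Rightarrow> complex" where
  "lform \<gamma> c m j = (\<Sum>i=1..j. \<gamma> i * of_nat (m i)) + c"

text \<open>Since \<open>m 1 \<ge> 1\<close>, one copy of \<open>\<gamma> 1\<close> can be set aside
  to absorb \<open>c\<close>: the real part of their sum is positive. The remaining terms are at
  least \<kappa> times their weight in \<open>psize\<close>.\<close>

lemma lform_bounds:
  assumes \<gamma>: "\<forall>i\<in>{1..j}. Re (\<gamma> i) > 0" and c: "Re c > - Re (\<gamma> 1)" and j: "j \<ge> 1"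
  shows "\<exists>\<delta> K. \<delta> > 0 \<and> K \<ge> 1 \<and> (\<forall>m. m 1 \<ge> 1 \<longrightarrow> Re (lform \<gamma> c m j) \<ge> \<delta> \<and>
    cmod (lform \<gamma> c m j) \<le> K * psize m j \<and> psize m j \<le> K * cmod (lform \<gamma> c m j))"
proof -
  define \<kappa> where "\<kappa> = Min (insert (Re (\<gamma> 1) + Re c) ((\<lambda>i. Re (\<gamma> i)) ` {1..j}))"
  have \<kappa>0: "\<kappa> > 0" unfolding \<kappa>_def using \<gamma> c by (subst Min_gr_iff) auto
  have \<kappa>c: "\<kappa> \<le> Re (\<gamma> 1) + Re c" unfolding \<kappa>_def by (rule Min_le) auto
  have \<kappa>i: "\<kappa> \<le> Re (\<gamma> i)" if "i \<in> {1..j}" for i unfolding \<kappa>_def by (rule Min_le) (use that in auto)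
  define K where "K = max (max 1 (1 / \<kappa>)) ((\<Sum>i=1..j. cmod (\<gamma> i)) + cmod c)"
  show ?thesis
  proof (rule exI[of _ \<kappa>], rule exI[of _ K], intro conjI allI impI)
    show "K \<ge> 1" by (simp add: K_def)
    fix m :: "nat \<Rightarrow> nat" assume m1: "m 1 \<ge> 1"
    have p1: "psize m j \<ge> 1" by (rule psize_ge_1[of m j, OF m1 j])
    have "\<kappa> * psize m j = \<kappa> * real (m 1) + (\<Sum>i=Suc 1..j. \<kappa> * real (m i))"
      unfolding psize_def using j by (simp add: sum.atLeast_Suc_atMost sum_distrib_left distrib_left)
    also have "\<dots> \<le> (Re (\<gamma> 1) * real (m 1) + Re c) + (\<Sum>i=Suc 1..j. Re (\<gamma> i) * real (m i))"
    proof (intro add_mono sum_mono mult_right_mono)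
      have "\<kappa> * (real (m 1) - 1) \<le> Re (\<gamma> 1) * (real (m 1) - 1)"
        using \<kappa>i[of 1] j m1 by (intro mult_right_mono) auto
      then show "\<kappa> * real (m 1) \<le> Re (\<gamma> 1) * real (m 1) + Re c" using \<kappa>c by (simp add: algebra_simps)
    qed (use \<kappa>i in auto)
    also have "\<dots> = Re (lform \<gamma> c m j)"
      unfolding lform_def using j by (simp add: sum.atLeast_Suc_atMost)
    finally have lo: "\<kappa> * psize m j \<le> Re (lform \<gamma> c m j)" .
    have "\<kappa> \<le> \<kappa> * psize m j" using p1 \<kappa>0 by simp
    with lo show "\<kappa> \<le> Re (lform \<gamma> c m j)" by linarith
    have Re0: "0 \<le> Re (lform \<gamma> c m j)"
      using lo mult_nonneg_nonneg[of \<kappa> "psize m j"] \<kappa>0 p1 by linarith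
    have "psize m j \<le> 1 / \<kappa> * Re (lform \<gamma> c m j)" using lo \<kappa>0 by (simp add: field_simps)
    also have "\<dots> \<le> K * cmod (lform \<gamma> c m j)"
      using \<kappa>0 complex_Re_le_cmod Re0 by (intro mult_mono) (auto simp: K_def)
    finally show "psize m j \<le> K * cmod (lform \<gamma> c m j)" .
    have "cmod (lform \<gamma> c m j) \<le> (\<Sum>i=1..j. cmod (\<gamma> i) * real (m i)) + cmod c"
      unfolding lform_def by (rule order_trans[OF norm_triangle_ineq])
        (auto intro!: add_mono sum_norm_le simp: norm_mult)
    also have "\<dots> \<le> (\<Sum>i=1..j. cmod (\<gamma> i) * psize m j) + cmod c * psize m j"
      using p1 psize_ge by (intro add_mono sum_mono mult_left_mono) (auto simp: mult_le_cancel_left1)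
    also have "\<dots> = ((\<Sum>i=1..j. cmod (\<gamma> i)) + cmod c) * psize m j"
      by (simp add: sum_distrib_right distrib_right)
    also have "\<dots> \<le> K * psize m j" using p1 by (intro mult_right_mono) (auto simp: K_def)
    finally show "cmod (lform \<gamma> c m j) \<le> K * psize m j" .
  qed (use \<kappa>0 in auto)
qed

lemma norm_powr_of_real: "x \<noteq> 0 \<Longrightarrow> cmod (x powr of_real e) = cmod x powr e"
  by (simp add: powr_def)

subsection \<open>Splitting off the last summation variable\<close>

text \<open>The dimension is \<open>Suc n\<close>. The entry \<open>b 0\<close>, which does not occur in the series, is a free base
  point that takes the place of \<open>b n\<close> when \<open>n = 0\<close>.\<close>
locale zeta_data =
  fixes n :: nat and \<gamma> b \<nu> :: "nat \<Rightarrow> complex"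
  assumes gam: "j \<in> {1..Suc n} \<Longrightarrow> Re (\<gamma> j) > 0"
    and bb: "j \<le> Suc n \<Longrightarrow> Re (b j) > - Re (\<gamma> 1)"
    and nu: "j \<in> {1..Suc n} \<Longrightarrow> cmod (\<nu> j) = 1"
begin

definition \<beta> where "\<beta> = b (Suc n) - b n"

abbreviation "admissible \<equiv> lerch_coeffs (\<nu> (Suc n)) (\<beta> / \<gamma> (Suc n))"
abbreviation "zcoeff \<equiv> expansion_coeff (\<nu> (Suc n)) (\<gamma> (Suc n))"
abbreviation "remainder \<equiv> expansion_error (\<nu> (Suc n)) (\<gamma> (Suc n)) \<beta>"

abbreviation "cleared_series s \<equiv>
  pole_factor (\<nu> (Suc n)) (s (Suc n)) * zeta_series (Suc n) (Suc n) \<gamma> b \<nu> s"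

text \<open>The twist of the last variable is included but its power is not, so raising
  \<open>m (Suc n)\<close> by \<open>k\<close> merely multiplies by
  \<open>\<nu> (Suc n) ^ k\<close>.\<close>

definition prefix_weight where
  "prefix_weight m s = (\<Prod>j=1..Suc n. \<nu> j ^ m j) * (\<Prod>j=1..n. lform \<gamma> (b j) m j powr (- s j))"

text \<open>The argument of the expansion. Its shift is \<open>b n\<close> and not
  \<open>b (Suc n)\<close>, so that for \<open>n \<ge> 1\<close> and \<open>m (Suc n) = 0\<close> it
  coincides with the last form in \<open>prefix_weight\<close> and the two powers merge into
  one.\<close>

definition base_form where "base_form m = lform \<gamma> (b n) m (Suc n)"

text \<open>Starting points of the last summation. For \<open>n = 0\<close> the last variable is
  also the first one, which begins at 1.\<close>

definition base_idx where "base_idx = {m \<in> idx (Suc n). m (Suc n) = (if n = 0 then 1 else 0)}"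

definition bump :: "(nat \<Rightarrow> nat) \<Rightarrow> nat \<Rightarrow> nat \<Rightarrow> nat" where
  "bump m k = m(Suc n := m (Suc n) + k)"

definition base_series where
  "base_series r s = (\<Sum>\<^sub>\<infinity>m\<in>base_idx. prefix_weight m s * base_form m powr (1 - s (Suc n) - of_nat r))"

definition error_term where
  "error_term q L s m = prefix_weight m s * remainder q L (s (Suc n)) (base_form m)"

definition error_series where
  "error_series q L s = (\<Sum>\<^sub>\<infinity>m\<in>idx (Suc n). error_term q L s m)"

lemma base_form_add_\<beta>: "base_form m + \<beta> = lform \<gamma> (b (Suc n)) m (Suc n)"
  by (simp add: base_form_def \<beta>_def lform_def)

lemma zeta_term_eq:
  "zeta_term (Suc n) (Suc n) \<gamma> b \<nu> s m =
     prefix_weight m s * (base_form m + \<beta>) powr (- s (Suc n))"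
  by (simp add: base_form_add_\<beta> zeta_term_def prefix_weight_def lform_def powr_minus divide_inverse
      prod_inversef[symmetric] o_def)

lemma bij_bump: "bij_betw (\<lambda>(m, k). bump m k) (base_idx \<times> UNIV) (idx (Suc n))"
proof (rule bij_betw_byWitness[where f' = "\<lambda>m. (m(Suc n := if n = 0 then 1 else 0),
          m (Suc n) - (if n = 0 then 1 else 0))"])
  show "\<forall>m\<in>idx (Suc n). (case (m(Suc n := if n = 0 then 1 else 0),
          m (Suc n) - (if n = 0 then 1 else 0)) of (m, k) \<Rightarrow> bump m k) = m"
    by (auto simp: bump_def idx_def fun_eq_iff)
qed (auto simp: bump_def base_idx_def idx_def fun_eq_iff split: if_splits)

lemma base_form_bump: "base_form (bump m k) = base_form m + \<gamma> (Suc n) * of_nat k"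
  by (simp add: base_form_def lform_def bump_def algebra_simps)

lemma prefix_weight_bump: "prefix_weight (bump m k) s = \<nu> (Suc n) ^ k * prefix_weight m s"
proof -
  have "lform \<gamma> (b j) (bump m k) j = lform \<gamma> (b j) m j" if "j \<in> {1..n}" for j
    unfolding lform_def bump_def using that by (intro arg_cong2[of _ _ _ _ "(+)"] sum.cong) auto
  then have 1: "(\<Prod>j=1..n. lform \<gamma> (b j) (bump m k) j powr (- s j)) =
      (\<Prod>j=1..n. lform \<gamma> (b j) m j powr (- s j))"
    by (intro prod.cong) auto
  have "(\<Prod>j=1..n. \<nu> j ^ bump m k j) = (\<Prod>j=1..n. \<nu> j ^ m j)"
    by (rule prod.cong) (auto simp: bump_def)
  then have "(\<Prod>j=1..Suc n. \<nu> j ^ bump m k j) = \<nu> (Suc n) ^ k * (\<Prod>j=1..Suc n. \<nu> j ^ m j)"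
    by (simp add: bump_def power_add)
  with 1 show ?thesis by (simp add: prefix_weight_def)
qed

lemma form_bounds:
  assumes j: "j \<in> {1..Suc n}" and i: "i \<le> Suc n"
  shows "\<exists>\<delta>>0. \<forall>m\<in>idx (Suc n). Re (lform \<gamma> (b i) m j) \<ge> \<delta>"
    and "\<exists>K\<ge>0. \<forall>m\<in>idx (Suc n). \<forall>e. cmod (lform \<gamma> (b i) m j powr e) \<le> exp (K * cmod e) * psize m j powr Re e"
proof -
  have g: "\<forall>i\<in>{1..j}. Re (\<gamma> i) > 0" using gam j by auto
  have j1: "j \<ge> 1" using j by simp
  obtain \<delta> K where K: "\<delta> > 0" "K \<ge> 1" "\<forall>m. m 1 \<ge> 1 \<longrightarrow> Re (lform \<gamma> (b i) m j) \<ge> \<delta> \<and>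
      cmod (lform \<gamma> (b i) m j) \<le> K * psize m j \<and> psize m j \<le> K * cmod (lform \<gamma> (b i) m j)"
    using lform_bounds[where \<gamma> = \<gamma> and c = "b i" and j = j, OF g bb[OF i] j1] by (elim exE conjE)
  show "\<exists>\<delta>>0. \<forall>m\<in>idx (Suc n). Re (lform \<gamma> (b i) m j) \<ge> \<delta>"
    using K(1,3) by (auto simp: idx_def)
  show "\<exists>K\<ge>0. \<forall>m\<in>idx (Suc n). \<forall>e. cmod (lform \<gamma> (b i) m j powr e) \<le> exp (K * cmod e) * psize m j powr Re e"
  proof (rule exI[of _ "ln K + pi"], intro conjI ballI allI)
    fix m e assume "m \<in> idx (Suc n)"
    then have m1: "m 1 \<ge> 1" by (simp add: idx_def)
    note * = mp[OF spec[OF K(3), of m] m1]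
    have "Re (lform \<gamma> (b i) m j) > 0" using * K(1) by linarith
    then have "lform \<gamma> (b i) m j \<noteq> 0" by (metis less_irrefl zero_complex.sel(1))
    then show "cmod (lform \<gamma> (b i) m j powr e) \<le> exp ((ln K + pi) * cmod e) * psize m j powr Re e"
      using * K(2) psize_ge_1[of m j, OF m1] j by (intro powr_norm_bound) auto
  qed (use K(2) in simp)
qed

lemma lform_nz:
  assumes "m \<in> idx (Suc n)" "j \<in> {1..n}"
  shows "lform \<gamma> (b j) m j \<noteq> 0"
proof -
  obtain \<delta> where "\<delta> > 0" "Re (lform \<gamma> (b j) m j) \<ge> \<delta>"
    using form_bounds(1)[of j j] assms by auto
  then show ?thesis by auto
qed

lemma base_form_Re:
  "\<exists>\<delta>>0. \<forall>m\<in>idx (Suc n). Re (base_form m) \<ge> \<delta> \<and> Re (base_form m + \<beta>) \<ge> \<delta>"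
proof -
  obtain \<delta>1 where \<delta>1: "\<delta>1 > 0" "\<forall>m\<in>idx (Suc n). Re (base_form m) \<ge> \<delta>1"
    using form_bounds(1)[of "Suc n" n] unfolding base_form_def by auto
  obtain \<delta>2 where \<delta>2: "\<delta>2 > 0" "\<forall>m\<in>idx (Suc n). Re (lform \<gamma> (b (Suc n)) m (Suc n)) \<ge> \<delta>2"
    using form_bounds(1)[of "Suc n" "Suc n"] by auto
  show ?thesis unfolding base_form_add_\<beta>
    by (rule exI[of _ "min \<delta>1 \<delta>2"]) (use \<delta>1 \<delta>2 in \<open>auto intro: min.coboundedI1 min.coboundedI2\<close>)
qed

section \<open>Local domination and holomorphy of the series\<close>

lemma prefix_weight_bound:
  "\<exists>B\<ge>0. \<forall>m\<in>idx (Suc n). \<forall>s. cmod (prefix_weight m s) \<le>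
     exp (B * (\<Sum>j=1..n. cmod (s j))) * (\<Prod>j=1..n. psize m j powr (- Re (s j)))"
proof -
  have "\<forall>j\<in>{1..n}. \<exists>K\<ge>0. \<forall>m\<in>idx (Suc n). \<forall>e.
      cmod (lform \<gamma> (b j) m j powr e) \<le> exp (K * cmod e) * psize m j powr Re e"
    by (intro ballI form_bounds(2)) auto
  from bchoice[OF this] obtain K where K: "\<forall>j\<in>{1..n}. K j \<ge> 0 \<and> (\<forall>m\<in>idx (Suc n). \<forall>e.
      cmod (lform \<gamma> (b j) m j powr e) \<le> exp (K j * cmod e) * psize m j powr Re e)"
    by (elim exE)
  define B where "B = (\<Sum>j=1..n. K j)"
  have Bj: "K j \<le> B" if "j \<in> {1..n}" for j
    unfolding B_def by (rule member_le_sum[OF that]) (use K in auto)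
  have B0: "B \<ge> 0" unfolding B_def by (rule sum_nonneg) (use K in auto)
  show ?thesis
  proof (intro exI[of _ B] conjI ballI allI B0)
    fix m s assume m: "m \<in> idx (Suc n)"
    have "cmod (prefix_weight m s) = (\<Prod>j=1..n. cmod (lform \<gamma> (b j) m j powr (- s j)))"
    proof -
      have "cmod (\<Prod>j=1..Suc n. \<nu> j ^ m j) = (\<Prod>j=1..Suc n. 1)"
        unfolding prod_norm[symmetric] by (rule prod.cong) (use nu in \<open>auto simp: norm_power\<close>)
      then show ?thesis by (simp add: prefix_weight_def norm_mult prod_norm)
    qed
    also have "\<dots> \<le> (\<Prod>j=1..n. exp (B * cmod (s j)) * psize m j powr (- Re (s j)))"
    proof (rule prod_mono, safe)
      fix j assume j: "j \<in> {1..n}"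
      have "cmod (lform \<gamma> (b j) m j powr (- s j)) \<le>
          exp (K j * cmod (- s j)) * psize m j powr Re (- s j)"
        using bspec[OF conjunct2[OF bspec[OF K j]] m] by blast
      also have "\<dots> \<le> exp (B * cmod (s j)) * psize m j powr (- Re (s j))"
        using Bj[OF j] by (intro mult_mono) (auto intro: mult_right_mono)
      finally show "cmod (lform \<gamma> (b j) m j powr (- s j)) \<le>
          exp (B * cmod (s j)) * psize m j powr (- Re (s j))" .
    qed auto
    also have "\<dots> = exp (B * (\<Sum>j=1..n. cmod (s j))) * (\<Prod>j=1..n. psize m j powr (- Re (s j)))"
      by (simp only: prod.distrib exp_sum[OF finite_atLeastAtMost] sum_distrib_left)
    finally show "cmod (prefix_weight m s) \<le>
      exp (B * (\<Sum>j=1..n. cmod (s j))) * (\<Prod>j=1..n. psize m j powr (- Re (s j)))" .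
  qed
qed

text \<open>On the polydisc of radius \<open>r\<close> the real part of every exponent is at least
  that at the corner \<open>u\<close>, which still lies in the open region. As all
  \<open>psize m j \<ge> 1\<close>, the series at the corner dominates, up to a factor bounded on
  the polydisc.\<close>

lemma dominated:
  assumes p: "p \<in> shifted_region (Suc n) L"
    and v: "\<And>R. \<exists>C\<ge>0. \<forall>m\<in>idx (Suc n). \<forall>s. cmod (s (Suc n)) \<le> R \<longrightarrow>
              cmod (v m s) \<le> C * psize m (Suc n) powr (- Re (s (Suc n)) - real L)"
  shows "\<exists>W M. openin (top_of_set (cn (Suc n))) W \<and> p \<in> W \<and> M summable_on idx (Suc n) \<and>
           (\<forall>m\<in>idx (Suc n). \<forall>s\<in>W. norm (prefix_weight m s * v m s) \<le> M m)"
proof -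
  obtain \<rho> where \<rho>: "\<rho> > 0" "polydisc (Suc n) p \<rho> \<subseteq> shifted_region (Suc n) L"
    using polydisc_within[OF openin_shifted_region p] by blast
  have pcn: "p \<in> cn (Suc n)" using p shifted_region_cn by blast
  define r where "r = \<rho> / 2"
  have r0: "r > 0" using \<rho> by (simp add: r_def)
  define u where "u = (\<lambda>j. if j \<in> {1..Suc n} then p j - of_real r else 0)"
  have "u \<in> polydisc (Suc n) p \<rho>"
    using \<rho>(1) by (auto simp: polydisc_def u_def cn_def r_def)
  then have u: "u \<in> shifted_region (Suc n) L" using \<rho>(2) by blast
  define \<sigma> where "\<sigma> = (\<lambda>j. Re (u j) + (if j = Suc n then real L else 0))"
  have tail: "(\<Sum>i=j..Suc n. \<sigma> i) > real (Suc n + 1 - j)" if j: "j \<in> {1..Suc n}" for j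
  proof -
    have "(\<Sum>i=j..Suc n. \<sigma> i) = Re (\<Sum>i=j..Suc n. u i) + real L"
      unfolding \<sigma>_def sum.distrib using j by (simp add: sum.delta)
    then show ?thesis using u j by (simp add: shifted_region_def)
  qed
  obtain B where B: "B \<ge> 0" "\<forall>m\<in>idx (Suc n). \<forall>s. cmod (prefix_weight m s) \<le>
     exp (B * (\<Sum>j=1..n. cmod (s j))) * (\<Prod>j=1..n. psize m j powr (- Re (s j)))"
    using prefix_weight_bound by (elim exE conjE)
  obtain C where C: "C \<ge> 0" "\<forall>m\<in>idx (Suc n). \<forall>s. cmod (s (Suc n)) \<le> cmod (p (Suc n)) + r \<longrightarrow>
      cmod (v m s) \<le> C * psize m (Suc n) powr (- Re (s (Suc n)) - real L)"
    using v[of "cmod (p (Suc n)) + r"] by (elim exE conjE)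
  define A where "A = exp (B * (\<Sum>j=1..n. cmod (p j) + r)) * C"
  show ?thesis
  proof (intro exI[of _ "polydisc (Suc n) p r"] exI[of _ "\<lambda>m. A * (\<Prod>j=1..Suc n. psize m j powr (- \<sigma> j))"]
      conjI ballI openin_polydisc polydisc_center pcn r0)
    show "(\<lambda>m. A * (\<Prod>j=1..Suc n. psize m j powr (- \<sigma> j))) summable_on idx (Suc n)"
      by (rule summable_on_cmult_right, rule psize_prod_summable) (use tail in auto)
    fix m s assume m: "m \<in> idx (Suc n)" and s: "s \<in> polydisc (Suc n) p r"
    have m1: "m 1 \<ge> 1" using m by (simp add: idx_def)
    have sj: "cmod (s j) \<le> cmod (p j) + r" "Re (p j) - r \<le> Re (s j)" if j: "j \<in> {1..Suc n}" for j
    proof -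
      have d: "cmod (s j - p j) < r" using s j by (auto simp: polydisc_def)
      then show "cmod (s j) \<le> cmod (p j) + r" using norm_triangle_ineq2[of "s j" "p j"] by simp
      show "Re (p j) - r \<le> Re (s j)" using d abs_Re_le_cmod[of "s j - p j"] by simp
    qed
    have "cmod (prefix_weight m s) \<le> exp (B * (\<Sum>j=1..n. cmod (s j))) * (\<Prod>j=1..n. psize m j powr (- Re (s j)))"
      by (rule spec[OF bspec[OF B(2) m]])
    also have "\<dots> \<le> exp (B * (\<Sum>j=1..n. cmod (p j) + r)) * (\<Prod>j=1..n. psize m j powr (- \<sigma> j))"
    proof (intro mult_mono prod_nonneg prod_mono conjI)
      show "exp (B * (\<Sum>j=1..n. cmod (s j))) \<le> exp (B * (\<Sum>j=1..n. cmod (p j) + r))"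
        unfolding exp_le_cancel_iff using sj(1) B(1) by (intro mult_left_mono sum_mono) auto
      fix j assume j: "j \<in> {1..n}"
      show "psize m j powr (- Re (s j)) \<le> psize m j powr (- \<sigma> j)"
        using psize_ge_1[of m j, OF m1] sj(2)[of j] j by (intro powr_mono) (auto simp: \<sigma>_def u_def)
    qed auto
    finally have 1: "cmod (prefix_weight m s) \<le> exp (B * (\<Sum>j=1..n. cmod (p j) + r)) *
        (\<Prod>j=1..n. psize m j powr (- \<sigma> j))" .
    have "cmod (v m s) \<le> C * psize m (Suc n) powr (- Re (s (Suc n)) - real L)"
      using spec[OF bspec[OF C(2) m], of s] sj(1)[of "Suc n"] by simp
    also have "\<dots> \<le> C * psize m (Suc n) powr (- \<sigma> (Suc n))"
      using C(1) psize_ge_1[of m "Suc n", OF m1] sj(2)[of "Suc n"]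
      by (intro mult_left_mono powr_mono) (auto simp: \<sigma>_def u_def)
    finally have 2: "cmod (v m s) \<le> C * psize m (Suc n) powr (- \<sigma> (Suc n))" .
    have "norm (prefix_weight m s * v m s) \<le> (exp (B * (\<Sum>j=1..n. cmod (p j) + r)) *
        (\<Prod>j=1..n. psize m j powr (- \<sigma> j))) * (C * psize m (Suc n) powr (- \<sigma> (Suc n)))"
      unfolding norm_mult by (intro mult_mono 1 2) (auto intro!: mult_nonneg_nonneg prod_nonneg)
    then show "norm (prefix_weight m s * v m s) \<le> A * (\<Prod>j=1..Suc n. psize m j powr (- \<sigma> j))"
      by (simp add: A_def algebra_simps)
  qed
qed

lemma zeta_term_summable:
  assumes s: "s \<in> conv_region (Suc n)"
  shows "zeta_term (Suc n) (Suc n) \<gamma> b \<nu> s summable_on idx (Suc n)"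
proof -
  obtain K where K: "K \<ge> 0" "\<forall>m\<in>idx (Suc n). \<forall>e.
      cmod ((base_form m + \<beta>) powr e) \<le> exp (K * cmod e) * psize m (Suc n) powr Re e"
    using form_bounds(2)[of "Suc n" "Suc n"] unfolding base_form_add_\<beta> by auto
  have v: "\<exists>C\<ge>0. \<forall>m\<in>idx (Suc n). \<forall>s. cmod (s (Suc n)) \<le> R \<longrightarrow>
      cmod ((base_form m + \<beta>) powr (- s (Suc n))) \<le> C * psize m (Suc n) powr (- Re (s (Suc n)) - real 0)" for R
  proof (intro exI[of _ "exp (K * R)"] conjI ballI allI impI)
    fix m and s :: "nat \<Rightarrow> complex" assume m: "m \<in> idx (Suc n)" and s: "cmod (s (Suc n)) \<le> R"
    have "cmod ((base_form m + \<beta>) powr (- s (Suc n))) \<le>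
        exp (K * cmod (- s (Suc n))) * psize m (Suc n) powr Re (- s (Suc n))"
      using bspec[OF K(2) m] by blast
    also have "\<dots> \<le> exp (K * R) * psize m (Suc n) powr (- Re (s (Suc n)) - real 0)"
      using s K(1) by (intro mult_mono) (auto intro!: mult_left_mono)
    finally show "cmod ((base_form m + \<beta>) powr (- s (Suc n))) \<le> \<dots>" .
  qed auto
  have "s \<in> shifted_region (Suc n) 0" using s by (simp add: shifted_region_0)
  from dominated[OF this v] obtain W M where W: "s \<in> W" "M summable_on idx (Suc n)"
    "\<forall>m\<in>idx (Suc n). \<forall>s\<in>W. norm (prefix_weight m s * (base_form m + \<beta>) powr (- s (Suc n))) \<le> M m"
    by (elim exE conjE)
  have "(\<lambda>m. norm (zeta_term (Suc n) (Suc n) \<gamma> b \<nu> s m)) summable_on idx (Suc n)"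
  proof (rule summable_on_comparison_test[OF W(2)])
    fix m assume "m \<in> idx (Suc n)"
    then show "norm (zeta_term (Suc n) (Suc n) \<gamma> b \<nu> s m) \<le> M m"
      unfolding zeta_term_eq using W(1,3) by blast
  qed simp
  then show ?thesis by (rule abs_summable_summable)
qed

lemma error_dominated:
  assumes q: "admissible q" and L: "L \<ge> 1"
    and p: "p \<in> shifted_region (Suc n) L"
  shows "\<exists>W M. openin (top_of_set (cn (Suc n))) W \<and> p \<in> W \<and> M summable_on idx (Suc n) \<and>
           (\<forall>m\<in>idx (Suc n). \<forall>s\<in>W. norm (error_term q L s m) \<le> M m)"
  unfolding error_term_def
proof (rule dominated[OF p])
  fix R
  obtain K where K: "K \<ge> 0" "\<forall>m\<in>idx (Suc n). \<forall>e.
      cmod (base_form m powr e) \<le> exp (K * cmod e) * psize m (Suc n) powr Re e"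
    using form_bounds(2)[of "Suc n" n] unfolding base_form_def by auto
  obtain \<delta> where \<delta>: "\<delta> > 0" "\<forall>m\<in>idx (Suc n). Re (base_form m) \<ge> \<delta> \<and> Re (base_form m + \<beta>) \<ge> \<delta>" using base_form_Re by (elim exE conjE)
  have "Re (\<gamma> (Suc n)) > 0" by (rule gam) simp
  from expansion_error_bound[OF this q \<delta>(1) L, of R]
  obtain C where C: "C \<ge> 0" "\<forall>s X. cmod s \<le> R \<longrightarrow> Re X \<ge> \<delta> \<longrightarrow> Re (X + \<beta>) \<ge> \<delta> \<longrightarrow>
     cmod (remainder q L s X) \<le> C * cmod X powr (- Re s - real L)"
    by (elim exE conjE)
  show "\<exists>C\<ge>0. \<forall>m\<in>idx (Suc n). \<forall>s. cmod (s (Suc n)) \<le> R \<longrightarrow>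
      cmod (remainder q L (s (Suc n)) (base_form m)) \<le>
      C * psize m (Suc n) powr (- Re (s (Suc n)) - real L)"
  proof (intro exI[of _ "C * exp (K * (R + real L))"] conjI ballI allI impI)
    fix m and s :: "nat \<Rightarrow> complex" assume m: "m \<in> idx (Suc n)" and s: "cmod (s (Suc n)) \<le> R"
    define e where "e = - Re (s (Suc n)) - real L"
    have e: "\<bar>e\<bar> \<le> R + real L" unfolding e_def using s abs_Re_le_cmod[of "s (Suc n)"] by linarith
    have "cmod (remainder q L (s (Suc n)) (base_form m)) \<le>
        C * cmod (base_form m) powr e"
      unfolding e_def using C(2) s bspec[OF \<delta>(2) m] by simp
    also have "C * cmod (base_form m) powr e \<le> C * (exp (K * \<bar>e\<bar>) * psize m (Suc n) powr e)"
    proof (rule mult_left_mono[OF _ C(1)])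
      have "base_form m \<noteq> 0" using bspec[OF \<delta>(2) m] \<delta>(1) by auto
      then show "cmod (base_form m) powr e \<le> exp (K * \<bar>e\<bar>) * psize m (Suc n) powr e"
        using spec[OF bspec[OF K(2) m], of "of_real e"] norm_powr_of_real[of "base_form m" e] by simp
    qed
    also have "\<dots> \<le> C * (exp (K * (R + real L)) * psize m (Suc n) powr e)"
      using C(1) e K(1) by (intro mult_left_mono mult_right_mono) (auto intro!: mult_left_mono)
    finally show "cmod (remainder q L (s (Suc n)) (base_form m)) \<le>
      C * exp (K * (R + real L)) * psize m (Suc n) powr (- Re (s (Suc n)) - real L)"
      by (simp add: e_def)
  qed (use C in auto)
qed

lemma error_term_summable:
  assumes "admissible q" "L \<ge> 1" "s \<in> shifted_region (Suc n) L"
  shows "error_term q L s summable_on idx (Suc n)"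
proof -
  obtain W M where W: "s \<in> W" "M summable_on idx (Suc n)"
    "\<forall>m\<in>idx (Suc n). \<forall>s\<in>W. norm (error_term q L s m) \<le> M m"
    using error_dominated[OF assms] by (elim exE conjE)
  have "(\<lambda>m. norm (error_term q L s m)) summable_on idx (Suc n)"
  proof (rule summable_on_comparison_test[OF W(2)])
    fix m assume "m \<in> idx (Suc n)"
    then show "norm (error_term q L s m) \<le> M m" using W(1,3) by blast
  qed simp
  then show ?thesis by (rule abs_summable_summable)
qed

lemma holo_n_error_series:
  assumes q: "admissible q" and L: "L \<ge> 1"
  shows "holo_n (Suc n) (error_series q L) (shifted_region (Suc n) L)"
proof -
  have "holo_n (Suc n) (\<lambda>s. \<Sum>\<^sub>\<infinity>m\<in>idx (Suc n). error_term q L s m) (shifted_region (Suc n) L)"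
  proof (rule holo_n_infsum[OF openin_shifted_region _ error_dominated[OF q L]])
    fix m assume m: "m \<in> idx (Suc n)"
    obtain \<delta> where \<delta>: "\<delta> > 0" "\<forall>m\<in>idx (Suc n). Re (base_form m) \<ge> \<delta> \<and> Re (base_form m + \<beta>) \<ge> \<delta>"
      using base_form_Re by (elim exE conjE)
    from \<delta>(1) bspec[OF \<delta>(2) m] have \<delta>: "\<delta> > 0" "Re (base_form m) \<ge> \<delta>" "Re (base_form m + \<beta>) \<ge> \<delta>" by auto
    have g: "Re (\<gamma> (Suc n)) > 0" by (rule gam) simp
    have "Re (base_form m + \<gamma> (Suc n)) > 0" using \<delta> g by simp
    moreover have "z \<noteq> 0" if "Re z > 0" for z :: complex using that by auto
    ultimately have "base_form m \<noteq> 0" "base_form m + \<beta> \<noteq> 0" "base_form m + \<gamma> (Suc n) \<noteq> 0"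
      using \<delta> by (meson order_less_le_trans)+
    then have h: "(\<lambda>z. remainder q L z (base_form m)) holomorphic_on UNIV"
      by (rule holomorphic_expansion_error)
    have "(\<lambda>z. lform \<gamma> (b j) m j powr (- z)) holomorphic_on UNIV" if "j \<in> {1..n}" for j
      by (intro holomorphic_powr_exponent holomorphic_intros lform_nz[OF m that])
    then show "holo_n (Suc n) (\<lambda>s. error_term q L s m) (shifted_region (Suc n) L)"
      unfolding error_term_def prefix_weight_def
      by (intro holo_n_mult holo_n_prod holo_n_const holo_n_coord_comp[OF h]
          holo_n_coord_comp[where g = "\<lambda>z. lform \<gamma> (b _) m _ powr (- z)"])
  qed
  then show ?thesis by (simp add: error_series_def[abs_def])
qed

text \<open>\<open>bump\<close> fibres the index set over the starting points, and on each fibre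
  telescoping leaves the expansion at \<open>base_form\<close>. Summability over the whole index set
  justifies the iterated summation.\<close>

lemma splitting_identity:
  assumes q: "admissible q" and L: "L \<ge> 1"
    and s: "s \<in> conv_region (Suc n)"
    and base: "\<And>r. (\<lambda>m. prefix_weight m s * base_form m powr (1 - s (Suc n) - of_nat r)) summable_on base_idx"
  shows "cleared_series s =
     (\<Sum>r\<le>L. zcoeff q r (s (Suc n)) * base_series r s)
       + error_series q L s"
proof -
  define p where "p = pole_factor (\<nu> (Suc n)) (s (Suc n))"
  define z where "z = s (Suc n)"
  define f where "f = zeta_term (Suc n) (Suc n) \<gamma> b \<nu> s"
  define g where "g = error_term q L s"
  define P where "P = (\<lambda>m. expansion (\<nu> (Suc n)) (\<gamma> (Suc n)) q L z (base_form m))"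
  have sL: "s \<in> shifted_region (Suc n) L" using s conv_region_subset by blast
  have fs: "f summable_on idx (Suc n)" unfolding f_def by (rule zeta_term_summable[OF s])
  have gs: "g summable_on idx (Suc n)" unfolding g_def by (rule error_term_summable[OF q L sL])
  have f2: "(\<lambda>(m, k). f (bump m k)) summable_on base_idx \<times> UNIV"
    using fs summable_on_reindex_bij_betw[OF bij_bump, of f] by (simp add: case_prod_unfold)
  have g2: "(\<lambda>(m, k). g (bump m k)) summable_on base_idx \<times> UNIV"
    using gs summable_on_reindex_bij_betw[OF bij_bump, of g] by (simp add: case_prod_unfold)
  have fi: "infsum f (idx (Suc n)) = (\<Sum>\<^sub>\<infinity>m\<in>base_idx. \<Sum>\<^sub>\<infinity>k. f (bump m k))"
    using infsum_Sigma'_banach[OF f2] infsum_reindex_bij_betw[OF bij_bump, of f]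
    by (simp add: case_prod_unfold)
  have gi: "infsum g (idx (Suc n)) = (\<Sum>\<^sub>\<infinity>m\<in>base_idx. \<Sum>\<^sub>\<infinity>k. g (bump m k))"
    using infsum_Sigma'_banach[OF g2] infsum_reindex_bij_betw[OF bij_bump, of g]
    by (simp add: case_prod_unfold)
  have Rez: "Re z > 1" using s unfolding conv_region_def z_def by (auto dest: bspec[of _ _ "Suc n"])
  have g0: "Re (\<gamma> (Suc n)) > 0" by (rule gam) simp
  have inner: "p * (\<Sum>\<^sub>\<infinity>k. f (bump m k)) = prefix_weight m s * P m + (\<Sum>\<^sub>\<infinity>k. g (bump m k))"
    if m: "m \<in> base_idx" for m
  proof -
    have mi: "m \<in> idx (Suc n)" using m by (simp add: base_idx_def)
    obtain \<delta> where \<delta>: "\<delta> > 0" "\<forall>m\<in>idx (Suc n). Re (base_form m) \<ge> \<delta> \<and> Re (base_form m + \<beta>) \<ge> \<delta>"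
      using base_form_Re by (elim exE conjE)
    from \<delta>(1) bspec[OF \<delta>(2) mi] have \<delta>: "\<delta> > 0" "Re (base_form m) \<ge> \<delta>" by auto
    \<comment> \<open>A nonzero weight can be divided out, so summability on the fibre passes to the
      one-variable series.\<close>
    have W: "prefix_weight m s \<noteq> 0"
    proof -
      have "\<nu> j \<noteq> 0" if "j \<in> {1..Suc n}" for j using nu[OF that] by auto
      then show ?thesis unfolding prefix_weight_def using lform_nz[OF mi] by auto
    qed
    have fk: "f (bump m k) = prefix_weight m s *
        (\<nu> (Suc n) ^ k * (base_form m + \<gamma> (Suc n) * of_nat k + \<beta>) powr (- z))" for k
      unfolding f_def zeta_term_eq prefix_weight_bump base_form_bump z_def by simp
    have gk: "g (bump m k) = prefix_weight m s * (\<nu> (Suc n) ^ k *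
        remainder q L z (base_form m + \<gamma> (Suc n) * of_nat k))" for k
      unfolding g_def error_term_def prefix_weight_bump base_form_bump z_def by simp
    define S where "S = (\<Sum>\<^sub>\<infinity>k. \<nu> (Suc n) ^ k * (base_form m + \<gamma> (Suc n) * of_nat k + \<beta>) powr (- z))"
    define H where "H = (\<Sum>\<^sub>\<infinity>k. \<nu> (Suc n) ^ k *
        remainder q L z (base_form m + \<gamma> (Suc n) * of_nat k))"
    have "(\<lambda>k. f (bump m k)) summable_on UNIV" by (rule summable_on_SigmaD1[OF f2 m])
    then have "(\<lambda>k. \<nu> (Suc n) ^ k * (base_form m + \<gamma> (Suc n) * of_nat k + \<beta>) powr (- z)) summable_on UNIV"
      unfolding fk using W by (subst (asm) summable_on_cmult_right') auto
    then have S: "(\<lambda>k. \<nu> (Suc n) ^ k * (base_form m + \<gamma> (Suc n) * of_nat k + \<beta>) powr (- z)) sums S"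
      unfolding S_def by (intro has_sum_imp_sums has_sum_infsum)
    have "(\<lambda>k. g (bump m k)) summable_on UNIV" by (rule summable_on_SigmaD1[OF g2 m])
    then have "(\<lambda>k. \<nu> (Suc n) ^ k * remainder q L z
        (base_form m + \<gamma> (Suc n) * of_nat k)) summable_on UNIV"
      unfolding gk using W by (subst (asm) summable_on_cmult_right') auto
    then have H: "(\<lambda>k. \<nu> (Suc n) ^ k * remainder q L z
        (base_form m + \<gamma> (Suc n) * of_nat k)) sums H"
      unfolding H_def by (intro has_sum_imp_sums has_sum_infsum)
    have "p * S = P m + H"
      unfolding p_def P_def z_def[symmetric]
      by (rule powr_sum_telescope[OF g0 _ Rez _ S H]) (use nu[of "Suc n"] \<delta> in auto)
    moreover have "(\<Sum>\<^sub>\<infinity>k. f (bump m k)) = prefix_weight m s * S"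
      unfolding fk S_def by (rule infsum_cmult_right')
    moreover have "(\<Sum>\<^sub>\<infinity>k. g (bump m k)) = prefix_weight m s * H"
      unfolding gk H_def by (rule infsum_cmult_right')
    ultimately show ?thesis by (simp only: mult.left_commute[of p] distrib_left)
  qed
  define d where "d = (\<lambda>r. zcoeff q r z)"
  have WP: "prefix_weight m s * P m =
      (\<Sum>r\<le>L. d r * (prefix_weight m s * base_form m powr (1 - z - of_nat r)))" for m
    by (simp add: P_def expansion_def d_def sum_distrib_left algebra_simps)
  have "((\<lambda>m. prefix_weight m s * P m) has_sum (\<Sum>r\<le>L. d r * base_series r s)) base_idx"
    unfolding WP base_series_def z_def[symmetric]
    by (intro has_sum_sum has_sum_cmult_right has_sum_infsum base[folded z_def])
  then have Ps: "(\<lambda>m. prefix_weight m s * P m) summable_on base_idx"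
    and Pi: "(\<Sum>\<^sub>\<infinity>m\<in>base_idx. prefix_weight m s * P m) = (\<Sum>r\<le>L. d r * base_series r s)"
    by (auto simp: has_sum_iff)
  have "p * infsum f (idx (Suc n)) = (\<Sum>\<^sub>\<infinity>m\<in>base_idx. p * (\<Sum>\<^sub>\<infinity>k. f (bump m k)))"
    unfolding fi by (rule infsum_cmult_right'[symmetric])
  also have "\<dots> = (\<Sum>\<^sub>\<infinity>m\<in>base_idx. prefix_weight m s * P m + (\<Sum>\<^sub>\<infinity>k. g (bump m k)))"
    by (rule infsum_cong) (rule inner)
  also have "\<dots> = (\<Sum>r\<le>L. d r * base_series r s) + infsum g (idx (Suc n))"
    unfolding gi Pi[symmetric] by (rule infsum_add[OF Ps summable_on_Sigma_banach[OF g2]])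
  finally show ?thesis
    by (simp add: p_def f_def g_def d_def z_def zeta_series_def error_series_def)
qed

end

subsection \<open>Continuation by one variable\<close>

definition shift :: "nat \<Rightarrow> complex \<Rightarrow> (nat \<Rightarrow> complex) \<Rightarrow> nat \<Rightarrow> complex" where
  "shift n c s = (\<lambda>j. if j = n then s n + s (Suc n) + c else if j \<in> {1..n} then s j else 0)"

lemma shift_cn: "n \<ge> 1 \<Longrightarrow> shift n c s \<in> cn n"
  by (auto simp: shift_def cn_def)

lemma holo_n_shift:
  assumes n: "n \<ge> 1" and G: "holo_n n G (cn n)"
  shows "holo_n (Suc n) (\<lambda>s. G (shift n c s)) U"
proof (rule holo_nI)
  have "continuous_on U (shift n c)"
  proof (rule continuous_on_coordinatewise_then_product)
    fix i
    consider "i = n" | "i \<noteq> n" "i \<in> {1..n}" | "i \<noteq> n" "i \<notin> {1..n}" by blast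
    then show "continuous_on U (\<lambda>s. shift n c s i)"
      by cases (auto simp: shift_def intro!: continuous_intros)
  qed
  then show "continuous_on U (\<lambda>s. G (shift n c s))"
    by (rule continuous_on_compose2[OF holo_nD(1)[OF G]]) (use shift_cn[OF n] in auto)
next
  fix s j assume j: "j \<in> {1..Suc n}"
  have fd: "(\<lambda>z. G ((shift n c s)(i := z))) field_differentiable (at (shift n c s i))" if "i \<in> {1..n}" for i
    by (rule holo_nD(2)[OF G shift_cn[OF n] that])
  have nn: "n \<in> {1..n}" using n by simp
  consider "j = n" | "j = Suc n" | "j \<noteq> n" "j \<in> {1..n}" using j by fastforce
  then show "(\<lambda>z. G (shift n c (s(j := z)))) field_differentiable (at (s j))"
  proof cases
    case 1
    have eq: "shift n c (s(j := z)) = (shift n c s)(n := z + (s (Suc n) + c))" for z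
      using 1 by (auto simp: shift_def fun_eq_iff)
    have "(\<lambda>z. z + (s (Suc n) + c)) field_differentiable (at (s j))"
      by (intro derivative_intros field_differentiable_add)
    moreover have "(\<lambda>z. G ((shift n c s)(n := z))) field_differentiable (at (s j + (s (Suc n) + c)))"
      using fd[OF nn] 1 by (simp add: shift_def add.assoc)
    ultimately have "((\<lambda>z. G ((shift n c s)(n := z))) \<circ> (\<lambda>z. z + (s (Suc n) + c))) field_differentiable (at (s j))"
      by (rule field_differentiable_compose)
    then show ?thesis unfolding eq by (simp only: o_def)
  next
    case 2
    have eq: "shift n c (s(j := z)) = (shift n c s)(n := z + (s n + c))" for z
      using 2 by (auto simp: shift_def fun_eq_iff)
    have "(\<lambda>z. z + (s n + c)) field_differentiable (at (s j))"
      by (intro derivative_intros field_differentiable_add)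
    moreover have "(\<lambda>z. G ((shift n c s)(n := z))) field_differentiable (at (s j + (s n + c)))"
      using fd[OF nn] 2 by (simp add: shift_def algebra_simps)
    ultimately have "((\<lambda>z. G ((shift n c s)(n := z))) \<circ> (\<lambda>z. z + (s n + c))) field_differentiable (at (s j))"
      by (rule field_differentiable_compose)
    then show ?thesis unfolding eq by (simp only: o_def)
  next
    case 3
    have eq: "shift n c (s(j := z)) = (shift n c s)(j := z)" for z
      using 3 by (auto simp: shift_def fun_eq_iff)
    have "shift n c s j = s j" using 3 by (simp add: shift_def)
    then show ?thesis unfolding eq using fd[OF 3(2)] by (simp only:)
  qed
qed

text \<open>Each tail changes by exactly \<open>c\<close>. In dimension \<open>Suc n\<close> it had
  to exceed a bound larger by 1, which is the loss that \<open>Re c \<ge> -1\<close>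
  permits.\<close>

lemma shift_conv_region:
  assumes n: "n \<ge> 1" and s: "s \<in> conv_region (Suc n)" and c: "Re c \<ge> -1"
  shows "shift n c s \<in> conv_region n"
proof -
  have "real (n + 1 - j) < Re (\<Sum>i=j..n. shift n c s i)" if j: "j \<in> {1..n}" for j
  proof -
    have "(\<Sum>i=j..n. shift n c s i) = shift n c s n + (\<Sum>i\<in>{j..n} - {n}. shift n c s i)"
      using j by (subst sum.remove[of _ n]) auto
    also have "(\<Sum>i\<in>{j..n} - {n}. shift n c s i) = (\<Sum>i\<in>{j..n} - {n}. s i)"
      using j by (intro sum.cong) (auto simp: shift_def)
    also have "\<dots> = (\<Sum>i=j..n. s i) - s n" using j by (subst (2) sum.remove[of _ n]) auto
    finally have "(\<Sum>i=j..n. shift n c s i) = (\<Sum>i=j..Suc n. s i) + c"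
      using j by (simp add: shift_def)
    moreover have "real (Suc n + 1 - j) < Re (\<Sum>i=j..Suc n. s i)"
      using s j by (auto simp: conv_region_def)
    ultimately show ?thesis using c j by (simp add: of_nat_diff)
  qed
  then show ?thesis using shift_cn[OF n] by (simp add: conv_region_def)
qed

context zeta_data
begin

text \<open>\<open>A r\<close> and \<open>k r\<close> are numerator and denominator of the r-th base
  series: \<open>k r\<close> is 1 when the lower function is entire, and the linear form of the r-th
  polar hyperplane when there are two untwisted variables. The last clause, with all denominators
  cleared, serves meromorphy at the poles.\<close>

lemma continuation:
  assumes q: "admissible q"
    and A: "\<And>r. holo_n (Suc n) (A r) (cn (Suc n))" and k: "\<And>r. holo_n (Suc n) (k r) (cn (Suc n))"
    and E: "openin (top_of_set (cn (Suc n))) E" "conv_region (Suc n) \<subseteq> E"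
      "\<And>r s. s \<in> E \<Longrightarrow> k r s \<noteq> 0"
    and base: "\<And>r s. s \<in> conv_region (Suc n) \<Longrightarrow> base_series r s * k r s = A r s"
    and summ: "\<And>r s. s \<in> conv_region (Suc n) \<Longrightarrow>
      (\<lambda>m. prefix_weight m s * base_form m powr (1 - s (Suc n) - of_nat r)) summable_on base_idx"
  obtains F where "holo_n (Suc n) F E"
    "\<And>s. s \<in> conv_region (Suc n) \<Longrightarrow>
       F s = cleared_series s"
    "\<And>L s. L \<ge> 1 \<Longrightarrow> s \<in> shifted_region (Suc n) L \<Longrightarrow> s \<in> E \<Longrightarrow>
       F s = (\<Sum>r\<le>L. zcoeff q r (s (Suc n)) * (A r s / k r s))
         + error_series q L s"
    "\<And>L. L \<ge> 1 \<Longrightarrow> \<exists>g. holo_n (Suc n) g (shifted_region (Suc n) L) \<and>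
       (\<forall>s \<in> shifted_region (Suc n) L \<inter> E. F s * (\<Prod>r\<le>L. k r s) = g s)"
proof -
  define d where "d = (\<lambda>r s. zcoeff q r (s (Suc n)))"
  have d: "holo_n (Suc n) (d r) U" for r U
    unfolding d_def by (rule holo_n_coord_comp[OF holomorphic_expansion_coeff])
  define h where "h = (\<lambda>L s. \<Prod>r\<le>L. k r s)"
  define g where "g = (\<lambda>L s. (\<Sum>r\<le>L. d r s * (A r s * (\<Prod>r'\<in>{..L} - {r}. k r' s))) + h L s * error_series q L s)"
  have hh: "holo_n (Suc n) (h L) (cn (Suc n))" for L
    unfolding h_def by (intro holo_n_prod k)
  have gh: "holo_n (Suc n) (g L) (shifted_region (Suc n) L)" if "L \<ge> 1" for L
  proof -
    note sub = holo_n_subset[OF _ shifted_region_cn]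
    show ?thesis unfolding g_def
      by (intro holo_n_add holo_n_sum holo_n_mult d holo_n_prod sub[OF A] sub[OF k] sub[OF hh]
          holo_n_error_series[OF q that])
  qed
  have split: "h L s * (\<Sum>r\<le>L. d r s * (A r s / k r s)) = (\<Sum>r\<le>L. d r s * (A r s * (\<Prod>r'\<in>{..L} - {r}. k r' s)))"
    if s: "s \<in> E" for L s
    unfolding sum_distrib_left
  proof (rule sum.cong[OF refl])
    fix r assume r: "r \<in> {..L}"
    have "h L s = k r s * (\<Prod>r'\<in>{..L} - {r}. k r' s)"
      unfolding h_def using r by (intro prod.remove) auto
    then show "h L s * (d r s * (A r s / k r s)) = d r s * (A r s * (\<Prod>r'\<in>{..L} - {r}. k r' s))"
      using E(3)[OF s, of r] by (simp add: field_simps)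
  qed
  define f where "f = (\<lambda>s. cleared_series s)"
  have feq: "f s * h L s = g L s" if s: "s \<in> conv_region (Suc n)" and L: "L \<ge> 1" for L s
  proof -
    have sE: "s \<in> E" using s E(2) by blast
    have "base_series r s = A r s / k r s" for r
      using base[OF s, of r] E(3)[OF sE, of r] by (simp add: field_simps)
    then have "f s = (\<Sum>r\<le>L. d r s * (A r s / k r s)) + error_series q L s"
      unfolding f_def d_def using splitting_identity[OF q L s summ[OF s]] by simp
    then show ?thesis using split[OF sE, of L] by (simp add: g_def algebra_simps)
  qed
  obtain F where F: "holo_n (Suc n) F E" "\<And>s. s \<in> conv_region (Suc n) \<Longrightarrow> F s = f s"
    "\<And>L s. s \<in> shifted_region (Suc n) (Suc L) \<Longrightarrow> s \<in> E \<Longrightarrow> F s * h (Suc L) s = g (Suc L) s"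
  \<comment> \<open>The truncation order is taken as \<open>Suc L\<close> because the error estimate
    needs a positive order.\<close>
  proof (rule holo_n_glue[where n = "Suc n" and C = "conv_region (Suc n)"
        and D = "\<lambda>L. shifted_region (Suc n) (Suc L)" and g = "\<lambda>L. g (Suc L)"
        and h = "\<lambda>L. h (Suc L)" and E = E and f = f])
    show "\<exists>L. s \<in> shifted_region (Suc n) (Suc L)" if "s \<in> cn (Suc n)" for s
      using shifted_region_exhausts[OF that] shifted_region_mono[OF le_SucI[OF order_refl]] by blast
    show "h (Suc L) s \<noteq> 0" if "s \<in> E" for L s
      unfolding h_def using E(3)[OF that] by simp
  qed (use openin_conv_region conv_region_nonempty openin_shifted_region connected_shifted_region
        conv_region_subset shifted_region_mono gh hh E feq in auto)
  show ?thesis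
  proof (rule that[of F])
    show "holo_n (Suc n) F E" by (rule F(1))
    show "F s = cleared_series s"
      if "s \<in> conv_region (Suc n)" for s using F(2)[OF that] by (simp add: f_def)
    fix L :: nat assume "L \<ge> 1"
    then obtain M where M: "L = Suc M" by (cases L) auto
    have eq: "F s * h L s = g L s" if "s \<in> shifted_region (Suc n) L" "s \<in> E" for s
      using F(3)[of s M] that M by simp
    then show "\<exists>g. holo_n (Suc n) g (shifted_region (Suc n) L) \<and>
       (\<forall>s \<in> shifted_region (Suc n) L \<inter> E. F s * (\<Prod>r\<le>L. k r s) = g s)"
      using gh[OF \<open>L \<ge> 1\<close>] unfolding h_def by (intro exI[of _ "g L"]) blast
    fix s assume s: "s \<in> shifted_region (Suc n) L" "s \<in> E"
    have h0: "h L s \<noteq> 0" unfolding h_def using E(3)[OF s(2)] by simp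
    have "h L s * F s = h L s * ((\<Sum>r\<le>L. d r s * (A r s / k r s)) + error_series q L s)"
      unfolding distrib_left split[OF s(2)] using eq[OF s] by (simp add: g_def mult.commute)
    then show "F s = (\<Sum>r\<le>L. zcoeff q r (s (Suc n)) * (A r s / k r s))
         + error_series q L s"
      using h0 by (simp add: d_def)
  qed
qed

lemma error_series_eq_0:
  assumes q: "admissible q"
    and s: "(\<exists>N<L. s (Suc n) = - of_nat N) \<or> (\<nu> (Suc n) = 1 \<and> s (Suc n) = 1)"
  shows "error_series q L s = 0"
proof -
  have g: "Re (\<gamma> (Suc n)) > 0" by (rule gam) simp
  obtain \<delta> where \<delta>: "\<delta> > 0" "\<forall>m\<in>idx (Suc n). Re (base_form m) \<ge> \<delta> \<and> Re (base_form m + \<beta>) \<ge> \<delta>"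
    using base_form_Re by (elim exE conjE)
  have "error_term q L s m = 0" if m: "m \<in> idx (Suc n)" for m
  proof -
    have Y: "Re (base_form m) > 0" "Re (base_form m + \<beta>) > 0"
      using bspec[OF \<delta>(2) m] \<delta>(1) by linarith+
    have "remainder q L (s (Suc n)) (base_form m) = 0"
      using s
    proof
      assume "\<exists>N<L. s (Suc n) = - of_nat N"
      then obtain N where "N < L" "s (Suc n) = - of_nat N" by blast
      then show ?thesis using expansion_error_neg_nat[OF g q Y, of N L] by simp
    next
      assume "\<nu> (Suc n) = 1 \<and> s (Suc n) = 1"
      then show ?thesis using expansion_error_1[OF g Y(1), of \<beta> q L] q by simp
    qed
    then show ?thesis by (simp add: error_term_def)
  qed
  then show ?thesis unfolding error_series_def by (simp add: infsum_0)
qed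

lemma lower: "n = Suc k \<Longrightarrow> zeta_data k \<gamma> b \<nu>"
  by unfold_locales (use gam bb nu in auto)

lemma base_idx_eq: "n \<ge> 1 \<Longrightarrow> base_idx = idx n"
  unfolding base_idx_def idx_def by (auto simp: le_Suc_eq)

lemma base_term_eq:
  assumes n: "n \<ge> 1" and m: "m \<in> base_idx"
  shows "prefix_weight m s * base_form m powr (1 - s (Suc n) - of_nat r) =
    zeta_term n n \<gamma> b \<nu> (shift n (of_nat r - 1) s) m"
proof -
  obtain k where k: "n = Suc k" using n by (cases n) auto
  have m0: "m (Suc n) = 0" and mi: "m \<in> idx (Suc n)" using m n by (auto simp: base_idx_def)
  have Y: "base_form m = lform \<gamma> (b n) m n" by (simp add: base_form_def lform_def m0)
  have nz: "lform \<gamma> (b n) m n \<noteq> 0" using lform_nz[OF mi, of n] n by simp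
  define X where "X = (\<lambda>j. lform \<gamma> (b j) m j)"
  have "(\<Prod>j=1..n. X j powr (- shift n (of_nat r - 1) s j)) =
      (\<Prod>j=1..k. X j powr (- s j)) * X n powr (- (s n + s (Suc n) + (of_nat r - 1)))"
  proof -
    have "(\<Prod>j=1..k. X j powr (- shift n (of_nat r - 1) s j)) = (\<Prod>j=1..k. X j powr (- s j))"
      by (rule prod.cong) (auto simp: shift_def k)
    then show ?thesis unfolding k by (simp add: shift_def)
  qed
  also have "- (s n + s (Suc n) + (of_nat r - 1)) = - s n + (1 - s (Suc n) - of_nat r)" by simp
  also have "X n powr (- s n + (1 - s (Suc n) - of_nat r)) = X n powr (- s n) * X n powr (1 - s (Suc n) - of_nat r)"
    by (rule powr_add)
  finally have "(\<Prod>j=1..n. X j powr (- shift n (of_nat r - 1) s j)) =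
      (\<Prod>j=1..n. X j powr (- s j)) * X n powr (1 - s (Suc n) - of_nat r)"
    unfolding k by simp
  then have "prefix_weight m s * base_form m powr (1 - s (Suc n) - of_nat r) =
     (\<Prod>j=1..n. \<nu> j ^ m j) * (\<Prod>j=1..n. X j powr (- shift n (of_nat r - 1) s j))"
    unfolding prefix_weight_def Y X_def by (simp add: m0 mult.assoc)
  also have "\<dots> = zeta_term n n \<gamma> b \<nu> (shift n (of_nat r - 1) s) m"
    by (simp add: zeta_term_def X_def lform_def powr_minus divide_inverse prod_inversef[symmetric] o_def)
  finally show ?thesis .
qed

lemma base_series_eq:
  assumes n: "n \<ge> 1"
  shows "base_series r s = zeta_series n n \<gamma> b \<nu> (shift n (of_nat r - 1) s)"
  unfolding base_series_def zeta_series_def base_idx_eq[OF n, symmetric]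
  by (rule infsum_cong) (rule base_term_eq[OF n])

lemma base_idx_0: "n = 0 \<Longrightarrow> base_idx = {(\<lambda>_. 0)(1 := 1)}"
  unfolding base_idx_def idx_def by (auto simp: fun_eq_iff)

lemma base_summable:
  assumes s: "s \<in> conv_region (Suc n)"
  shows "(\<lambda>m. prefix_weight m s * base_form m powr (1 - s (Suc n) - of_nat r)) summable_on base_idx"
proof (cases n)
  case 0
  show ?thesis by (rule summable_on_finite) (simp add: base_idx_0[OF 0])
next
  case (Suc k)
  interpret lo: zeta_data k \<gamma> b \<nu> by (rule lower[OF Suc])
  have n: "n \<ge> 1" using Suc by simp
  have "shift n (of_nat r - 1) s \<in> conv_region n" by (rule shift_conv_region[OF n s]) simp
  then have "zeta_term n n \<gamma> b \<nu> (shift n (of_nat r - 1) s) summable_on idx n"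
    using lo.zeta_term_summable[of "shift n (of_nat r - 1) s"] Suc by simp
  then have "zeta_term n n \<gamma> b \<nu> (shift n (of_nat r - 1) s) summable_on base_idx"
    by (simp add: base_idx_eq[OF n])
  then show ?thesis
    using summable_on_cong[of base_idx "\<lambda>m. prefix_weight m s * base_form m powr (1 - s (Suc n) - of_nat r)"
        "zeta_term n n \<gamma> b \<nu> (shift n (of_nat r - 1) s)"] base_term_eq[OF n] by blast
qed

lemma base_series_0:
  assumes n: "n = 0"
  shows "base_series r s = \<nu> 1 * (\<gamma> 1 + b 0) powr (1 - s 1 - of_nat r)"
  unfolding base_series_def base_idx_0[OF n] prefix_weight_def base_form_def
  by (simp add: lform_def n)

section \<open>Zeta functions whose variables before the last are twisted\<close>

lemma entire_continuation:
  assumes q: "admissible q"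
    and A: "\<And>r. holo_n (Suc n) (A r) (cn (Suc n))"
    and base: "\<And>r s. s \<in> conv_region (Suc n) \<Longrightarrow> base_series r s = A r s"
  obtains G where "holo_n (Suc n) G (cn (Suc n))"
    "\<And>s. s \<in> conv_region (Suc n) \<Longrightarrow>
       G s = cleared_series s"
    "\<And>L s. L \<ge> 1 \<Longrightarrow> s \<in> shifted_region (Suc n) L \<Longrightarrow>
       G s = (\<Sum>r\<le>L. zcoeff q r (s (Suc n)) * A r s)
         + error_series q L s"
proof -
  obtain G where G: "holo_n (Suc n) G (cn (Suc n))"
    "\<And>s. s \<in> conv_region (Suc n) \<Longrightarrow>
       G s = cleared_series s"
    "\<And>L s. L \<ge> 1 \<Longrightarrow> s \<in> shifted_region (Suc n) L \<Longrightarrow> s \<in> cn (Suc n) \<Longrightarrow>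
       G s = (\<Sum>r\<le>L. zcoeff q r (s (Suc n)) * (A r s / 1))
         + error_series q L s"
    by (rule continuation[OF q A, where k = "\<lambda>_ _. 1" and E = "cn (Suc n)"])
       (use base base_summable conv_region_def in \<open>auto intro: holo_n_const\<close>)
  show ?thesis
  proof (rule that[OF G(1) G(2)])
    fix L s assume L: "(1::nat) \<le> L" and s: "s \<in> shifted_region (Suc n) L"
    have "s \<in> cn (Suc n)" using s shifted_region_cn by blast
    from G(3)[OF L s this]
    show "G s = (\<Sum>r\<le>L. zcoeff q r (s (Suc n)) * A r s)
         + error_series q L s" by simp
  qed
qed

text \<open>At \<open>s (Suc n) = 1\<close> the error vanishes and every coefficient with
  \<open>r \<ge> 1\<close> contains the factor \<open>s - 1\<close>. Only the polar coefficient
  \<open>inverse (\<gamma> (Suc n))\<close> survives.\<close>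

lemma residue:
  assumes q: "lerch_coeffs 1 (\<beta> / \<gamma> (Suc n)) q" and \<nu>1: "\<nu> (Suc n) = 1"
    and G: "\<And>L s. L \<ge> 1 \<Longrightarrow> s \<in> shifted_region (Suc n) L \<Longrightarrow>
       G s = (\<Sum>r\<le>L. zcoeff q r (s (Suc n)) * A r s)
         + error_series q L s"
    and s: "s \<in> cn (Suc n)" "s (Suc n) = 1"
  shows "G s = inverse (\<gamma> (Suc n)) * A 0 s"
proof -
  obtain L where "s \<in> shifted_region (Suc n) L" using shifted_region_exhausts[OF s(1)] by blast
  then have L: "s \<in> shifted_region (Suc n) (Suc L)"
    using shifted_region_mono[of L "Suc L"] by auto
  have "error_series q (Suc L) s = 0" by (rule error_series_eq_0) (use q \<nu>1 s in auto)
  then have "G s = (\<Sum>r\<le>Suc L. expansion_coeff 1 (\<gamma> (Suc n)) q r 1 * A r s)"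
    using G[OF _ L] \<nu>1 s by simp
  also have "\<dots> = expansion_coeff 1 (\<gamma> (Suc n)) q 0 1 * A 0 s"
    by (subst sum.atMost_Suc_shift) (simp add: expansion_coeff_Suc pole_factor_def)
  finally show ?thesis by (simp add: expansion_coeff_0)
qed

end

text \<open>Induction on the number of twisted variables. The lower function ends in a twisted
  variable, so it has no pole factor and its base series are entire; a pole can come only from the
  last variable. The residue clause later identifies the numerator of the exceptional term on its
  polar hyperplane.\<close>

lemma twisted_continuation:
  assumes "zeta_data n \<gamma> b \<nu>" and "\<And>j. j \<in> {1..n} \<Longrightarrow> \<nu> j \<noteq> 1"
  shows "\<exists>G. holo_n (Suc n) G (cn (Suc n)) \<and>
    (\<forall>s\<in>conv_region (Suc n). G s = pole_factor (\<nu> (Suc n)) (s (Suc n)) * zeta_series (Suc n) (Suc n) \<gamma> b \<nu> s) \<and>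
    (\<nu> (Suc n) = 1 \<longrightarrow> (\<forall>s\<in>cn (Suc n). s (Suc n) = 1 \<longrightarrow>
       G s = inverse (\<gamma> (Suc n)) * zeta_cont n n \<gamma> b \<nu> (rst n s)))"
  using assms
proof (induction n)
  case 0
  interpret zeta_data 0 \<gamma> b \<nu> by (rule 0)
  obtain q where q: "lerch_coeffs (\<nu> (Suc 0)) (\<beta> / \<gamma> (Suc 0)) q" using lerch_coeffs_exist by blast
  define A where "A = (\<lambda>r (s::nat \<Rightarrow> complex). \<nu> 1 * (\<gamma> 1 + b 0) powr (1 - s 1 - of_nat r))"
  have X: "\<gamma> 1 + b 0 \<noteq> 0"
  proof -
    have "Re (\<gamma> 1 + b 0) > 0" using bb[of 0] by simp
    then show ?thesis by (metis less_irrefl zero_complex.sel(1))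
  qed
  have "(\<lambda>z. \<nu> 1 * (\<gamma> 1 + b 0) powr (1 - z - of_nat r)) holomorphic_on UNIV" for r
    by (intro holomorphic_intros holomorphic_powr_exponent X)
  from holo_n_coord_comp[OF this, where n = "Suc 0" and i = 1 and U = "cn (Suc 0)"]
  have A: "holo_n (Suc 0) (A r) (cn (Suc 0))" for r unfolding A_def .
  have base: "base_series r s = A r s" for r s
    unfolding A_def by (rule base_series_0) simp
  obtain G where G: "holo_n (Suc 0) G (cn (Suc 0))"
    "\<And>s. s \<in> conv_region (Suc 0) \<Longrightarrow>
       G s = pole_factor (\<nu> (Suc 0)) (s (Suc 0)) * zeta_series (Suc 0) (Suc 0) \<gamma> b \<nu> s"
    "\<And>L s. L \<ge> 1 \<Longrightarrow> s \<in> shifted_region (Suc 0) L \<Longrightarrow>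
       G s = (\<Sum>r\<le>L. expansion_coeff (\<nu> (Suc 0)) (\<gamma> (Suc 0)) q r (s (Suc 0)) * A r s)
         + error_series q L s"
  proof (rule entire_continuation[OF q A base], goal_cases)
    case (1 G)
    show ?case by (rule 1(1)[OF 1(2-4)])
  qed
  have "G s = inverse (\<gamma> (Suc 0)) * zeta_cont 0 0 \<gamma> b \<nu> (rst 0 s)"
    if "\<nu> (Suc 0) = 1" "s \<in> cn (Suc 0)" "s (Suc 0) = 1" for s
    using residue[OF _ that(1) G(3) that(2,3)] q that X by (simp add: A_def zeta_cont_def)
  then show ?case using G(1,2) by blast
next
  case (Suc k)
  interpret zeta_data "Suc k" \<gamma> b \<nu> by (rule Suc.prems)
  obtain q where q: "lerch_coeffs (\<nu> (Suc (Suc k))) (\<beta> / \<gamma> (Suc (Suc k))) q" using lerch_coeffs_exist by blast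
  have tw: "\<nu> (Suc k) \<noteq> 1" using Suc.prems(2)[of "Suc k"] by simp
  obtain H where H: "holo_n (Suc k) H (cn (Suc k))"
    "\<forall>s\<in>conv_region (Suc k). H s = pole_factor (\<nu> (Suc k)) (s (Suc k)) * zeta_series (Suc k) (Suc k) \<gamma> b \<nu> s"
    using Suc.IH[OF lower[OF refl]] Suc.prems(2) by force
  have H2: "H s = 1 * zeta_series (Suc k) (Suc k) \<gamma> b \<nu> s" if "s \<in> conv_region (Suc k)" for s
    using H(2) that tw by (simp add: pole_factor_def)
  have cont: "zeta_cont (Suc k) (Suc k) \<gamma> b \<nu> s = H s" if "s \<in> cn (Suc k)" for s
  proof -
    have "connected (cn (Suc k))" by (rule connected_segmentI) (auto simp: cn_def)
    moreover have "cn (Suc k) \<inter> conv_region (Suc k) \<noteq> {}"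
      using conv_region_nonempty[of "Suc k"] by (auto simp: conv_region_def)
    ultimately show ?thesis
      using zeta_cont_eq[OF _ H(1) holo_n_const H2, of "cn (Suc k)" s] that by simp
  qed
  define A where "A = (\<lambda>r s. H (shift (Suc k) (of_nat r - 1) s))"
  have A: "holo_n (Suc (Suc k)) (A r) (cn (Suc (Suc k)))" for r
    unfolding A_def by (rule holo_n_shift[OF _ H(1)]) simp
  have base: "base_series r s = A r s" if "s \<in> conv_region (Suc (Suc k))" for r s
  proof -
    have "shift (Suc k) (of_nat r - 1) s \<in> conv_region (Suc k)"
      by (rule shift_conv_region[OF _ that]) auto
    then show ?thesis unfolding A_def using base_series_eq[of r s] H2 by simp
  qed
  obtain G where G: "holo_n (Suc (Suc k)) G (cn (Suc (Suc k)))"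
    "\<And>s. s \<in> conv_region (Suc (Suc k)) \<Longrightarrow>
       G s = pole_factor (\<nu> (Suc (Suc k))) (s (Suc (Suc k))) * zeta_series (Suc (Suc k)) (Suc (Suc k)) \<gamma> b \<nu> s"
    "\<And>L s. L \<ge> 1 \<Longrightarrow> s \<in> shifted_region (Suc (Suc k)) L \<Longrightarrow>
       G s = (\<Sum>r\<le>L. expansion_coeff (\<nu> (Suc (Suc k))) (\<gamma> (Suc (Suc k))) q r (s (Suc (Suc k))) * A r s)
         + error_series q L s"
  proof (rule entire_continuation[where A = A, OF q A], goal_cases)
    case (1 r s)
    show ?case by (rule base[OF 1(2)])
  next
    case (2 G)
    show ?case by (rule 2(1)[OF 2(2-4)])
  qed
  have "G s = inverse (\<gamma> (Suc (Suc k))) * zeta_cont (Suc k) (Suc k) \<gamma> b \<nu> (rst (Suc k) s)"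
    if "\<nu> (Suc (Suc k)) = 1" "s \<in> cn (Suc (Suc k))" "s (Suc (Suc k)) = 1" for s
  proof -
    \<comment> \<open>For \<open>r = 0\<close> and last coordinate 1 the merged increment
      \<open>1 + (0 - 1)\<close> is 0, so the last coordinate simply drops out.\<close>
    have "shift (Suc k) (of_nat 0 - 1) s = rst (Suc k) s"
      using that(3) by (auto simp: shift_def rst_def fun_eq_iff)
    then have "A 0 s = zeta_cont (Suc k) (Suc k) \<gamma> b \<nu> (rst (Suc k) s)"
      unfolding A_def using cont[OF rst_cn] by simp
    then show ?thesis using residue[OF _ that(1) G(3) that(2,3)] q that by simp
  qed
  then show ?case using G(1,2) by blast
qed

subsection \<open>Values of the Hurwitz zeta function at nonpositive integers\<close>

text \<open>\<open>P\<close> is the expansion at \<open>s = - l\<close>, where the error vanishes.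
  The identity is read off where \<open>X\<close> and \<open>X + a\<close> lie in the right
  half-plane and extends to all \<open>X\<close>, both sides being polynomials; it is needed at
  natural numbers \<open>X\<close>, where \<open>X + a\<close> may leave the half-plane.\<close>

lemma lerch_polynomial:
  fixes a X :: complex and l :: nat
  assumes q: "lerch_coeffs 1 a q"
  defines "P \<equiv> \<lambda>X. \<Sum>r\<le>Suc l. expansion_coeff 1 1 q r (- of_nat l) * X ^ (Suc l - r)"
  shows "P X - P (X + 1) = - of_nat (Suc l) * (X + a) ^ l"
proof (rule analytic_continuation_open[of "{z. Re z > max 0 (- Re a)}" UNIV
      "\<lambda>X. P X - P (X + 1)" "\<lambda>X. - of_nat (Suc l) * (X + a) ^ l"])
  show "open {z. max 0 (- Re a) < Re z}" by (rule open_halfspace_Re_gt)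
  have "of_real (1 + \<bar>Re a\<bar>) \<in> {z. Re z > max 0 (- Re a)}" by (auto simp: abs_if)
  then show "{z. Re z > max 0 (- Re a)} \<noteq> {}" by blast
  show "(\<lambda>X. P X - P (X + 1)) holomorphic_on UNIV" unfolding P_def by (intro holomorphic_intros)
  show "(\<lambda>X. - of_nat (Suc l) * (X + a) ^ l) holomorphic_on UNIV" by (intro holomorphic_intros)
next
  fix X assume "X \<in> {z. Re z > max 0 (- Re a)}"
  then have X: "Re X > 0" "Re (X + a) > 0" "Re (X + 1) > 0" by auto
  have ex: "expansion 1 1 q (Suc l) (- of_nat l) Y = P Y" if Y: "Re Y > 0" for Y
    unfolding expansion_def P_def
  proof (rule sum.cong[OF refl])
    fix r assume "r \<in> {..Suc l}"
    then have "1 - - of_nat l - of_nat r = (of_nat (Suc l - r) :: complex)" by (simp add: of_nat_diff)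
    moreover have "Y \<noteq> 0" using Y by auto
    ultimately show "expansion_coeff 1 1 q r (- of_nat l) * Y powr (1 - - of_nat l - of_nat r) =
        expansion_coeff 1 1 q r (- of_nat l) * Y ^ (Suc l - r)"
      using powr_nat'[of Y "Suc l - r"] by simp
  qed
  have "X + a \<noteq> 0" using X(2) by (metis less_irrefl zero_complex.sel(1))
  then have "(X + a) powr (- (- of_nat l)) = (X + a) ^ l" by (simp add: powr_nat')
  moreover have "expansion_error 1 1 a q (Suc l) (- of_nat l) X = 0"
    by (rule expansion_error_neg_nat) (use q X in auto)
  ultimately show "P X - P (X + 1) = - of_nat (Suc l) * (X + a) ^ l"
    unfolding expansion_error_def ex[OF X(1)] ex[OF X(3)] by (simp add: pole_factor_def algebra_simps)
qed auto

text \<open>One more summand is compensated by one step of the difference equation, so the left side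
  does not depend on \<open>M\<close>. At \<open>M = 0\<close> only \<open>r = Suc l\<close>
  survives, through \<open>0 ^ 0 = 1\<close>.\<close>

lemma lerch_polynomial_sum:
  fixes a :: complex and l M :: nat
  assumes q: "lerch_coeffs 1 a q"
  shows "- of_nat (Suc l) * (\<Sum>k<M. (of_nat k + a) ^ l) +
      (\<Sum>r\<le>Suc l. expansion_coeff 1 1 q r (- of_nat l) * of_nat M ^ (Suc l - r)) = - of_nat (Suc l) * q l"
proof (induction M)
  case 0
  have "(\<Sum>r\<le>Suc l. expansion_coeff 1 1 q r (- of_nat l) * of_nat 0 ^ (Suc l - r)) =
      expansion_coeff 1 1 q (Suc l) (- of_nat l)"
    by (subst sum.atMost_Suc) (auto intro!: sum.neutral simp: power_0_left)
  also have "\<dots> = - of_nat (Suc l) * q l"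
  proof -
    have "(- (- of_nat l) gchoose l :: complex) = 1"
      by (simp add: binomial_gbinomial[symmetric])
    then show ?thesis by (simp add: expansion_coeff_Suc pole_factor_def)
  qed
  finally show ?case by simp
next
  case (Suc M)
  define P where "P = (\<lambda>X. \<Sum>r\<le>Suc l. expansion_coeff 1 1 q r (- of_nat l) * X ^ (Suc l - r))"
  define c :: complex where "c = - of_nat (Suc l)"
  have IH: "c * (\<Sum>k<M. (of_nat k + a) ^ l) + P (of_nat M) = c * q l"
    using Suc by (simp only: P_def c_def)
  have "P (of_nat M) - P (of_nat M + 1) = c * (of_nat M + a) ^ l"
    unfolding P_def c_def by (rule lerch_polynomial[OF q])
  then have *: "P (of_nat (Suc M)) = P (of_nat M) - c * (of_nat M + a) ^ l"
    by (simp add: algebra_simps)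
  have "c * (\<Sum>k<Suc M. (of_nat k + a) ^ l) + P (of_nat (Suc M)) =
      c * (\<Sum>k<M. (of_nat k + a) ^ l) + P (of_nat M)"
    unfolding * by (simp add: distrib_left)
  then have "c * (\<Sum>k<Suc M. (of_nat k + a) ^ l) + P (of_nat (Suc M)) = c * q l"
    using IH by (simp only:)
  then show ?case by (simp only: P_def c_def)
qed

text \<open>Without its first \<open>M\<close> terms the Hurwitz series is the one-dimensional case
  of the continuation, with step 1 and increment \<open>a\<close>. At \<open>- l\<close> the
  expansion is exact, and \<open>lerch_polynomial_sum\<close> combines it with the first
  \<open>M\<close> terms into \<open>- of_nat (Suc l) * q l\<close>, where
  \<open>- of_nat (Suc l)\<close> is the pole factor \<open>s - 1\<close>.\<close>

lemma hurwitz_zeta_neg: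
  assumes a: "a \<notin> nonpos_real" and q: "lerch_coeffs 1 a q"
  shows "hurwitz_zeta (- of_nat l) a = q l"
proof -
  obtain M0 :: nat where "- Re a < real M0" using reals_Archimedean2 by blast
  then obtain M :: nat where M: "M \<ge> 1" "real M + Re a > 0"
    by (intro that[of "Suc M0"]) auto
  text \<open>Shifting the summation by \<open>M\<close> moves all terms into the right half-plane.\<close>
  define b where "b = (\<lambda>j::nat. if j = 0 then of_nat M - 1 else of_nat M - 1 + a)"
  interpret zeta_data 0 "\<lambda>_. 1" b "\<lambda>_. 1"
    by unfold_locales (use M in \<open>auto simp: b_def\<close>)
  have \<beta>: "\<beta> = a" unfolding \<beta>_def by (simp add: b_def)
  \<comment> \<open>The index starts at 1, so the starting argument of the expansion is
    \<open>1 + b 0 = M\<close>.\<close>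
  define A where "A = (\<lambda>r (s::nat \<Rightarrow> complex). (of_nat M :: complex) powr (1 - s 1 - of_nat r))"
  have A: "holo_n (Suc 0) (A r) (cn (Suc 0))" for r
  proof -
    have "(\<lambda>z. (of_nat M :: complex) powr (1 - z - of_nat r)) holomorphic_on UNIV"
      by (intro holomorphic_intros holomorphic_powr_exponent) (use M in auto)
    from holo_n_coord_comp[OF this, where n = "Suc 0" and i = 1 and U = "cn (Suc 0)"]
    show ?thesis unfolding A_def .
  qed
  have base: "base_series r s = A r s" for r s
    unfolding A_def by (subst base_series_0) (simp_all add: b_def)
  have q': "lerch_coeffs 1 (\<beta> / 1) q" using q by (simp add: \<beta>)
  obtain G where G: "holo_n (Suc 0) G (cn (Suc 0))"
    "\<And>s. s \<in> conv_region (Suc 0) \<Longrightarrow>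
       G s = pole_factor 1 (s (Suc 0)) * zeta_series (Suc 0) (Suc 0) (\<lambda>_. 1) b (\<lambda>_. 1) s"
    "\<And>L s. L \<ge> 1 \<Longrightarrow> s \<in> shifted_region (Suc 0) L \<Longrightarrow>
       G s = (\<Sum>r\<le>L. expansion_coeff 1 1 q r (s (Suc 0)) * A r s) + error_series q L s"
  proof (rule entire_continuation[OF q' A base], goal_cases)
    case (1 G)
    show ?case by (rule 1(1)[OF 1(2-4)])
  qed
  define pt where "pt = (\<lambda>z::complex. (\<lambda>_::nat. 0::complex)(1 := z))"
  have pt: "pt z \<in> cn (Suc 0)" "pt z (Suc 0) = z" for z by (auto simp: pt_def cn_def)
  have hol: "(\<lambda>z. G (pt z)) holomorphic_on UNIV"
  proof -
    have "{z. pt z \<in> cn (Suc 0)} = UNIV" using pt by auto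
    then show ?thesis
      using holo_n_slice[OF G(1) order_refl, of 1 "\<lambda>_. 0"] by (simp add: pt_def)
  qed
  \<comment> \<open>The entire function that continues \<open>z - 1\<close> times the Hurwitz
    series, with its first \<open>M\<close> terms put back.\<close>
  define g where "g = (\<lambda>z. (z - 1) * (\<Sum>k<M. (of_nat k + a) powr (- z)) + G (pt z))"
  have nz: "of_nat k + a \<noteq> 0" for k
  proof
    assume "of_nat k + a = 0"
    then have "a = - of_nat k" by (simp add: add_eq_0_iff)
    then show False using a by (auto simp: nonpos_real_def)
  qed
  have gh: "g holomorphic_on UNIV" unfolding g_def
    by (intro holomorphic_intros hol holomorphic_powr_exponent nz)
  have gs: "g z = (z - 1) * (\<Sum>k. (of_nat k + a) powr (- z))" if z: "Re z > 1" for z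
  proof -
    have pc: "pt z \<in> conv_region (Suc 0)" using z pt by (simp add: conv_region_def)
    have bij: "bij_betw (\<lambda>k. (\<lambda>_. 0)(1 := Suc k)) UNIV (idx (Suc 0))"
      by (rule bij_betw_byWitness[where f' = "\<lambda>m. m 1 - 1"]) (auto simp: idx_def fun_eq_iff)
    have t: "zeta_term (Suc 0) (Suc 0) (\<lambda>_. 1) b (\<lambda>_. 1) (pt z) ((\<lambda>_. 0)(1 := Suc k)) =
        (of_nat (k + M) + a) powr (- z)" for k
      by (simp add: zeta_term_def b_def pt_def powr_minus divide_inverse algebra_simps)
    have s: "(\<lambda>k. (of_nat (k + M) + a) powr (- z)) summable_on UNIV"
      using zeta_term_summable[OF pc] summable_on_reindex_bij_betw[OF bij,
          of "zeta_term (Suc 0) (Suc 0) (\<lambda>_. 1) b (\<lambda>_. 1) (pt z)"] unfolding t by simp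
    have "zeta_series (Suc 0) (Suc 0) (\<lambda>_. 1) b (\<lambda>_. 1) (pt z) = (\<Sum>\<^sub>\<infinity>k. (of_nat (k + M) + a) powr (- z))"
      unfolding zeta_series_def infsum_reindex_bij_betw[OF bij, symmetric] t ..
    also have "\<dots> = (\<Sum>k. (of_nat (k + M) + a) powr (- z))"
      using has_sum_imp_sums[OF has_sum_infsum[OF s]] by (simp add: sums_iff)
    finally have zs: "zeta_series (Suc 0) (Suc 0) (\<lambda>_. 1) b (\<lambda>_. 1) (pt z) =
        (\<Sum>k. (of_nat (k + M) + a) powr (- z))" .
    have "summable (\<lambda>k. (of_nat (k + M) + a) powr (- z))"
      by (rule summable_on_imp_summable[OF s])
    then have "summable (\<lambda>k. (of_nat k + a) powr (- z))"
      using summable_iff_shift[of "\<lambda>k. (of_nat k + a) powr (- z)" M] by simp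
    from suminf_split_initial_segment[OF this, of M]
    show ?thesis unfolding g_def G(2)[OF pc] zs pt(2) by (simp add: pole_factor_def algebra_simps)
  qed
  have val: "hurwitz_zeta s a = g s / (s - 1)" if s: "s \<noteq> 1" for s
    unfolding hurwitz_zeta_def
  proof (rule the_equality)
    have "connected (UNIV - {1::complex})" by (rule connected_open_delete) auto
    moreover have "(2::complex) \<in> (UNIV - {1}) \<inter> {z. Re z > 1}" by auto
    then have "(UNIV - {1::complex}) \<inter> {z. Re z > 1} \<noteq> {}" by blast
    moreover have "(\<lambda>z. g z / (z - 1)) holomorphic_on UNIV - {1}"
      by (intro holomorphic_intros holomorphic_on_subset[OF gh]) auto
    moreover have "g z / (z - 1) = (\<Sum>m. (of_nat m + a) powr (- z))" if "Re z > 1" for z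
    proof -
      have "z - 1 \<noteq> 0" using that by auto
      then show ?thesis using gs[OF that] by simp
    qed
    ultimately show "\<exists>U F. open U \<and> connected U \<and> s \<in> U \<and> F holomorphic_on U \<and>
        U \<inter> {z. Re z > 1} \<noteq> {} \<and>
        (\<forall>z\<in>U. Re z > 1 \<longrightarrow> F z = (\<Sum>m. (of_nat m + a) powr (- z))) \<and> F s = g s / (s - 1)"
      using s by (intro exI[of _ "UNIV - {1}"] exI[of _ "\<lambda>z. g z / (z - 1)"]) auto
  next
    fix v assume "\<exists>U F. open U \<and> connected U \<and> s \<in> U \<and> F holomorphic_on U \<and>
        U \<inter> {z. Re z > 1} \<noteq> {} \<and>
        (\<forall>z\<in>U. Re z > 1 \<longrightarrow> F z = (\<Sum>m. (of_nat m + a) powr (- z))) \<and> F s = v"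
    then obtain U F where U: "open U" "connected U" "s \<in> U" "F holomorphic_on U"
      "U \<inter> {z. Re z > 1} \<noteq> {}"
      "\<forall>z\<in>U. Re z > 1 \<longrightarrow> F z = (\<Sum>m. (of_nat m + a) powr (- z))" "F s = v" by blast
    have "(s - 1) * F s = g s"
    proof (rule analytic_continuation_open[of "U \<inter> {z. Re z > 1}" U "\<lambda>z. (z - 1) * F z" g])
      show "open (U \<inter> {z. Re z > 1})" by (intro open_Int U(1) open_halfspace_Re_gt)
      show "(\<lambda>z. (z - 1) * F z) holomorphic_on U" by (intro holomorphic_intros U(4))
      show "g holomorphic_on U" by (rule holomorphic_on_subset[OF gh]) auto
    qed (use U gs in auto)
    then show "v = g s / (s - 1)" using s U(7) by (auto simp: field_simps)
  qed
  define s where "s = (- of_nat l :: complex)"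
  have s1: "s \<noteq> 1"
  proof
    assume "s = 1"
    then have "Re s = 1" by simp
    then show False by (simp add: s_def)
  qed
  \<comment> \<open>Order \<open>l + 2\<close> suffices because \<open>- l + (l + 2) > 1\<close>;
    the surplus term \<open>r = l + 2\<close> has a coefficient containing
    \<open>l choose Suc l\<close>, which is 0.\<close>
  have "pt s \<in> shifted_region (Suc 0) (l + 2)"
    using pt(1)[of s] by (simp add: shifted_region_def pt_def s_def)
  from G(3)[OF _ this] have "G (pt s) = (\<Sum>r\<le>l + 2. expansion_coeff 1 1 q r s * A r (pt s)) +
      error_series q (l + 2) (pt s)"
    using pt(2) by simp
  also have "error_series q (l + 2) (pt s) = 0"
    by (rule error_series_eq_0[OF q']) (use pt(2) s_def in auto)
  also have "(\<Sum>r\<le>l + 2. expansion_coeff 1 1 q r s * A r (pt s)) =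
      (\<Sum>r\<le>Suc l. expansion_coeff 1 1 q r s * A r (pt s))"
  proof -
    have "(- s gchoose Suc l) = (0 :: complex)"
      unfolding s_def by (simp add: binomial_gbinomial[symmetric])
    then show ?thesis by (simp add: expansion_coeff_Suc del: gbinomial_Suc)
  qed
  also have "\<dots> = (\<Sum>r\<le>Suc l. expansion_coeff 1 1 q r (- of_nat l) * of_nat M ^ (Suc l - r))"
  proof (rule sum.cong[OF refl])
    fix r assume "r \<in> {..Suc l}"
    then have "1 - s - of_nat r = (of_nat (Suc l - r) :: complex)" by (simp add: of_nat_diff s_def)
    then have "A r (pt s) = of_nat M ^ (Suc l - r)"
      using powr_nat'[of "of_nat M :: complex" "Suc l - r"] M(1) by (simp add: A_def pt_def)
    then show "expansion_coeff 1 1 q r s * A r (pt s) =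
        expansion_coeff 1 1 q r (- of_nat l) * of_nat M ^ (Suc l - r)"
      by (simp add: s_def)
  qed
  finally have Gs: "G (pt s) = (\<Sum>r\<le>Suc l. expansion_coeff 1 1 q r (- of_nat l) * of_nat M ^ (Suc l - r))"
    by simp
  have "(of_nat k + a) powr (- s) = (of_nat k + a) ^ l" for k
    using powr_nat'[OF disjI1[OF nz]] by (simp add: s_def)
  then have "g s = (- of_nat l - 1) * (\<Sum>k<M. (of_nat k + a) ^ l) + G (pt s)"
    by (simp add: g_def s_def)
  also have "(- of_nat l - 1 :: complex) = - of_nat (Suc l)" by simp
  finally have "g s = - of_nat (Suc l) * q l"
    using lerch_polynomial_sum[OF q, of l M] Gs by simp
  moreover have "s - 1 = - of_nat (Suc l)" by (simp add: s_def)
  ultimately show ?thesis using val[OF s1] by (simp add: s_def del: of_nat_Suc)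
qed

subsection \<open>Two untwisted variables\<close>

lemma prod_descending_neg:
  "(\<Prod>i=Suc K..<Suc (K + M). (of_nat K - of_nat i :: complex)) = (-1) ^ M * fact M"
proof (induction M)
  case (Suc M)
  have "(\<Prod>i=Suc K..<Suc (K + Suc M). (of_nat K - of_nat i :: complex)) =
      (\<Prod>i=Suc K..<Suc (K + M). (of_nat K - of_nat i)) * (of_nat K - of_nat (Suc (K + M)))"
    by simp
  also have "(of_nat K - of_nat (Suc (K + M)) :: complex) = - of_nat (Suc M)" by simp
  finally show ?case unfolding Suc by (simp add: algebra_simps)
qed simp

lemma prod_descending: "(\<Prod>i=0..<K. (of_nat K - of_nat i :: complex)) = fact K"
proof -
  have "(of_nat K gchoose K :: complex) = 1" by (simp add: binomial_gbinomial[symmetric])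
  then show ?thesis by (simp add: gbinomial_prod_rev)
qed

text \<open>The quotient by \<open>c\<close> is the function \<open>\<epsilon>\<close> of the theorem.\<close>
lemma gbinomial_vanishing_order:
  fixes K M :: nat
  defines "c \<equiv> (-1) ^ (M + 1) * fact K * fact M / (fact (M + K + 1) :: complex)"
  shows "\<exists>C\<ge>0. \<forall>x. cmod x \<le> 1/2 \<longrightarrow>
    cmod (((of_nat K - x) gchoose (M + K + 1)) / c - x) \<le> C * cmod x ^ 2"
proof -
  define l where "l = M + K + 1"
  \<comment> \<open>The factor \<open>i = K\<close> is the simple zero at \<open>x = 0\<close>. At 0
    the other factors give \<open>fact K\<close> for \<open>i < K\<close> and
    \<open>(-1) ^ M * fact M\<close> for \<open>i > K\<close>; this is the origin of
    \<open>c\<close>, which normalises \<open>u 0\<close> to 1.\<close>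
  define u where "u = (\<lambda>x. - (\<Prod>i\<in>{0..<l} - {K}. of_nat K - x - of_nat i) / fact l / c)"
  have c: "c = (-1) ^ (M + 1) * fact K * fact M / fact l" by (simp only: c_def l_def)
  have c0: "c \<noteq> 0" by (simp add: c)
  have fac: "((of_nat K - x) gchoose l) / c = x * u x" for x :: complex
  proof -
    have "(\<Prod>i=0..<l. of_nat K - x - of_nat i) =
        (of_nat K - x - of_nat K) * (\<Prod>i\<in>{0..<l} - {K}. of_nat K - x - of_nat i)"
      by (rule prod.remove) (auto simp: l_def)
    then show ?thesis by (simp add: gbinomial_prod_rev u_def)
  qed
  have u0: "u 0 = 1"
  proof -
    have "{0..<l} - {K} = {0..<K} \<union> {Suc K..<Suc (K + M)}" by (auto simp: l_def)
    then have "(\<Prod>i\<in>{0..<l} - {K}. of_nat K - 0 - of_nat i) =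
        (\<Prod>i=0..<K. (of_nat K - of_nat i :: complex)) * (\<Prod>i=Suc K..<Suc (K + M). of_nat K - of_nat i)"
      by (simp only: diff_0_right) (rule prod.union_disjoint, auto)
    also have "\<dots> = fact K * ((-1) ^ M * fact M)"
      by (simp only: prod_descending prod_descending_neg)
    finally show ?thesis using c0 by (simp add: u_def c)
  qed
  have hol: "u holomorphic_on UNIV" unfolding u_def by (intro holomorphic_intros) (auto simp: c0)
  obtain B where B: "B \<ge> 0" "\<And>x. cmod x \<le> 2 \<Longrightarrow> cmod (u x) \<le> B"
    using entire_bounded[OF hol, of 2] by blast
  have lip: "cmod (u x - u 0) \<le> 4 * B / 2 * cmod (x - 0)" if "cmod x \<le> 1/2" for x
    by (rule holomorphic_lipschitz[of u 0 2 B])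
       (use that B(2) holomorphic_on_subset[OF hol] in auto)
  show ?thesis
  proof (intro exI[of _ "2 * B"] conjI allI impI)
    fix x :: complex assume x: "cmod x \<le> 1/2"
    have "((of_nat K - x) gchoose (M + K + 1)) / c - x = x * (u x - u 0)"
      using fac[of x] by (simp add: u0 l_def algebra_simps)
    then have "cmod (((of_nat K - x) gchoose (M + K + 1)) / c - x) = cmod x * cmod (u x - u 0)"
      by (simp add: norm_mult)
    also have "\<dots> \<le> cmod x * (2 * B * cmod x)"
      using lip[OF x] by (intro mult_left_mono) auto
    finally show "cmod (((of_nat K - x) gchoose (M + K + 1)) / c - x) \<le> 2 * B * cmod x ^ 2"
      by (simp add: power2_eq_square algebra_simps)
  qed (use B in auto)
qed

locale double_pole = zeta_data "Suc k" \<gamma> b \<nu> for k :: nat and \<gamma> b \<nu> +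
  assumes twisted: "j \<in> {1..k} \<Longrightarrow> \<nu> j \<noteq> 1"
    and untwisted: "\<nu> (Suc k) = 1" "\<nu> (Suc (Suc k)) = 1"
    and nonpos: "\<beta> / \<gamma> (Suc (Suc k)) \<notin> nonpos_real"
begin

abbreviation "n \<equiv> Suc (Suc k)"

text \<open>Domain of the function that still carries the factor \<open>s n - 1\<close>;
  \<open>regular_set\<close> removes that pole too. The bound 2 is there because the r-th base
  series has its pole at \<open>2 - r\<close>.\<close>

definition off_hyperplanes where
  "off_hyperplanes = {s \<in> cn n. \<forall>i::int. i \<le> 2 \<longrightarrow> s (Suc k) + s n \<noteq> of_int i}"

definition regular_set where
  "regular_set = {s \<in> cn n. s n \<noteq> 1 \<and> (\<forall>i::int. i \<le> 2 \<longrightarrow> s (Suc k) + s n \<noteq> of_int i)}"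

definition main_terms :: "(nat \<Rightarrow> nat) \<Rightarrow> (complex \<Rightarrow> complex) \<Rightarrow> (nat \<Rightarrow> complex) \<Rightarrow> complex" where
  "main_terms N \<epsilon> \<delta> =
     - (1 / of_nat (N n + 1))
       * zeta_cont (Suc k) (Suc k) \<gamma> b \<nu> (rst (Suc k) (\<lambda>j. - of_int (Nstar n N 1 j)))
       * inverse (\<gamma> n)
     + (\<Sum>l=0..N n. of_nat (N n choose l)
       * zeta_cont (Suc k) (Suc k) \<gamma> b \<nu> (rst (Suc k) (\<lambda>j. - of_int (Nstar n N (- int l) j)))
       * hurwitz_zeta (- of_nat l) (\<beta> / \<gamma> n)
       * \<gamma> n ^ l)
     + ((-1) ^ (N (Suc k) + 1) * fact (N n) * fact (N (Suc k)) / fact (N (Suc k) + N n + 1))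
       * (\<epsilon> (\<delta> n) / (\<delta> (Suc k) + \<delta> n))
       * zeta_cont k k \<gamma> b \<nu> (rst k (\<lambda>j. \<delta> j - of_nat (N j)))
       * hurwitz_zeta (- of_nat (N (Suc k) + N n + 1)) (\<beta> / \<gamma> n)
       * inverse (\<gamma> (Suc k)) * \<gamma> n ^ (N (Suc k) + N n + 1)"

lemma openin_off_hyperplanes: "openin (top_of_set (cn n)) off_hyperplanes"
proof -
  have "open (- (of_int ` {..2::int}) :: complex set)" by (simp add: open_Compl closed_of_int_image)
  then have "openin (top_of_set (cn n)) {s \<in> cn n. s (Suc k) + s n \<in> - (of_int ` {..2::int})}"
    by (intro openin_cn_cond) (auto intro!: continuous_intros)
  moreover have "{s \<in> cn n. s (Suc k) + s n \<in> - (of_int ` {..2::int})} = off_hyperplanes"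
    by (auto simp: off_hyperplanes_def)
  ultimately show ?thesis by simp
qed

lemma conv_region_off_hyperplanes:
  assumes "s \<in> conv_region n"
  shows "s n \<noteq> 1" "i \<le> 2 \<Longrightarrow> s (Suc k) + s n \<noteq> of_int i"
proof -
  have 1: "Re (s n) > 1" using assms by (auto simp: conv_region_def dest: bspec[of _ _ n])
  then show "s n \<noteq> 1" by auto
  have "\<forall>j\<in>{1..n}. Re (\<Sum>i=j..n. s i) > real (n + 1 - j)"
    using assms unfolding conv_region_def by blast
  from bspec[OF this, of "Suc k"] have 2: "Re (s (Suc k) + s n) > 2" by simp
  assume "i \<le> 2"
  show "s (Suc k) + s n \<noteq> of_int i"
  proof
    assume "s (Suc k) + s n = of_int i"
    then have "Re (s (Suc k) + s n) = real_of_int i" by simp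
    then show False using 2 \<open>i \<le> 2\<close> by simp
  qed
qed

lemma shift_last: "shift (Suc k) c s (Suc k) = s (Suc k) + s n + c"
  by (simp add: shift_def)

text \<open>The case of \<open>twisted_continuation\<close> with last twist 1. The added clause ties
  the entire function to \<open>zeta_cont\<close> at points with last coordinate a nonpositive
  integer, the only ones at which the final formula evaluates the zeta function in
  \<open>Suc k\<close> variables.\<close>

lemma one_untwisted_continuation:
  "\<exists>G. holo_n (Suc k) G (cn (Suc k)) \<and>
    (\<forall>s\<in>conv_region (Suc k). G s = (s (Suc k) - 1) * zeta_series (Suc k) (Suc k) \<gamma> b \<nu> s) \<and>
    (\<forall>s\<in>cn (Suc k). s (Suc k) = 1 \<longrightarrow> G s = inverse (\<gamma> (Suc k)) * zeta_cont k k \<gamma> b \<nu> (rst k s)) \<and>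
    (\<forall>s\<in>cn (Suc k). \<forall>j. s (Suc k) = - of_nat j \<longrightarrow>
       zeta_cont (Suc k) (Suc k) \<gamma> b \<nu> s = G s / (s (Suc k) - 1))"
proof -
  have "zeta_data k \<gamma> b \<nu>" by (rule lower) simp
  then have "\<exists>G. holo_n (Suc k) G (cn (Suc k)) \<and>
      (\<forall>s\<in>conv_region (Suc k). G s = pole_factor (\<nu> (Suc k)) (s (Suc k)) * zeta_series (Suc k) (Suc k) \<gamma> b \<nu> s) \<and>
      (\<nu> (Suc k) = 1 \<longrightarrow> (\<forall>s\<in>cn (Suc k). s (Suc k) = 1 \<longrightarrow>
         G s = inverse (\<gamma> (Suc k)) * zeta_cont k k \<gamma> b \<nu> (rst k s)))"
    by (rule twisted_continuation) (rule twisted)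
  then obtain G where G: "holo_n (Suc k) G (cn (Suc k))"
    "\<forall>s\<in>conv_region (Suc k). G s = (s (Suc k) - 1) * zeta_series (Suc k) (Suc k) \<gamma> b \<nu> s"
    "\<forall>s\<in>cn (Suc k). s (Suc k) = 1 \<longrightarrow> G s = inverse (\<gamma> (Suc k)) * zeta_cont k k \<gamma> b \<nu> (rst k s)"
    unfolding untwisted pole_factor_def by auto
  have Geq: "G s = (s (Suc k) - 1) * zeta_series (Suc k) (Suc k) \<gamma> b \<nu> s" if "s \<in> conv_region (Suc k)" for s
    using G(2) that by blast
  text \<open>\<open>?U\<close> is convex, avoids the pole \<open>s (Suc k) = 1\<close>, and contains the points in question.\<close>
  let ?U = "{t \<in> cn (Suc k). Re (t (Suc k)) - Im (t (Suc k)) < 1}"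
  have "zeta_cont (Suc k) (Suc k) \<gamma> b \<nu> s = G s / (s (Suc k) - 1)"
    if s: "s \<in> cn (Suc k)" "s (Suc k) = - of_nat j" for s j
  proof (rule zeta_cont_eq[where U = ?U])
    show "holo_n (Suc k) (\<lambda>s. s (Suc k) - 1) (cn (Suc k))"
      by (intro holo_n_diff holo_n_coord holo_n_const)
    show "openin (top_of_set (cn (Suc k))) ?U"
    proof -
      have "continuous_on UNIV (\<lambda>t::nat \<Rightarrow> complex. Re (t (Suc k)) - Im (t (Suc k)))"
        by (intro continuous_intros)
      from openin_cn_cond[OF this open_lessThan, of "Suc k" 1] show ?thesis by simp
    qed
    show "connected ?U"
    proof (rule connected_segmentI)
      fix x y :: "nat \<Rightarrow> complex" and t :: real
      assume x: "x \<in> ?U"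
        and y: "y \<in> ?U" and t: "0 \<le> t" "t \<le> 1"
      define u where "u = Re (x (Suc k)) - Im (x (Suc k))"
      define v where "v = Re (y (Suc k)) - Im (y (Suc k))"
      have "(1 - t) * u + t * v < 1"
        by (rule convex_bound_lt) (use x y t in \<open>auto simp: u_def v_def\<close>)
      then show "(\<lambda>j. of_real (1 - t) * x j + of_real t * y j) \<in>
          ?U"
        using x y by (auto simp: cn_def u_def v_def algebra_simps)
    qed
    show "s \<in> ?U" using s by simp
    \<comment> \<open>\<open>Complex 2 2\<close> has real part above 1, while its real and imaginary
      parts differ by 0 < 1, so this point lies in both sets.\<close>
    have "(\<lambda>j. if j \<in> {1..Suc k} then (if j = Suc k then Complex 2 2 else 2) else 0) \<in> conv_region (Suc k)"
      by (rule conv_region_last) auto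
    moreover from this have "(\<lambda>j. if j \<in> {1..Suc k} then (if j = Suc k then Complex 2 2 else 2) else 0) \<in>
        ?U"
      by (auto simp: cn_def)
    ultimately show "?U \<inter> conv_region (Suc k) \<noteq> {}"
      by blast
    show "t (Suc k) - 1 \<noteq> 0" if "t \<in> ?U" for t
      using that by auto
  qed (use G(1) Geq in auto)
  with G show ?thesis by (intro exI[of _ G]) blast
qed

text \<open>Just one linear factor vanishes at the point; the other terms are holomorphic there,
  hence constant up to O(max). In the exceptional term \<open>G\<close> is compared with its value
  on the polar hyperplane, moving only the last coordinate. The difference is O(\<eta>) with \<eta>
  = \<open>\<delta> (Suc k) + \<delta> n\<close>, which cancels the denominator, and the binomial
  coefficient contributes O(\<open>\<delta> n\<close>).\<close>

lemma expansion_at_nonpositive_integers: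
  assumes q: "admissible q" and G: "holo_n (Suc k) G (cn (Suc k))"
    and Gres: "\<And>s. s \<in> cn (Suc k) \<Longrightarrow> s (Suc k) = 1 \<Longrightarrow>
      G s = inverse (\<gamma> (Suc k)) * zeta_cont k k \<gamma> b \<nu> (rst k s)"
    and Zval: "\<And>s j. s \<in> cn (Suc k) \<Longrightarrow> s (Suc k) = - of_nat j \<Longrightarrow>
      zeta_cont (Suc k) (Suc k) \<gamma> b \<nu> s = G s / (s (Suc k) - 1)"
    and F: "\<And>L s. L \<ge> 1 \<Longrightarrow> s \<in> shifted_region n L \<Longrightarrow> s \<in> regular_set \<Longrightarrow>
      F s = ((\<Sum>r\<le>L. zcoeff q r (s n) * (G (shift (Suc k) (of_nat r - 1) s) / (s (Suc k) + s n + of_nat r - 2)))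
        + error_series q L s) / (s n - 1)"
  shows "\<exists>\<epsilon>. (\<exists>C. eventually (\<lambda>x. cmod (\<epsilon> x - x) \<le> C * cmod x ^ 2) (at 0))
    \<and> (\<exists>C. eventually (\<lambda>\<delta>. cmod (F (rst n (\<lambda>j. \<delta> j - of_nat (N j))) - main_terms N \<epsilon> \<delta>)
          \<le> C * Max ((\<lambda>j. cmod (\<delta> j)) ` {1..n}))
        (at (\<lambda>_. 0) within {\<delta> \<in> cn n. \<delta> (Suc k) + \<delta> n \<noteq> 0}))"
proof -
  define A where "A = (\<lambda>r s. G (shift (Suc k) (of_nat r - 1) s))"
  define \<kappa> where "\<kappa> = (\<lambda>r s :: nat \<Rightarrow> complex. s (Suc k) + s n + of_nat r - (2::complex))"
  have A: "holo_n n (A r) U" for r U unfolding A_def by (rule holo_n_shift[OF _ G]) simp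
  have \<kappa>: "holo_n n (\<kappa> r) U" for r U
    unfolding \<kappa>_def by (intro holo_n_add holo_n_diff holo_n_coord holo_n_const)
  have q1: "lerch_coeffs 1 (\<beta> / \<gamma> n) q" using q by (simp only: untwisted)
  have hur: "hurwitz_zeta (- of_nat l) (\<beta> / \<gamma> n) = q l" for l
    by (rule hurwitz_zeta_neg[OF nonpos q1])
  define M where "M = N (Suc k)"
  define K where "K = N n"
  \<comment> \<open>At \<open>p\<close> the r-th linear factor equals
    \<open>r - (M + K + 2)\<close>, so \<open>r = Suc l\<close> is the exceptional index.\<close>
  define l where "l = M + K + 1"
  define c :: complex where "c = (-1) ^ (M + 1) * fact K * fact M / fact l"
  have c0: "c \<noteq> 0" by (simp add: c_def)
  define \<epsilon> where "\<epsilon> = (\<lambda>x::complex. ((of_nat K - x) gchoose l) / c)"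
  obtain C3 where C3: "C3 \<ge> 0" "\<And>x. cmod x \<le> 1/2 \<Longrightarrow> cmod (\<epsilon> x - x) \<le> C3 * cmod x ^ 2"
    using gbinomial_vanishing_order[of K M] unfolding \<epsilon>_def c_def l_def by blast
  have \<epsilon>small: "cmod (\<epsilon> x) \<le> (1 + C3) * cmod x" if x: "cmod x \<le> 1/2" for x
  proof -
    have "cmod (\<epsilon> x) \<le> cmod x + cmod (\<epsilon> x - x)" using norm_triangle_ineq[of x "\<epsilon> x - x"] by simp
    also have "\<dots> \<le> cmod x + C3 * cmod x ^ 2" using C3(2)[OF x] by simp
    also have "C3 * cmod x ^ 2 \<le> C3 * (cmod x * 1)"
      unfolding power2_eq_square using C3(1) x by (intro mult_left_mono) auto
    finally show ?thesis by (simp add: algebra_simps)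
  qed
  define p where "p = rst n (\<lambda>j. - of_nat (N j) :: complex)"
  have pcn: "p \<in> cn n" by (simp add: p_def rst_cn)
  have pn: "p n = - of_nat K" "p (Suc k) = - of_nat M" by (simp_all add: p_def rst_def K_def M_def)
  obtain L0 where "p \<in> shifted_region n L0" using shifted_region_exhausts[OF pcn] by blast
  \<comment> \<open>Large enough for the sum to contain the exceptional index \<open>Suc l\<close>,
    and larger than \<open>K\<close>, so that the error series vanishes at \<open>p\<close>.\<close>
  define L where "L = max L0 (l + 2)"
  have pL: "p \<in> shifted_region n L"
    using \<open>p \<in> shifted_region n L0\<close> shifted_region_mono[of L0 L n] by (auto simp: L_def)
  have L: "L \<ge> 1" "K < L" "Suc l \<le> L" by (auto simp: L_def l_def)
  define d where "d = (\<lambda>r s :: nat \<Rightarrow> complex. expansion_coeff 1 (\<gamma> n) q r (s n))"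
  define \<Phi> where "\<Phi> = (\<lambda>r s. d r s * (A r s / \<kappa> r s) / (s n - 1))"
  define R where "R = {..L} - {Suc l}"
  \<comment> \<open>All terms but the exceptional one; on \<open>V\<close> none of their
    denominators vanishes.\<close>
  define \<Psi> where "\<Psi> = (\<lambda>s. (\<Sum>r\<in>R. \<Phi> r s) + error_series q L s / (s n - 1))"
  define V where "V = shifted_region n L \<inter> {s \<in> cn n. s n \<in> - {1}} \<inter> {s \<in> cn n. \<forall>r\<in>R. \<kappa> r s \<in> - {0}}"
  have Vop: "openin (top_of_set (cn n)) V"
    unfolding V_def
  proof (intro openin_Int openin_shifted_region)
    show "openin (top_of_set (cn n)) {s \<in> cn n. s n \<in> - {1}}"
      by (intro openin_cn_cond) (auto intro!: continuous_intros)
    show "openin (top_of_set (cn n)) {s \<in> cn n. \<forall>r\<in>R. \<kappa> r s \<in> - {0}}"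
      by (rule openin_cn_conds) (auto simp: R_def \<kappa>_def intro!: continuous_intros)
  qed
  have \<kappa>p: "\<kappa> r p = of_nat r - of_nat (Suc l)" for r
    by (simp add: \<kappa>_def pn l_def)
  have pn1: "p n - 1 = - of_nat (Suc K)" by (simp add: pn)
  have pn1': "p n \<noteq> 1"
  proof
    assume "p n = 1"
    then have "Re (p n) = 1" by simp
    then show False by (simp add: pn)
  qed
  have pV: "p \<in> V"
    using pL pcn pn1' by (auto simp: V_def R_def \<kappa>p simp del: of_nat_Suc)
  have \<Psi>V: "holo_n n \<Psi> V"
    unfolding \<Psi>_def \<Phi>_def d_def
  proof (intro holo_n_add holo_n_sum holo_n_divide holo_n_mult A \<kappa> holo_n_diff holo_n_coord holo_n_const
      holo_n_coord_comp[OF holomorphic_expansion_coeff])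
    show "holo_n n (error_series q L) V"
      by (rule holo_n_subset[OF holo_n_error_series[OF q L(1)]]) (auto simp: V_def)
  qed (auto simp: V_def)
  obtain r1 C1 where r1: "r1 > 0" "C1 \<ge> 0" "polydisc n p r1 \<subseteq> V"
    "\<And>x y. x \<in> polydisc n p r1 \<Longrightarrow> y \<in> polydisc n p r1 \<Longrightarrow>
       cmod (\<Psi> x - \<Psi> y) \<le> C1 * (\<Sum>j=1..n. cmod (x j - y j))"
  proof (rule holo_n_lipschitz[OF Vop \<Psi>V pV], goal_cases)
    case (1 r C)
    show ?case by (rule 1(1)[OF 1(2-5)])
  qed
  \<comment> \<open>The exceptional term evaluates \<open>G\<close> near this point, which lies on
    the polar hyperplane \<open>s (Suc k) = 1\<close>.\<close>
  define p' where "p' = shift (Suc k) (of_nat l) p"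
  have p'cn: "p' \<in> cn (Suc k)" unfolding p'_def by (rule shift_cn) simp
  obtain r2 C2 where r2: "r2 > 0" "C2 \<ge> 0" "polydisc (Suc k) p' r2 \<subseteq> cn (Suc k)"
    "\<And>x y. x \<in> polydisc (Suc k) p' r2 \<Longrightarrow> y \<in> polydisc (Suc k) p' r2 \<Longrightarrow>
       cmod (G x - G y) \<le> C2 * (\<Sum>j=1..Suc k. cmod (x j - y j))"
  proof (rule holo_n_lipschitz[OF openin_subtopology_self G p'cn], goal_cases)
    case (1 r C)
    show ?case by (rule 1(1)[OF 1(2-5)])
  qed
  define Z where "Z = (\<lambda>i. zeta_cont (Suc k) (Suc k) \<gamma> b \<nu> (rst (Suc k) (\<lambda>j. - of_int (Nstar n N i j))))"
  have shp: "shift (Suc k) c' p = rst (Suc k) (\<lambda>j. - of_int (Nstar n N i j))" if "c' = - of_int i" for c' i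
    using that by (auto simp: fun_eq_iff shift_def rst_def Nstar_def p_def)
  have quot: "A r p / \<kappa> r p = Z (1 - int r)" if "r < Suc l" for r
  proof -
    define s where "s = shift (Suc k) (of_nat r - 1) p"
    have s: "s = rst (Suc k) (\<lambda>j. - of_int (Nstar n N (1 - int r) j))"
      unfolding s_def by (rule shp) simp
    have last: "s (Suc k) = - of_nat (M + K + 1 - r)"
      unfolding s_def shift_last pn using that by (simp add: of_nat_diff l_def)
    have "s \<in> cn (Suc k)" unfolding s by (rule rst_cn)
    from Zval[OF this last] have "Z (1 - int r) = G s / (s (Suc k) - 1)" by (simp only: Z_def s)
    moreover have "\<kappa> r p = s (Suc k) - 1" unfolding s_def shift_last \<kappa>_def by simp
    ultimately show ?thesis by (simp add: A_def s_def)
  qed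
  have d_div: "d (Suc i) s / (s n - 1) = ((- s n) gchoose i) * (\<gamma> n ^ i * q i)" if "s n \<noteq> 1" for i s
    using that by (simp add: d_def expansion_coeff_Suc pole_factor_def)
  have \<Phi>S: "\<Phi> (Suc i) s = ((- s n) gchoose i) * (\<gamma> n ^ i * q i) * (A (Suc i) s / \<kappa> (Suc i) s)"
    if "s n \<noteq> 1" for i s
    unfolding d_div[where s = s, OF that, symmetric] \<Phi>_def by simp
  have gK: "((- p n) gchoose i) = of_nat (K choose i)" for i
    by (simp add: pn binomial_gbinomial)
  have \<Psi>p: "\<Psi> p = - (1 / of_nat (K + 1)) * Z 1 * inverse (\<gamma> n)
      + (\<Sum>i=0..K. of_nat (K choose i) * Z (- int i) * q i * \<gamma> n ^ i)"
  proof -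
    have "error_series q L p = 0" by (rule error_series_eq_0[OF q]) (use pn L in auto)
    then have "\<Psi> p = (\<Sum>r\<in>R. \<Phi> r p)" by (simp add: \<Psi>_def)
    \<comment> \<open>\<open>r = 0\<close> yields the first term of the formula and
      \<open>r = Suc i\<close> with \<open>i \<le> K\<close> the finite sum; for
      \<open>i > K\<close> the coefficient contains \<open>K choose i\<close>, which is 0.\<close>
    also have "\<dots> = (\<Sum>r\<in>insert 0 (Suc ` {0..K}). \<Phi> r p)"
    proof (rule sum.mono_neutral_right)
      show "insert 0 (Suc ` {0..K}) \<subseteq> R" using L by (auto simp: R_def l_def)
      show "\<forall>r\<in>R - insert 0 (Suc ` {0..K}). \<Phi> r p = 0"
      proof
        fix r assume r: "r \<in> R - insert 0 (Suc ` {0..K})"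
        then obtain i where i: "r = Suc i" by (cases r) auto
        with r have "i > K" by auto
        then have "((- p n) gchoose i) = 0" unfolding gK by (simp add: binomial_eq_0)
        then show "\<Phi> r p = 0" unfolding i \<Phi>S[where s = p, OF pn1'] by simp
      qed
    qed (simp add: R_def)
    also have "\<dots> = \<Phi> 0 p + (\<Sum>i=0..K. \<Phi> (Suc i) p)"
    proof -
      have "(\<Sum>r\<in>Suc ` {0..K}. \<Phi> r p) = (\<Sum>i=0..K. \<Phi> (Suc i) p)"
        using sum.reindex[of Suc "{0..K}" "\<lambda>r. \<Phi> r p"] by (simp only: o_def inj_Suc)
      moreover have "(\<Sum>r\<in>insert 0 (Suc ` {0..K}). \<Phi> r p) = \<Phi> 0 p + (\<Sum>r\<in>Suc ` {0..K}. \<Phi> r p)"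
        by (rule sum.insert) auto
      ultimately show ?thesis by simp
    qed
    also have "\<Phi> 0 p = - (1 / of_nat (K + 1)) * Z 1 * inverse (\<gamma> n)"
      unfolding \<Phi>_def quot[OF zero_less_Suc] pn1 d_def expansion_coeff_0 Suc_eq_plus1[symmetric]
      by (simp del: of_nat_Suc)
    also have "(\<Sum>i=0..K. \<Phi> (Suc i) p) = (\<Sum>i=0..K. of_nat (K choose i) * Z (- int i) * q i * \<gamma> n ^ i)"
    proof (rule sum.cong[OF refl])
      fix i assume "i \<in> {0..K}"
      then have "Suc i < Suc l" by (simp add: l_def)
      from quot[OF this] show "\<Phi> (Suc i) p = of_nat (K choose i) * Z (- int i) * q i * \<gamma> n ^ i"
        unfolding \<Phi>S[where s = p, OF pn1'] gK by simp
    qed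
    finally show ?thesis .
  qed
  have terms: "main_terms N \<epsilon> \<delta> = \<Psi> p + c * (\<epsilon> (\<delta> n) / (\<delta> (Suc k) + \<delta> n)) * zeta_cont k k \<gamma> b \<nu> (rst k (\<lambda>j. \<delta> j - of_nat (N j)))
      * q l * inverse (\<gamma> (Suc k)) * \<gamma> n ^ l" for \<delta>
    unfolding main_terms_def hur \<Psi>p c_def Z_def l_def M_def K_def ..
  define Q where "Q = \<gamma> n ^ l * q l"
  \<comment> \<open>The merged coordinate moves by a sum of two increments, hence
    \<open>r2 / 2\<close>. The bound \<open>1 / 2\<close> forces \<open>cmod \<eta> < 1\<close>, so
    a nonzero \<eta> is not an integer and \<open>s\<close> avoids the hyperplanes; it also keeps
    \<open>\<delta> n\<close> in the disc where \<epsilon> is estimated.\<close>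
  define \<rho> where "\<rho> = min r1 (min (r2 / 2) (1 / 2))"
  have \<rho>: "\<rho> > 0" "\<rho> \<le> r1" "2 * \<rho> \<le> r2" "2 * \<rho> \<le> 1" using r1(1) r2(1) by (auto simp: \<rho>_def)
  define C where "C = C1 * real n + cmod c * (1 + C3) * cmod Q * C2"
  have bound: "cmod (F (rst n (\<lambda>j. \<delta> j - of_nat (N j))) - main_terms N \<epsilon> \<delta>) \<le> C * Max ((\<lambda>j. cmod (\<delta> j)) ` {1..n})"
    if \<delta>: "\<delta> \<in> cn n" "\<delta> (Suc k) + \<delta> n \<noteq> 0" "\<And>j. j \<in> {1..n} \<Longrightarrow> cmod (\<delta> j) < \<rho>" for \<delta>
  proof -
    define s where "s = rst n (\<lambda>j. \<delta> j - of_nat (N j))"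
    define \<eta> where "\<eta> = \<delta> (Suc k) + \<delta> n"
    define m where "m = Max ((\<lambda>j. cmod (\<delta> j)) ` {1..n})"
    have \<delta>m: "cmod (\<delta> j) \<le> m" if "j \<in> {1..n}" for j
      unfolding m_def by (rule Max_ge) (use that in auto)
    have m0: "m \<ge> 0" by (rule order_trans[OF norm_ge_zero \<delta>m[of n]]) simp
    have sp: "s j - p j = \<delta> j" if "j \<in> {1..n}" for j
      using that by (simp add: s_def p_def rst_def)
    have sP: "s \<in> polydisc n p r1"
      unfolding polydisc_def
    proof (intro CollectI conjI ballI)
      show "s \<in> cn n" unfolding s_def by (rule rst_cn)
      fix j assume j: "j \<in> {1..n}"
      show "cmod (s j - p j) < r1" unfolding sp[OF j] using \<delta>(3)[OF j] \<rho>(2) by linarith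
    qed
    then have sV: "s \<in> V" using r1(3) by blast
    have sn: "s n = \<delta> n - of_nat K" "s (Suc k) = \<delta> (Suc k) - of_nat M"
      by (simp_all add: s_def rst_def K_def M_def)
    have \<eta>0: "\<eta> \<noteq> 0" using \<delta>(2) by (simp add: \<eta>_def)
    have \<eta>small: "cmod \<eta> < 2 * \<rho>"
      using norm_triangle_ineq[of "\<delta> (Suc k)" "\<delta> n"] \<delta>(3)[of n] \<delta>(3)[of "Suc k"] by (simp add: \<eta>_def)
    have sE: "s \<in> regular_set"
    proof -
      have "s (Suc k) + s n \<noteq> of_int i" for i
      proof
        assume "s (Suc k) + s n = of_int i"
        then have "\<eta> = of_int (i + int M + int K)" by (simp add: sn \<eta>_def algebra_simps)
        then have e: "\<eta> = of_int j" if "j = i + int M + int K" for j using that by simp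
        define j where "j = i + int M + int K"
        have j: "\<eta> = of_int j" by (rule e) (rule j_def)
        then have "cmod \<eta> = real_of_int \<bar>j\<bar>" by simp
        moreover have "j \<noteq> 0" using \<eta>0 j by auto
        ultimately show False using \<eta>small \<rho>(4) by linarith
      qed
      then show ?thesis using sV by (auto simp: regular_set_def V_def)
    qed
    have s1: "s n \<noteq> 1" "s \<in> shifted_region n L" using sV by (auto simp: V_def)
    define S where "S = shift (Suc k) (of_nat l) s"
    \<comment> \<open>The projection of \<open>S\<close> to the polar hyperplane; its first
      \<open>k\<close> coordinates remain perturbed, which puts \<delta> into the last zeta factor
      of the formula.\<close>
    define t where "t = S(Suc k := 1)"
    have Sl: "S (Suc k) = 1 + \<eta>"
      unfolding S_def shift_last sn by (simp add: l_def \<eta>_def)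
    have Scn: "S \<in> cn (Suc k)" unfolding S_def by (rule shift_cn) simp
    have tcn: "t \<in> cn (Suc k)" "t (Suc k) = 1" unfolding t_def by (auto intro: cn_upd Scn)
    have p'l: "p' (Suc k) = 1" unfolding p'_def shift_last pn by (simp add: l_def)
    have Sp: "S j - p' j = \<delta> j" if "j \<in> {1..k}" for j
      using that sp[of j] by (simp add: S_def p'_def shift_def)
    have SP: "S \<in> polydisc (Suc k) p' r2"
      unfolding polydisc_def
    proof (intro CollectI conjI ballI Scn)
      fix j assume j: "j \<in> {1..Suc k}"
      show "cmod (S j - p' j) < r2"
      proof (cases "j = Suc k")
        case True
        then show ?thesis using \<eta>small \<rho>(3) by (simp add: Sl p'l)
      next
        case False
        then have j': "j \<in> {1..k}" using j by auto
        then show ?thesis unfolding Sp[OF j'] using \<delta>(3)[of j] \<rho>(1,3) j by auto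
      qed
    qed
    have tP: "t \<in> polydisc (Suc k) p' r2"
      using SP tcn r2(1) p'l by (auto simp: polydisc_def t_def)
    have Gd: "cmod (G S - G t) \<le> C2 * cmod \<eta>"
    proof -
      have "(\<Sum>j=1..Suc k. cmod (S j - t j)) = (\<Sum>j=1..k. cmod (S j - t j)) + cmod (S (Suc k) - t (Suc k))"
        by simp
      also have "(\<Sum>j=1..k. cmod (S j - t j)) = 0" by (rule sum.neutral) (auto simp: t_def)
      finally have "(\<Sum>j=1..Suc k. cmod (S j - t j)) = cmod \<eta>" by (simp add: t_def Sl)
      then show ?thesis using r2(4)[OF SP tP] by simp
    qed
    have Gt: "G t = inverse (\<gamma> (Suc k)) * zeta_cont k k \<gamma> b \<nu> (rst k (\<lambda>j. \<delta> j - of_nat (N j)))"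
    proof -
      have "rst k t = rst k (\<lambda>j. \<delta> j - of_nat (N j))"
        by (auto simp: rst_def t_def S_def shift_def s_def fun_eq_iff)
      then show ?thesis using Gres[OF tcn] by simp
    qed
    define g where "g = ((of_nat K - \<delta> n) gchoose l)"
    have gc: "c * \<epsilon> (\<delta> n) = g" using c0 by (simp add: \<epsilon>_def g_def)
    have g_le: "cmod g \<le> cmod c * (1 + C3) * m"
    proof -
      have half: "cmod (\<delta> n) \<le> 1/2" using \<delta>(3)[of n] \<rho>(4) by simp
      have "cmod g = cmod c * cmod (\<epsilon> (\<delta> n))" unfolding gc[symmetric] norm_mult ..
      also have "\<dots> \<le> cmod c * ((1 + C3) * cmod (\<delta> n))"
        using \<epsilon>small[OF half] by (rule mult_left_mono) simp
      also have "\<dots> \<le> cmod c * ((1 + C3) * m)" using \<delta>m[of n] C3(1) by (intro mult_left_mono) auto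
      finally show ?thesis by (simp add: mult.assoc)
    qed
    have \<Phi>l: "\<Phi> (Suc l) s = g * Q * (G S / \<eta>)"
    proof -
      have "\<kappa> (Suc l) s = \<eta>" by (simp add: \<kappa>_def sn \<eta>_def l_def)
      moreover have "A (Suc l) s = G S" by (simp add: A_def S_def)
      ultimately show ?thesis unfolding \<Phi>S[where s = s, OF s1(1)] by (simp add: sn g_def Q_def)
    qed
    have "F s = \<Psi> s + \<Phi> (Suc l) s"
    proof -
      have "F s = ((\<Sum>r\<le>L. d r s * (A r s / \<kappa> r s)) + error_series q L s) / (s n - 1)"
        using F[OF L(1) s1(2) sE] by (simp only: A_def \<kappa>_def d_def untwisted)
      also have "\<dots> = (\<Sum>r\<le>L. \<Phi> r s) + error_series q L s / (s n - 1)"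
        by (simp add: \<Phi>_def add_divide_distrib sum_divide_distrib)
      also have "(\<Sum>r\<le>L. \<Phi> r s) = \<Phi> (Suc l) s + (\<Sum>r\<in>R. \<Phi> r s)"
        unfolding R_def using L(3) by (intro sum.remove) auto
      finally show ?thesis by (simp add: \<Psi>_def)
    qed
    then have "F s - main_terms N \<epsilon> \<delta> = (\<Psi> s - \<Psi> p) + g * Q * ((G S - G t) / \<eta>)"
      unfolding terms \<eta>_def[symmetric] \<Phi>l Gt gc[symmetric] Q_def by (simp add: diff_divide_distrib algebra_simps)
    also have "cmod \<dots> \<le> cmod (\<Psi> s - \<Psi> p) + cmod g * cmod Q * (cmod (G S - G t) / cmod \<eta>)"
      using norm_triangle_ineq[of "\<Psi> s - \<Psi> p" "g * Q * ((G S - G t) / \<eta>)"]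
      by (simp only: norm_mult norm_divide)
    also have "\<dots> \<le> C1 * (real n * m) + (cmod c * (1 + C3) * m) * cmod Q * C2"
    proof (intro add_mono mult_mono)
      have "cmod (\<Psi> s - \<Psi> p) \<le> C1 * (\<Sum>j=1..n. cmod (s j - p j))"
        by (rule r1(4)[OF sP polydisc_center[OF pcn r1(1)]])
      also have "(\<Sum>j=1..n. cmod (s j - p j)) \<le> (\<Sum>j=1..n. m)"
        using sp \<delta>m by (intro sum_mono) auto
      also have "(\<Sum>j=1..n. m) = real n * m" by simp
      finally show "cmod (\<Psi> s - \<Psi> p) \<le> C1 * (real n * m)" using r1(2) by (simp add: mult_left_mono)
      show "cmod (G S - G t) / cmod \<eta> \<le> C2" using Gd \<eta>0 by (simp add: divide_le_eq)
    qed (use g_le m0 C3(1) in auto)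
    also have "\<dots> = C * m" by (simp add: C_def algebra_simps)
    finally show ?thesis by (simp only: s_def m_def)
  qed
  have ev1: "\<exists>C. eventually (\<lambda>x. cmod (\<epsilon> x - x) \<le> C * cmod x ^ 2) (at 0)"
  proof (rule exI[of _ C3])
    show "eventually (\<lambda>x. cmod (\<epsilon> x - x) \<le> C3 * cmod x ^ 2) (at 0)"
      unfolding eventually_at by (rule exI[of _ "1/2"]) (use C3(2) in \<open>auto simp: dist_norm\<close>)
  qed
  obtain T where T: "open T" "polydisc n (\<lambda>_. 0) \<rho> = cn n \<inter> T"
    using openin_polydisc[of n "\<lambda>_. 0" \<rho>] by (auto simp: openin_open)
  have T0: "(\<lambda>_. 0) \<in> T"
  proof -
    have "(\<lambda>_. 0) \<in> polydisc n (\<lambda>_. 0) \<rho>" using \<rho>(1) by (simp add: polydisc_def cn_def)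
    then show ?thesis using T(2) by blast
  qed
  have ev2: "eventually (\<lambda>\<delta>. cmod (F (rst n (\<lambda>j. \<delta> j - of_nat (N j))) - main_terms N \<epsilon> \<delta>) \<le> C * Max ((\<lambda>j. cmod (\<delta> j)) ` {1..n}))
      (at (\<lambda>_. 0) within {\<delta> \<in> cn n. \<delta> (Suc k) + \<delta> n \<noteq> 0})"
    unfolding eventually_at_topological
  proof (intro exI[of _ T] conjI ballI impI T(1) T0)
    fix \<delta> assume "\<delta> \<in> T" "\<delta> \<in> {\<delta> \<in> cn n. \<delta> (Suc k) + \<delta> n \<noteq> 0}"
    then have "\<delta> \<in> polydisc n (\<lambda>_. 0) \<rho>" "\<delta> \<in> cn n" "\<delta> (Suc k) + \<delta> n \<noteq> 0" using T(2) by auto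
    moreover from this(1) have "cmod (\<delta> j) < \<rho>" if "j \<in> {1..n}" for j
      using that by (auto simp: polydisc_def)
    ultimately show "cmod (F (rst n (\<lambda>j. \<delta> j - of_nat (N j))) - main_terms N \<epsilon> \<delta>) \<le> C * Max ((\<lambda>j. cmod (\<delta> j)) ` {1..n})"
      by (intro bound)
  qed
  from ev1 ev2 show ?thesis by blast
qed

text \<open>\<open>F\<close> is the function from \<open>continuation\<close> divided by
  \<open>s n - 1\<close>. Near any point finitely many linear forms times \<open>s n - 1\<close>
  clear its poles; their product is nonzero on the convergence region, hence not identically
  zero.\<close>

lemma meromorphic_expansion:
  "\<exists>F. holo_n n F regular_set
     \<and> (\<forall>s\<in>conv_region n. F s = zeta_series n n \<gamma> b \<nu> s)
     \<and> meromorphic_n n F regular_set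
     \<and> (\<forall>N :: nat \<Rightarrow> nat. \<exists>\<epsilon> :: complex \<Rightarrow> complex.
          (\<exists>C. eventually (\<lambda>x. cmod (\<epsilon> x - x) \<le> C * cmod x ^ 2) (at 0))
        \<and> (\<exists>C. eventually (\<lambda>\<delta>. cmod (F (rst n (\<lambda>j. \<delta> j - of_nat (N j))) - main_terms N \<epsilon> \<delta>)
              \<le> C * Max ((\<lambda>j. cmod (\<delta> j)) ` {1..n}))
            (at (\<lambda>_. 0) within {\<delta> \<in> cn n. \<delta> (Suc k) + \<delta> n \<noteq> 0})))"
proof -
  obtain q where q: "admissible q" using lerch_coeffs_exist by blast
  obtain G where G: "holo_n (Suc k) G (cn (Suc k))"
    "\<forall>s\<in>conv_region (Suc k). G s = (s (Suc k) - 1) * zeta_series (Suc k) (Suc k) \<gamma> b \<nu> s"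
    "\<forall>s\<in>cn (Suc k). s (Suc k) = 1 \<longrightarrow> G s = inverse (\<gamma> (Suc k)) * zeta_cont k k \<gamma> b \<nu> (rst k s)"
    "\<forall>s\<in>cn (Suc k). \<forall>j. s (Suc k) = - of_nat j \<longrightarrow>
       zeta_cont (Suc k) (Suc k) \<gamma> b \<nu> s = G s / (s (Suc k) - 1)"
    using one_untwisted_continuation by (elim exE conjE)
  define A where "A = (\<lambda>r s. G (shift (Suc k) (of_nat r - 1) s))"
  define \<kappa> where "\<kappa> = (\<lambda>r s :: nat \<Rightarrow> complex. s (Suc k) + s n + of_nat r - (2::complex))"
  have A: "holo_n n (A r) U" for r U unfolding A_def by (rule holo_n_shift[OF _ G(1)]) simp
  have \<kappa>: "holo_n n (\<kappa> r) U" for r U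
    unfolding \<kappa>_def by (intro holo_n_add holo_n_diff holo_n_coord holo_n_const)
  have EcR: "conv_region n \<subseteq> off_hyperplanes"
    using conv_region_off_hyperplanes(2) by (auto simp: off_hyperplanes_def conv_region_def)
  have E\<kappa>: "\<kappa> r s \<noteq> 0" if "s \<in> off_hyperplanes" for r s
  proof
    assume "\<kappa> r s = 0"
    then have "s (Suc k) + s n = 2 - of_nat r" unfolding \<kappa>_def by (simp add: algebra_simps)
    then have "s (Suc k) + s n = of_int (2 - int r)" by simp
    moreover have "2 - int r \<le> 2" by simp
    ultimately show False using that unfolding off_hyperplanes_def by blast
  qed
  have base: "base_series r s * \<kappa> r s = A r s" if s: "s \<in> conv_region n" for r s
  proof -
    have sh: "shift (Suc k) (of_nat r - 1) s \<in> conv_region (Suc k)"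
      by (rule shift_conv_region[OF _ s]) auto
    show ?thesis
      unfolding A_def bspec[OF G(2) sh] shift_last using base_series_eq[of r s]
      by (simp add: \<kappa>_def algebra_simps)
  qed
  obtain F0 where F0: "holo_n n F0 off_hyperplanes"
    "\<And>s. s \<in> conv_region n \<Longrightarrow> F0 s = cleared_series s"
    "\<And>L s. L \<ge> 1 \<Longrightarrow> s \<in> shifted_region n L \<Longrightarrow> s \<in> off_hyperplanes \<Longrightarrow>
       F0 s = (\<Sum>r\<le>L. zcoeff q r (s n) * (A r s / \<kappa> r s)) + error_series q L s"
    "\<And>L. L \<ge> 1 \<Longrightarrow> \<exists>g. holo_n n g (shifted_region n L) \<and>
       (\<forall>s \<in> shifted_region n L \<inter> off_hyperplanes. F0 s * (\<Prod>r\<le>L. \<kappa> r s) = g s)"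
  proof (rule continuation[where A = A and k = \<kappa> and E = off_hyperplanes, OF q], goal_cases)
    case (8 F)
    show ?case by (rule 8(1)[OF 8(2-5)])
  qed (use A \<kappa> EcR E\<kappa> base base_summable openin_off_hyperplanes in blast)+
  define F where "F = (\<lambda>s. F0 s / (s n - 1))"
  have RE: "s \<in> off_hyperplanes" "s n \<noteq> 1" "s \<in> cn n" if "s \<in> regular_set" for s
    using that by (auto simp: regular_set_def off_hyperplanes_def)
  have "holo_n n F regular_set"
    unfolding F_def
  proof (rule holo_n_divide)
    show "holo_n n F0 regular_set" by (rule holo_n_subset[OF F0(1)]) (use RE in blast)
    show "holo_n n (\<lambda>s. s n - 1) regular_set" by (intro holo_n_diff holo_n_coord holo_n_const)
  qed (use RE(2) in auto)
  moreover have "F s = zeta_series n n \<gamma> b \<nu> s" if "s \<in> conv_region n" for s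
    using F0(2)[OF that] conv_region_off_hyperplanes(1)[OF that] untwisted
    by (simp add: F_def pole_factor_def)
  moreover have "meromorphic_n n F regular_set"
    unfolding meromorphic_n_def
  proof
    fix p assume p: "p \<in> cn n"
    obtain L where "p \<in> shifted_region n L" using shifted_region_exhausts[OF p] by blast
    then have pL: "p \<in> shifted_region n (Suc L)" using shifted_region_mono[of L "Suc L"] by auto
    have L1: "Suc L \<ge> 1" by simp
    obtain g where g: "holo_n n g (shifted_region n (Suc L))"
      "\<forall>s \<in> shifted_region n (Suc L) \<inter> off_hyperplanes. F0 s * (\<Prod>r\<le>Suc L. \<kappa> r s) = g s"
      using F0(4)[OF L1] by (elim exE conjE)
    obtain c where c: "c \<in> conv_region n" using conv_region_nonempty[of n] by auto
    define h where "h = (\<lambda>s::nat \<Rightarrow> complex. (s n - 1) * (\<Prod>r\<le>Suc L. \<kappa> r s))"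
    have "holo_n n h (shifted_region n (Suc L))"
      unfolding h_def by (intro holo_n_mult holo_n_prod \<kappa> holo_n_diff holo_n_coord holo_n_const)
    moreover have "h c \<noteq> 0"
      unfolding h_def using E\<kappa> EcR c conv_region_off_hyperplanes(1)[OF c] by (auto simp del: prod.atMost_Suc)
    moreover have "c \<in> shifted_region n (Suc L)" using c conv_region_subset by blast
    moreover have "F x * h x = g x" if "x \<in> shifted_region n (Suc L) \<inter> regular_set" for x
    proof -
      have "F x * h x = F0 x * (\<Prod>r\<le>Suc L. \<kappa> r x)"
        unfolding F_def h_def using RE(2)[of x] that by simp
      then show ?thesis using g(2) RE(1)[of x] that by simp
    qed
    ultimately show "\<exists>V g h. openin (top_of_set (cn n)) V \<and> p \<in> V \<and> connected V \<and>
        holo_n n g V \<and> holo_n n h V \<and> (\<exists>x\<in>V. h x \<noteq> 0) \<and> (\<forall>x\<in>V \<inter> regular_set. F x * h x = g x)"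
      using pL g(1) openin_shifted_region connected_shifted_region
      by (intro exI[of _ "shifted_region n (Suc L)"] exI[of _ g] exI[of _ h]) blast
  qed
  moreover have "\<exists>\<epsilon>. (\<exists>C. eventually (\<lambda>x. cmod (\<epsilon> x - x) \<le> C * cmod x ^ 2) (at 0))
      \<and> (\<exists>C. eventually (\<lambda>\<delta>. cmod (F (rst n (\<lambda>j. \<delta> j - of_nat (N j))) - main_terms N \<epsilon> \<delta>)
            \<le> C * Max ((\<lambda>j. cmod (\<delta> j)) ` {1..n}))
          (at (\<lambda>_. 0) within {\<delta> \<in> cn n. \<delta> (Suc k) + \<delta> n \<noteq> 0}))" for N :: "nat \<Rightarrow> nat"
  proof (rule expansion_at_nonpositive_integers[OF q G(1)])
    fix L s assume "(1::nat) \<le> L" "s \<in> shifted_region n L" "s \<in> regular_set"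
    then show "F s = ((\<Sum>r\<le>L. zcoeff q r (s n) * (G (shift (Suc k) (of_nat r - 1) s) / (s (Suc k) + s n + of_nat r - 2)))
        + error_series q L s) / (s n - 1)"
      unfolding F_def using F0(3)[of L s] RE(1)[of s] by (simp only: A_def \<kappa>_def)
  qed (use G(3,4) in blast)+
  ultimately show ?thesis by blast
qed

end

section \<open>Transfer from the data of the theorem to full lists of twists\<close>

lemma zeta_series_cong:
  assumes k: "k \<le> n" and "\<And>j. j \<in> {1..n} \<Longrightarrow> \<gamma> j = \<gamma>' j" "\<And>j. j \<in> {1..n} \<Longrightarrow> b j = b' j"
    and \<mu>: "\<And>j. j \<in> {1..k} \<Longrightarrow> \<mu> j = \<nu> j" "\<And>j. j \<in> {k<..n} \<Longrightarrow> \<nu> j = 1"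
  shows "zeta_series n k \<gamma> b \<mu> = zeta_series n n \<gamma>' b' \<nu>"
proof -
  have "zeta_term n k \<gamma> b \<mu> s m = zeta_term n n \<gamma>' b' \<nu> s m" for s m
  proof -
    have "(\<Prod>j=1..k. \<mu> j ^ m j) = (\<Prod>j=1..k. \<nu> j ^ m j)" by (rule prod.cong) (use \<mu> in auto)
    also have "\<dots> = (\<Prod>j=1..n. \<nu> j ^ m j)"
      by (rule prod.mono_neutral_left) (use k \<mu>(2) in auto)
    finally have 1: "(\<Prod>j=1..k. \<mu> j ^ m j) = (\<Prod>j=1..n. \<nu> j ^ m j)" .
    have "(\<Sum>i=1..j. \<gamma> i * of_nat (m i)) + b j = (\<Sum>i=1..j. \<gamma>' i * of_nat (m i)) + b' j" if "j \<in> {1..n}" for j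
    proof -
      have "(\<Sum>i=1..j. \<gamma> i * of_nat (m i)) = (\<Sum>i=1..j. \<gamma>' i * (of_nat (m i) :: complex))"
        by (rule sum.cong) (use that assms(2) in auto)
      then show ?thesis using assms(3)[OF that] by simp
    qed
    then have "(\<Prod>j=1..n. ((\<Sum>i=1..j. \<gamma> i * of_nat (m i)) + b j) powr s j) =
        (\<Prod>j=1..n. ((\<Sum>i=1..j. \<gamma>' i * of_nat (m i)) + b' j) powr s j)"
      by (intro prod.cong) auto
    with 1 show ?thesis by (simp only: zeta_term_def)
  qed
  then show ?thesis by (simp add: zeta_series_def fun_eq_iff)
qed

lemma zeta_cont_cong:
  "zeta_series n k \<gamma> b \<mu> = zeta_series n k' \<gamma>' b' \<mu>' \<Longrightarrow> zeta_cont n k \<gamma> b \<mu> = zeta_cont n k' \<gamma>' b' \<mu>'"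
  by (simp add: zeta_cont_def fun_eq_iff)

theorem theorem3p2:
  fixes n :: nat and \<gamma> b \<mu> :: "nat \<Rightarrow> complex"
  assumes n2: "n \<ge> 2"
    and gam: "\<forall>j\<in>{1..n}. Re (\<gamma> j) > 0"
    and bb: "\<forall>j\<in>{1..n}. Re (b j) > - Re (\<gamma> 1)"
    and b1: "b n - b (n-1) \<notin> nonpos_real"
    and b2: "(b n - b (n-1)) / \<gamma> n \<notin> nonpos_real"
    and mu: "\<forall>j\<in>{1..n-2}. cmod (\<mu> j) = 1 \<and> \<mu> j \<noteq> 1"
  shows "\<exists>F. holo_n n F {s \<in> cn n. s n \<noteq> 1 \<and> (\<forall>k::int. k \<le> 2 \<longrightarrow> s (n-1) + s n \<noteq> of_int k)}
        \<and> (\<forall>s\<in>conv_region n. F s = zeta_series n (n-2) \<gamma> b \<mu> s)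
        \<and> meromorphic_n n F {s \<in> cn n. s n \<noteq> 1 \<and> (\<forall>k::int. k \<le> 2 \<longrightarrow> s (n-1) + s n \<noteq> of_int k)}
        \<and> (\<forall>N :: nat \<Rightarrow> nat. \<exists>\<epsilon> :: complex \<Rightarrow> complex.
             (\<exists>C. eventually (\<lambda>x. cmod (\<epsilon> x - x) \<le> C * cmod x ^ 2) (at 0))
           \<and> (\<exists>C. eventually (\<lambda>\<delta>.
                cmod (F (rst n (\<lambda>j. \<delta> j - of_nat (N j)))
                  - ( - (1 / of_nat (N n + 1))
                        * zeta_cont (n-1) (n-2) (rst (n-1) \<gamma>) (rst (n-1) b) \<mu>
                            (rst (n-1) (\<lambda>j. - of_int (Nstar n N 1 j)))
                        * inverse (\<gamma> n)
                      + (\<Sum>l=0..N n. of_nat (N n choose l)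
                        * zeta_cont (n-1) (n-2) (rst (n-1) \<gamma>) (rst (n-1) b) \<mu>
                            (rst (n-1) (\<lambda>j. - of_int (Nstar n N (- int l) j)))
                        * hurwitz_zeta (- of_nat l) ((b n - b (n-1)) / \<gamma> n)
                        * \<gamma> n ^ l)
                      + ((-1) ^ (N (n-1) + 1) * fact (N n) * fact (N (n-1))
                           / fact (N (n-1) + N n + 1))
                        * (\<epsilon> (\<delta> n) / (\<delta> (n-1) + \<delta> n))
                        * zeta_cont (n-2) (n-2) (rst (n-2) \<gamma>) (rst (n-2) b) \<mu>
                            (rst (n-2) (\<lambda>j. \<delta> j - of_nat (N j)))
                        * hurwitz_zeta (- of_nat (N (n-1) + N n + 1)) ((b n - b (n-1)) / \<gamma> n)
                        * inverse (\<gamma> (n-1)) * \<gamma> n ^ (N (n-1) + N n + 1)))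
                \<le> C * Max ((\<lambda>j. cmod (\<delta> j)) ` {1..n}))
              (at (\<lambda>_. 0) within {\<delta> \<in> cn n. \<delta> (n-1) + \<delta> n \<noteq> 0})))"
proof -
  obtain k where n: "n = Suc (Suc k)" using n2 by (metis add_2_eq_Suc le_Suc_ex)
  have nm: "n - 1 = Suc k" "n - 2 = k" using n by auto
  \<comment> \<open>The entry at 0 is only the base point of the innermost step; \<open>b 1\<close>
    is a value satisfying the half-plane condition imposed on it.\<close>
  define b' where "b' = b(0 := b 1)"
  \<comment> \<open>Filling up with twists 1 turns every \<open>zeta_series\<close> involved into
    one with as many twists as variables, all taken from one list.\<close>
  define \<nu> where "\<nu> = (\<lambda>j. if j \<in> {1..k} then \<mu> j else 1)"
  interpret zeta_data "Suc k" \<gamma> b' \<nu>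
  proof
    show "Re (\<gamma> j) > 0" if "j \<in> {1..Suc (Suc k)}" for j using gam that n by auto
    show "Re (b' j) > - Re (\<gamma> 1)" if "j \<le> Suc (Suc k)" for j
      using bb that n by (cases "j = 0") (auto simp: b'_def)
    show "cmod (\<nu> j) = 1" if "j \<in> {1..Suc (Suc k)}" for j
      using mu by (auto simp: \<nu>_def nm)
  qed
  have \<beta>: "b n - b (Suc k) = \<beta>" unfolding \<beta>_def by (simp add: b'_def n)
  interpret double_pole k \<gamma> b' \<nu>
  proof
    show "\<nu> j \<noteq> 1" if "j \<in> {1..k}" for j using mu that by (simp add: \<nu>_def nm)
    show "\<beta> / \<gamma> (Suc (Suc k)) \<notin> nonpos_real" using b2[unfolded nm \<beta>] unfolding n .
  qed (auto simp: \<nu>_def)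
  have S: "zeta_series n k \<gamma> b \<mu> = zeta_series (Suc (Suc k)) (Suc (Suc k)) \<gamma> b' \<nu>"
    unfolding n by (rule zeta_series_cong) (auto simp: b'_def \<nu>_def)
  have Z1: "zeta_cont (Suc k) k (rst (Suc k) \<gamma>) (rst (Suc k) b) \<mu> = zeta_cont (Suc k) (Suc k) \<gamma> b' \<nu>"
    by (rule zeta_cont_cong, rule zeta_series_cong) (auto simp: b'_def \<nu>_def rst_def)
  have Z2: "zeta_cont k k (rst k \<gamma>) (rst k b) \<mu> = zeta_cont k k \<gamma> b' \<nu>"
    by (rule zeta_cont_cong, rule zeta_series_cong) (auto simp: b'_def \<nu>_def rst_def)
  show ?thesis
    unfolding nm \<beta> Z1 Z2 S unfolding n
    by (rule meromorphic_expansion[unfolded regular_set_def main_terms_def])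
qed

end
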